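(* Let $\Bbbk$ be a field, $\Omega$ a language, $\pi:\mathcal F_\Omega\to\mathcal P$ a quotient morphism of operads, and $S$ a set of polylinear polynomials generating $\mathrm{Ker}\,\pi$ as an operad ideal of $\mathcal F_\Omega$. Let $\pi^{(2)}:\mathcal F_{\Omega^{(2)}}\to\mathrm{di}\mathcal P$ and $\hat\pi^{(2)}:\mathcal F_{\Omega^{(2)}}\to\mathcal P^{(2)}=\mathcal F_{\Omega^{(2)}}/J(S)$ be the morphisms defined in the context. Then the kernels of $\pi^{(2)}$ and $\hat\pi^{(2)}$ coincide, so the operads $\mathcal P^{(2)}$ and $\mathrm{di}\mathcal P$ are equivalent (isomorphic).
   Context: Operads are symmetric operads in $\Bbbk$-vector spaces, $\mathcal P=\{\mathcal P(n)\}_{n\ge 1}$, with compositions $\gamma_{m_1,\dots,m_n}$, an identity in $\mathcal P(1)$ and $S_n$-actions. A morphism is a family of $S_n$-linear maps preserving compositions and identity; kernels are operad ideals, and quotient operads are taken by operad ideals. A language $\Omega=\{f_i\mid i\in I\}$ is a set of symbols with arities $\nu(f_i)=n_i\ge 2$. $\mathcal F_\Omega(n)$ is the space of polylinear elements of degree $n$ in $x_1,\dots,x_n$ of the free algebra of type $\Omega$; with composition by substitution, identity $x_1$, and $f^\sigma=f(x_{\sigma(1)},\dots,x_{\sigma(n)})$, these form the free operad $\mathcal F_\Omega$. A morphism from $\mathcal F_\Omega$ to an operad is uniquely determined by arbitrary prescribed images of the elements $f_i=f_i(x_1,\dots,x_{n_i})$. $\mathrm{Perm}(n)=\Bbbk^n$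 with standard basis $e^{(n)}_1,\dots,e^{(n)}_n$, composition $\gamma_{m_1,\dots,m_n}(e_k^{(n)};e_{j_1}^{(m_1)},\dots,e_{j_n}^{(m_n)})=e^{(m_1+\dots+m_n)}_{m_1+\dots+m_{k-1}+j_k}$, and action $(e_k^{(n)})^\sigma=e^{(n)}_{\sigma(k)}$. For an operad $\mathcal P$, $\mathrm{di}\mathcal P=\mathcal P\otimes\mathrm{Perm}$ is the Hadamard product: $\mathrm{di}\mathcal P(n)=\mathcal P(n)\otimes\mathrm{Perm}(n)$ with componentwise structure. $\Omega^{(2)}=\{f_i^k\mid i\in I,\ k=1,\dots,n_i\}$ with $\nu(f_i^k)=n_i$. The morphism $\zeta_\Omega:\mathcal F_{\Omega^{(2)}}\to\mathrm{di}\mathcal F_\Omega$ sends $f_i^k(x_1,\dots,x_{n_i})$ to $f_i(x_1,\dots,x_{n_i})\otimes e_k^{(n_i)}$, and $\pi^{(2)}$ is $\zeta_\Omega$ followed by $\pi\otimes\mathrm{id}:\mathrm{di}\mathcal F_\Omega\to\mathrm{di}\mathcal P$. The linear map $\rho(n):\mathcal F_\Omega(n)\otimes\mathrm{Perm}(n)\to\mathcal F_{\Omega^{(2)}}(n)$ is defined on $f\otimes e_k^{(n)}$, $f$ a monomial, as follows. View $f$ as a planar tree whose leaves are labeled by the variables (by $1,\dots,n$) and whose internal vertices are labeled by symbols of $\Omega$, a vertex labeled $f_i$ having $n_i$ outgoing branches; emphasize the leaf labeled $k$. Replace each vertex label $f_i$ by $f_i^q$ if the $q$-th (from the left) outgoing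 branch of that vertex contains the emphasized leaf, and by $f_i^1$ if no outgoing branch of that vertex contains it. $J(S)$ is the operad ideal of $\mathcal F_{\Omega^{(2)}}$ generated by all $$f^k(x_1,\dots,x_{j-1},g^l(x_j,\dots,x_{j+m-1}),x_{j+m},\dots,x_{n+m-1})-f^k(x_1,\dots,x_{j-1},g^p(x_j,\dots,x_{j+m-1}),x_{j+m},\dots,x_{n+m-1}),$$ for $f,g\in\Omega$, $n=\nu(f)$, $m=\nu(g)$, $k,j\in\{1,\dots,n\}$, $k\ne j$, $l,p\in\{1,\dots,m\}$, together with all $s^k=\rho(n)(s\otimes e_k^{(n)})$ for $s\in S\cap\mathcal F_\Omega(n)$, $n\ge1$, $k=1,\dots,n$. Finally $\mathcal P^{(2)}=\mathcal F_{\Omega^{(2)}}/J(S)$ and $\hat\pi^{(2)}$ is the quotient morphism. *)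

theory Defs
  imports
    "HOL-Library.Poly_Mapping"
    "HOL-Combinatorics.Permutations"
    "HOL-Algebra.Module"
    "HOL-Algebra.QuotRing"
begin

section \<open>Vector spaces\<close>

text \<open>
  The ground field is a type of class \<^class>\<open>field\<close>.  A vector space over it is a
  \<^locale>\<open>module\<close> over the following ring record; the fields \<^const>\<open>mult\<close> and
  \<^const>\<open>one\<close> of a module record carry no information.
\<close>

definition scalars :: "'k::field ring"
  where "scalars = \<lparr>carrier = UNIV, mult = (*), one = 1, zero = 0, add = (+)\<rparr>"

definition linear_map :: "('k::field, 'a) module \<Rightarrow> ('k, 'b) module \<Rightarrow> ('a \<Rightarrow> 'b) \<Rightarrow> bool"
  where "linear_map M N h \<longleftrightarrow>
    h \<in> carrier M \<rightarrow> carrier N \<and>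
    (\<forall>x\<in>carrier M. \<forall>y\<in>carrier M. h (x \<oplus>\<^bsub>M\<^esub> y) = h x \<oplus>\<^bsub>N\<^esub> h y) \<and>
    (\<forall>c. \<forall>x\<in>carrier M. h (c \<odot>\<^bsub>M\<^esub> x) = c \<odot>\<^bsub>N\<^esub> h x)"

definition linear_span :: "('k::field, 'a) module \<Rightarrow> 'a set \<Rightarrow> 'a set"
  where "linear_span M X = \<Inter>{H. submodule H scalars M \<and> X \<subseteq> H}"

text \<open>The operations on cosets follow the pattern of \<^const>\<open>rcoset_mult\<close>: apply the
  operation to all representatives.\<close>

definition quotient_module :: "('k::field, 'a) module \<Rightarrow> 'a set \<Rightarrow> ('k, 'a set) module"
  where "quotient_module M H =
    \<lparr>carrier = a_rcosets\<^bsub>M\<^esub> H, mult = undefined, one = undefined,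
     zero = H, add = set_add M,
     smult = (\<lambda>c X. \<Union>x\<in>X. H +>\<^bsub>M\<^esub> (c \<odot>\<^bsub>M\<^esub> x))\<rparr>"

definition pm_scale :: "'k::field \<Rightarrow> ('x \<Rightarrow>\<^sub>0 'k) \<Rightarrow> ('x \<Rightarrow>\<^sub>0 'k)"
  where "pm_scale c p = Poly_Mapping.map ((*) c) p"

definition free_module :: "'x set \<Rightarrow> ('k::field, 'x \<Rightarrow>\<^sub>0 'k) module"
  where "free_module X =
    \<lparr>carrier = {p. Poly_Mapping.keys p \<subseteq> X}, mult = undefined, one = undefined,
     zero = 0, add = (+), smult = pm_scale\<rparr>"

definition basis :: "'x \<Rightarrow> ('x \<Rightarrow>\<^sub>0 'k::field)"
  where "basis x = Poly_Mapping.single x 1"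

text \<open>Linear extension of a map given on basis elements, and multilinear extension of an
  operation \<open>h x ys\<close> on basis elements to one scalar combination and a list of them.\<close>

definition lin_ext :: "('x \<Rightarrow> ('y \<Rightarrow>\<^sub>0 'k)) \<Rightarrow> ('x \<Rightarrow>\<^sub>0 'k::field) \<Rightarrow> ('y \<Rightarrow>\<^sub>0 'k)"
  where "lin_ext f p = (\<Sum>x\<in>Poly_Mapping.keys p. pm_scale (Poly_Mapping.lookup p x) (f x))"

definition multilin_ext ::
    "('x \<Rightarrow> 'y list \<Rightarrow> 'z) \<Rightarrow> ('x \<Rightarrow>\<^sub>0 'k::field) \<Rightarrow> ('y \<Rightarrow>\<^sub>0 'k) list \<Rightarrow> ('z \<Rightarrow>\<^sub>0 'k)"
  where "multilin_ext h p qs =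
    (\<Sum>x\<in>Poly_Mapping.keys p. \<Sum>ys\<in>listset (map Poly_Mapping.keys qs).
       pm_scale (Poly_Mapping.lookup p x * (\<Prod>i<length qs. Poly_Mapping.lookup (qs ! i) (ys ! i))) (basis (h x ys)))"


section \<open>Operads\<close>

text \<open>
  \<open>op_comp P [m\<^sub>1,\<dots>,m\<^sub>n] a [b\<^sub>1,\<dots>,b\<^sub>n]\<close> is the composition
  \<open>\<gamma>\<close> with indices \<open>m\<^sub>1,\<dots>,m\<^sub>n\<close>, and \<open>op_act P n \<sigma> a\<close> is \<open>a\<^sup>\<sigma>\<close>.
  Only the components with \<open>n \<ge> 1\<close> are meaningful.
\<close>

record ('k, 'a) operad =
  component :: "nat \<Rightarrow> ('k, 'a) module"
  op_comp :: "nat list \<Rightarrow> 'a \<Rightarrow> 'a list \<Rightarrow> 'a"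
  op_unit :: 'a
  op_act :: "nat \<Rightarrow> (nat \<Rightarrow> nat) \<Rightarrow> 'a \<Rightarrow> 'a"

definition positive_arities :: "nat list \<Rightarrow> bool"
  where "positive_arities ms \<longleftrightarrow> ms \<noteq> [] \<and> (\<forall>m\<in>set ms. m \<ge> 1)"

definition op_args :: "('k, 'a) operad \<Rightarrow> nat list \<Rightarrow> 'a list \<Rightarrow> bool"
  where "op_args P ms bs \<longleftrightarrow> list_all2 (\<lambda>m b. b \<in> carrier (component P m)) ms bs"

text \<open>Concatenating blocks of sizes \<open>ms\<close>, the block with list index \<open>i\<close> (counted from
  \<open>0\<close>) consists of the positions \<open>offset ms i + j\<close> with \<open>1 \<le> j \<le> ms ! i\<close>.\<close>

definition offset :: "nat list \<Rightarrow> nat \<Rightarrow> nat"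
  where "offset ms i = sum_list (take i ms)"

text \<open>
  As \<open>f\<^sup>\<sigma> = f(x\<^bsub>\<sigma>(1)\<^esub>,\<dots>,x\<^bsub>\<sigma>(n)\<^esub>)\<close>, one has
  \<open>(a\<^sup>\<sigma>)\<^sup>\<tau> = a\<^bsup>\<tau> \<circ> \<sigma>\<^esup>\<close>, where \<open>\<circ>\<close> is composition of functions.  In the equivariance axioms
  \<open>\<tau>\<close> is the uniquely determined block sum, respectively block permutation.
\<close>

locale operad =
  fixes P :: "('k::field, 'a) operad"
  assumes component_module: "n \<ge> 1 \<Longrightarrow> module scalars (component P n)"
    and unit_closed: "op_unit P \<in> carrier (component P 1)"
    and act_linear: "\<lbrakk>n \<ge> 1; \<sigma> permutes {1..n}\<rbrakk> \<Longrightarrow>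
      linear_map (component P n) (component P n) (op_act P n \<sigma>)"
    and act_id: "\<lbrakk>n \<ge> 1; a \<in> carrier (component P n)\<rbrakk> \<Longrightarrow> op_act P n id a = a"
    and act_act: "\<lbrakk>n \<ge> 1; \<sigma> permutes {1..n}; \<tau> permutes {1..n}; a \<in> carrier (component P n)\<rbrakk>
      \<Longrightarrow> op_act P n \<tau> (op_act P n \<sigma> a) = op_act P n (\<tau> \<circ> \<sigma>) a"
    and comp_linear_left: "\<lbrakk>positive_arities ms; op_args P ms bs\<rbrakk> \<Longrightarrow>
      linear_map (component P (length ms)) (component P (sum_list ms)) (\<lambda>a. op_comp P ms a bs)"
    and comp_linear_right:
      "\<lbrakk>positive_arities ms; a \<in> carrier (component P (length ms)); op_args P ms bs; i < length ms\<rbrakk> \<Longrightarrow>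
      linear_map (component P (ms ! i)) (component P (sum_list ms))
        (\<lambda>b. op_comp P ms a (bs[i := b]))"
    and unit_left: "\<lbrakk>n \<ge> 1; a \<in> carrier (component P n)\<rbrakk> \<Longrightarrow> op_comp P [n] (op_unit P) [a] = a"
    and unit_right: "\<lbrakk>n \<ge> 1; a \<in> carrier (component P n)\<rbrakk> \<Longrightarrow>
      op_comp P (replicate n 1) a (replicate n (op_unit P)) = a"
    and comp_assoc: "\<lbrakk>positive_arities (map length kss); \<forall>ks\<in>set kss. positive_arities ks;
      a \<in> carrier (component P (length kss)); op_args P (map length kss) bs;
      list_all2 (op_args P) kss css\<rbrakk> \<Longrightarrow>
      op_comp P (concat kss) (op_comp P (map length kss) a bs) (concat css) =
      op_comp P (map sum_list kss) a
        (map (\<lambda>i. op_comp P (kss ! i) (bs ! i) (css ! i)) [0..<length kss])"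
    and equivariance_inner: "\<lbrakk>positive_arities ms; a \<in> carrier (component P (length ms)); op_args P ms bs;
      length \<sigma>s = length ms; \<forall>i<length ms. \<sigma>s ! i permutes {1..ms ! i};
      \<tau> permutes {1..sum_list ms};
      \<forall>i<length ms. \<forall>j\<in>{1..ms ! i}. \<tau> (offset ms i + j) = offset ms i + (\<sigma>s ! i) j\<rbrakk> \<Longrightarrow>
      op_comp P ms a (map (\<lambda>i. op_act P (ms ! i) (\<sigma>s ! i) (bs ! i)) [0..<length ms]) =
      op_act P (sum_list ms) \<tau> (op_comp P ms a bs)"
    and equivariance_outer: "\<lbrakk>positive_arities ms; a \<in> carrier (component P (length ms)); op_args P ms bs;
      \<sigma> permutes {1..length ms};
      ms' = map (\<lambda>i. ms ! (\<sigma> i - 1)) [1..<length ms + 1];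
      bs' = map (\<lambda>i. bs ! (\<sigma> i - 1)) [1..<length ms + 1];
      \<tau> permutes {1..sum_list ms};
      \<forall>i\<in>{1..length ms}. \<forall>j\<in>{1..ms ! (\<sigma> i - 1)}.
        \<tau> (offset ms' (i - 1) + j) = offset ms (\<sigma> i - 1) + j\<rbrakk> \<Longrightarrow>
      op_comp P ms (op_act P (length ms) \<sigma> a) bs =
      op_act P (sum_list ms) \<tau> (op_comp P ms' a bs')"

definition operad_hom ::
    "('k::field, 'a) operad \<Rightarrow> ('k, 'b) operad \<Rightarrow> (nat \<Rightarrow> 'a \<Rightarrow> 'b) set"
  where "operad_hom P Q = {\<phi>.
    (\<forall>n\<ge>1. linear_map (component P n) (component Q n) (\<phi> n)) \<and>
    (\<forall>n\<ge>1. \<forall>\<sigma>. \<forall>a\<in>carrier (component P n).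
       \<sigma> permutes {1..n} \<longrightarrow> \<phi> n (op_act P n \<sigma> a) = op_act Q n \<sigma> (\<phi> n a)) \<and>
    \<phi> 1 (op_unit P) = op_unit Q \<and>
    (\<forall>ms bs. \<forall>a\<in>carrier (component P (length ms)). positive_arities ms \<longrightarrow> op_args P ms bs \<longrightarrow>
       \<phi> (sum_list ms) (op_comp P ms a bs) = op_comp Q ms (\<phi> (length ms) a) (map2 \<phi> ms bs))}"

definition operad_iso ::
    "('k::field, 'a) operad \<Rightarrow> ('k, 'b) operad \<Rightarrow> (nat \<Rightarrow> 'a \<Rightarrow> 'b) set"
  where "operad_iso P Q = {\<phi> \<in> operad_hom P Q.
    \<forall>n\<ge>1. bij_betw (\<phi> n) (carrier (component P n)) (carrier (component Q n))}"

definition operads_isomorphic :: "('k::field, 'a) operad \<Rightarrow> ('k, 'b) operad \<Rightarrow> bool"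
  where "operads_isomorphic P Q \<longleftrightarrow> operad_iso P Q \<noteq> {}"

definition operad_kernel ::
    "('k::field, 'a) operad \<Rightarrow> ('k, 'b) operad \<Rightarrow> (nat \<Rightarrow> 'a \<Rightarrow> 'b) \<Rightarrow> nat \<Rightarrow> 'a set"
  where "operad_kernel P Q \<phi> n = a_kernel (component P n) (component Q n) (\<phi> n)"

definition operad_ideal :: "('k::field, 'a) operad \<Rightarrow> (nat \<Rightarrow> 'a set) \<Rightarrow> bool"
  where "operad_ideal P I \<longleftrightarrow>
    (\<forall>n\<ge>1. submodule (I n) scalars (component P n)) \<and>
    (\<forall>n\<ge>1. \<forall>\<sigma>. \<forall>a\<in>I n. \<sigma> permutes {1..n} \<longrightarrow> op_act P n \<sigma> a \<in> I n) \<and>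
    (\<forall>ms bs. \<forall>a\<in>carrier (component P (length ms)). positive_arities ms \<longrightarrow> op_args P ms bs \<longrightarrow>
       a \<in> I (length ms) \<or> (\<exists>i<length ms. bs ! i \<in> I (ms ! i)) \<longrightarrow>
       op_comp P ms a bs \<in> I (sum_list ms))"

definition generated_ideal :: "('k::field, 'a) operad \<Rightarrow> 'a set \<Rightarrow> nat \<Rightarrow> 'a set"
  where "generated_ideal P S n =
    \<Inter>{I n | I. operad_ideal P I \<and> (\<forall>m\<ge>1. S \<inter> carrier (component P m) \<subseteq> I m)}"

definition quotient_operad ::
    "('k::field, 'a) operad \<Rightarrow> (nat \<Rightarrow> 'a set) \<Rightarrow> ('k, 'a set) operad"
  where "quotient_operad P I =
    \<lparr>component = (\<lambda>n. quotient_module (component P n) (I n)),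
     op_comp = (\<lambda>ms X Ys. \<Union>x\<in>X. \<Union>ys\<in>listset Ys.
       I (sum_list ms) +>\<^bsub>component P (sum_list ms)\<^esub> op_comp P ms x ys),
     op_unit = I 1 +>\<^bsub>component P 1\<^esub> op_unit P,
     op_act = (\<lambda>n \<sigma> X. \<Union>x\<in>X. I n +>\<^bsub>component P n\<^esub> op_act P n \<sigma> x)\<rparr>"

definition quotient_map :: "('k::field, 'a) operad \<Rightarrow> (nat \<Rightarrow> 'a set) \<Rightarrow> nat \<Rightarrow> 'a \<Rightarrow> 'a set"
  where "quotient_map P I n x = I n +>\<^bsub>component P n\<^esub> x"

text \<open>A quotient morphism is a morphism onto: by the first isomorphism theorem it is, up to
  isomorphism of the target, the projection modulo its kernel.\<close>

definition quotient_morphism ::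
    "('k::field, 'a) operad \<Rightarrow> ('k, 'b) operad \<Rightarrow> (nat \<Rightarrow> 'a \<Rightarrow> 'b) \<Rightarrow> bool"
  where "quotient_morphism P Q \<phi> \<longleftrightarrow> \<phi> \<in> operad_hom P Q \<and>
    (\<forall>n\<ge>1. \<phi> n ` carrier (component P n) = carrier (component Q n))"

text \<open>The operad whose components are spanned by sets \<open>B n\<close> equipped with composition, unit
  and symmetric group actions.\<close>

definition linearized_operad ::
    "(nat \<Rightarrow> 'x set) \<Rightarrow> (nat list \<Rightarrow> 'x \<Rightarrow> 'x list \<Rightarrow> 'x) \<Rightarrow> 'x \<Rightarrow>
     (nat \<Rightarrow> (nat \<Rightarrow> nat) \<Rightarrow> 'x \<Rightarrow> 'x) \<Rightarrow> ('k::field, 'x \<Rightarrow>\<^sub>0 'k) operad"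
  where "linearized_operad B cmp u act =
    \<lparr>component = (\<lambda>n. free_module (B n)),
     op_comp = (\<lambda>ms. multilin_ext (cmp ms)),
     op_unit = basis u,
     op_act = (\<lambda>n \<sigma>. lin_ext (\<lambda>x. basis (act n \<sigma> x)))\<rparr>"


section \<open>Hadamard products\<close>

text \<open>
  \<open>P(n) \<otimes> Q(n)\<close> is the free vector space on \<open>P(n) \<times> Q(n)\<close> modulo the span of the usual
  bilinearity relations; the componentwise structure on pure tensors is inherited from the
  linearization of \<open>P \<times> Q\<close>.
\<close>

definition tensor_relations ::
    "('k::field, 'a) module \<Rightarrow> ('k, 'b) module \<Rightarrow> (('a \<times> 'b) \<Rightarrow>\<^sub>0 'k) set"
  where "tensor_relations M N = linear_span (free_module (carrier M \<times> carrier N))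
    ({basis (x \<oplus>\<^bsub>M\<^esub> x', y) - basis (x, y) - basis (x', y) | x x' y.
        x \<in> carrier M \<and> x' \<in> carrier M \<and> y \<in> carrier N} \<union>
     {basis (x, y \<oplus>\<^bsub>N\<^esub> y') - basis (x, y) - basis (x, y') | x y y'.
        x \<in> carrier M \<and> y \<in> carrier N \<and> y' \<in> carrier N} \<union>
     {basis (c \<odot>\<^bsub>M\<^esub> x, y) - pm_scale c (basis (x, y)) | c x y.
        x \<in> carrier M \<and> y \<in> carrier N} \<union>
     {basis (x, c \<odot>\<^bsub>N\<^esub> y) - pm_scale c (basis (x, y)) | c x y.
        x \<in> carrier M \<and> y \<in> carrier N})"

definition hadamard_relations ::
    "('k::field, 'a) operad \<Rightarrow> ('k, 'b) operad \<Rightarrow> nat \<Rightarrow> (('a \<times> 'b) \<Rightarrow>\<^sub>0 'k) set"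
  where "hadamard_relations P Q n = tensor_relations (component P n) (component Q n)"

definition product_linearization ::
    "('k::field, 'a) operad \<Rightarrow> ('k, 'b) operad \<Rightarrow> ('k, ('a \<times> 'b) \<Rightarrow>\<^sub>0 'k) operad"
  where "product_linearization P Q = linearized_operad
    (\<lambda>n. carrier (component P n) \<times> carrier (component Q n))
    (\<lambda>ms x ys. (op_comp P ms (fst x) (map fst ys), op_comp Q ms (snd x) (map snd ys)))
    (op_unit P, op_unit Q)
    (\<lambda>n \<sigma> x. (op_act P n \<sigma> (fst x), op_act Q n \<sigma> (snd x)))"

definition hadamard ::
    "('k::field, 'a) operad \<Rightarrow> ('k, 'b) operad \<Rightarrow> ('k, (('a \<times> 'b) \<Rightarrow>\<^sub>0 'k) set) operad"
  where "hadamard P Q = quotient_operad (product_linearization P Q) (hadamard_relations P Q)"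

definition pure_tensor ::
    "('k::field, 'a) operad \<Rightarrow> ('k, 'b) operad \<Rightarrow> nat \<Rightarrow> 'a \<Rightarrow> 'b \<Rightarrow> (('a \<times> 'b) \<Rightarrow>\<^sub>0 'k) set"
  where "pure_tensor P Q n a b =
    quotient_map (product_linearization P Q) (hadamard_relations P Q) n (basis (a, b))"

text \<open>The morphism \<open>\<phi> \<otimes> id\<close> from \<open>P \<otimes> R\<close> to \<open>Q \<otimes> R\<close>.\<close>

definition hadamard_map ::
    "('k::field, 'b) operad \<Rightarrow> ('k, 'c) operad \<Rightarrow> (nat \<Rightarrow> 'a \<Rightarrow> 'b) \<Rightarrow> nat \<Rightarrow>
     (('a \<times> 'c) \<Rightarrow>\<^sub>0 'k) set \<Rightarrow> (('b \<times> 'c) \<Rightarrow>\<^sub>0 'k) set"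
  where "hadamard_map Q R \<phi> n X =
    (\<Union>p\<in>X. quotient_map (product_linearization Q R) (hadamard_relations Q R) n
      (lin_ext (\<lambda>(a, c). basis (\<phi> n a, c)) p))"

definition perm_operad :: "('k::field, nat \<Rightarrow>\<^sub>0 'k) operad"
  where "perm_operad = linearized_operad
    (\<lambda>n. {1..n}) (\<lambda>ms k js. offset ms (k - 1) + js ! (k - 1)) 1 (\<lambda>n \<sigma>. \<sigma>)"

abbreviation di :: "('k::field, 'a) operad \<Rightarrow> ('k, (('a \<times> (nat \<Rightarrow>\<^sub>0 'k)) \<Rightarrow>\<^sub>0 'k) set) operad"
  where "di P \<equiv> hadamard P perm_operad"


section \<open>Free operads\<close>

record 'f language =
  symbols :: "'f set"
  arity :: "'f \<Rightarrow> nat"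

definition language :: "'f language \<Rightarrow> bool"
  where "language L \<longleftrightarrow> (\<forall>f\<in>symbols L. arity L f \<ge> 2)"

datatype 'f monomial = Var nat | App 'f "'f monomial list"

fun well_formed :: "'f language \<Rightarrow> 'f monomial \<Rightarrow> bool" where
  "well_formed L (Var i) \<longleftrightarrow> True"
| "well_formed L (App f ts) \<longleftrightarrow>
     f \<in> symbols L \<and> length ts = arity L f \<and> (\<forall>t\<in>set ts. well_formed L t)"

fun leaves :: "'f monomial \<Rightarrow> nat list" where
  "leaves (Var i) = [i]"
| "leaves (App f ts) = concat (map leaves ts)"

fun subst :: "(nat \<Rightarrow> 'f monomial) \<Rightarrow> 'f monomial \<Rightarrow> 'f monomial" where
  "subst s (Var i) = s i"
| "subst s (App f ts) = App f (map (subst s) ts)"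

definition polylinear_monomials :: "'f language \<Rightarrow> nat \<Rightarrow> 'f monomial set"
  where "polylinear_monomials L n =
    {t. well_formed L t \<and> distinct (leaves t) \<and> set (leaves t) = {1..n}}"

text \<open>Substitute the \<open>i\<close>-th argument, with its variables shifted to the \<open>i\<close>-th block, for
  \<open>x\<^sub>i\<close>.\<close>

definition monomial_comp ::
    "nat list \<Rightarrow> 'f monomial \<Rightarrow> 'f monomial list \<Rightarrow> 'f monomial"
  where "monomial_comp ms t us =
    subst (\<lambda>i. subst (\<lambda>j. Var (offset ms (i - 1) + j)) (us ! (i - 1))) t"

definition free_operad :: "'f language \<Rightarrow> ('k::field, 'f monomial \<Rightarrow>\<^sub>0 'k) operad"
  where "free_operad L = linearized_operad (polylinear_monomials L) monomial_comp (Var 1)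
    (\<lambda>n \<sigma>. subst (\<lambda>i. Var (\<sigma> i)))"

definition generator :: "'f language \<Rightarrow> 'f \<Rightarrow> ('f monomial \<Rightarrow>\<^sub>0 'k::field)"
  where "generator L f = basis (App f (map Var [1..<arity L f + 1]))"

text \<open>The morphism with prescribed images of the generators; its values on the components
  are uniquely determined.\<close>

definition free_morphism ::
    "'f language \<Rightarrow> ('k::field, 'a) operad \<Rightarrow> ('f \<Rightarrow> 'a) \<Rightarrow> nat \<Rightarrow> ('f monomial \<Rightarrow>\<^sub>0 'k) \<Rightarrow> 'a"
  where "free_morphism L Q img = (SOME \<phi>. \<phi> \<in> operad_hom (free_operad L) Q \<and>
    (\<forall>f\<in>symbols L. \<phi> (arity L f) (generator L f) = img f))"


section \<open>The operads compared\<close>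

text \<open>The symbol \<open>f\<^sup>k\<close> is the pair \<open>(f, k)\<close>.\<close>

definition language2 :: "'f language \<Rightarrow> ('f \<times> nat) language"
  where "language2 L =
    \<lparr>symbols = (SIGMA f:symbols L. {1..arity L f}), arity = (\<lambda>(f, k). arity L f)\<rparr>"

definition zeta :: "'f language \<Rightarrow> nat \<Rightarrow> (('f \<times> nat) monomial \<Rightarrow>\<^sub>0 'k::field) \<Rightarrow>
    ((('f monomial \<Rightarrow>\<^sub>0 'k) \<times> (nat \<Rightarrow>\<^sub>0 'k)) \<Rightarrow>\<^sub>0 'k) set"
  where "zeta L = free_morphism (language2 L) (di (free_operad L))
    (\<lambda>(f, k). pure_tensor (free_operad L) perm_operad (arity L f) (generator L f) (basis k))"

definition pi2 :: "'f language \<Rightarrow> ('k::field, 'a) operad \<Rightarrow> (nat \<Rightarrow> ('f monomial \<Rightarrow>\<^sub>0 'k) \<Rightarrow> 'a) \<Rightarrow>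
    nat \<Rightarrow> (('f \<times> nat) monomial \<Rightarrow>\<^sub>0 'k) \<Rightarrow> (('a \<times> (nat \<Rightarrow>\<^sub>0 'k)) \<Rightarrow>\<^sub>0 'k) set"
  where "pi2 L P \<pi> n x = hadamard_map P perm_operad \<pi> n (zeta L n x)"

text \<open>The position, counted from \<open>1\<close>, of the branch with the leaf \<open>k\<close>; it is \<open>1\<close> if there
  is no such branch.\<close>

definition branch :: "nat \<Rightarrow> 'f monomial list \<Rightarrow> nat"
  where "branch k ts =
    (if \<exists>q\<in>{1..length ts}. k \<in> set (leaves (ts ! (q - 1)))
     then LEAST q. q \<in> {1..length ts} \<and> k \<in> set (leaves (ts ! (q - 1))) else 1)"

fun emphasize :: "nat \<Rightarrow> 'f monomial \<Rightarrow> ('f \<times> nat) monomial" where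
  "emphasize k (Var i) = Var i"
| "emphasize k (App f ts) = App (f, branch k ts) (map (emphasize k) ts)"

text \<open>The map \<open>f \<otimes> e\<^sub>k \<mapsto> emphasize k f\<close>, extended bilinearly to pairs and factored through
  the tensor product (the value does not depend on the representative \<open>p\<close> of the tensor).
  It is given by one formula for all \<open>n\<close>.\<close>

definition rho :: "((('f monomial \<Rightarrow>\<^sub>0 'k) \<times> (nat \<Rightarrow>\<^sub>0 'k)) \<Rightarrow>\<^sub>0 'k) set \<Rightarrow>
    (('f \<times> nat) monomial \<Rightarrow>\<^sub>0 'k::field)"
  where "rho X = the_elem (lin_ext (\<lambda>(a, v).
    lin_ext (\<lambda>t. lin_ext (\<lambda>k. basis (emphasize k t)) v) a) ` X)"

text \<open>\<open>nested_monomial n m f k j g l\<close> is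
  \<open>f\<^sup>k(x\<^sub>1,\<dots>,x\<^bsub>j-1\<^esub>,g\<^sup>l(x\<^sub>j,\<dots>,x\<^bsub>j+m-1\<^esub>),x\<^bsub>j+m\<^esub>,\<dots>,x\<^bsub>n+m-1\<^esub>)\<close>.\<close>

definition nested_monomial ::
    "nat \<Rightarrow> nat \<Rightarrow> 'f \<Rightarrow> nat \<Rightarrow> nat \<Rightarrow> 'f \<Rightarrow> nat \<Rightarrow> ('f \<times> nat) monomial"
  where "nested_monomial n m f k j g l =
    App (f, k) (map Var [1..<j] @ [App (g, l) (map Var [j..<j + m])] @ map Var [j + m..<n + m])"

definition J_generators :: "'f language \<Rightarrow> ('f monomial \<Rightarrow>\<^sub>0 'k::field) set \<Rightarrow>
    (('f \<times> nat) monomial \<Rightarrow>\<^sub>0 'k) set"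
  where "J_generators L S =
    {basis (nested_monomial n m f k j g l) - basis (nested_monomial n m f k j g p)
      | n m f k j g l p. f \<in> symbols L \<and> g \<in> symbols L \<and> n = arity L f \<and> m = arity L g \<and>
        k \<in> {1..n} \<and> j \<in> {1..n} \<and> k \<noteq> j \<and> l \<in> {1..m} \<and> p \<in> {1..m}} \<union>
    {rho (pure_tensor (free_operad L) perm_operad n s (basis k))
      | n s k. n \<ge> 1 \<and> s \<in> S \<inter> carrier (component (free_operad L) n) \<and> k \<in> {1..n}}"

definition J_ideal :: "'f language \<Rightarrow> ('f monomial \<Rightarrow>\<^sub>0 'k::field) set \<Rightarrow> nat \<Rightarrow>
    (('f \<times> nat) monomial \<Rightarrow>\<^sub>0 'k) set"
  where "J_ideal L S = generated_ideal (free_operad (language2 L)) (J_generators L S)"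

definition P2 :: "'f language \<Rightarrow> ('f monomial \<Rightarrow>\<^sub>0 'k::field) set \<Rightarrow>
    ('k, (('f \<times> nat) monomial \<Rightarrow>\<^sub>0 'k) set) operad"
  where "P2 L S = quotient_operad (free_operad (language2 L)) (J_ideal L S)"

definition pi2_hat :: "'f language \<Rightarrow> ('f monomial \<Rightarrow>\<^sub>0 'k::field) set \<Rightarrow> nat \<Rightarrow>
    (('f \<times> nat) monomial \<Rightarrow>\<^sub>0 'k) \<Rightarrow> (('f \<times> nat) monomial \<Rightarrow>\<^sub>0 'k) set"
  where "pi2_hat L S = quotient_map (free_operad (language2 L)) (J_ideal L S)"

end

theory Submission imports Defs
begin

text \<open>
  In coordinates, \<open>di P(n)\<close> is the space of functions from \<open>{1..n}\<close> to \<open>P(n)\<close>, and \<open>\<zeta>\<close> sends a monomial \<open>t\<close>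
  over \<open>\<Omega>\<^sup>(\<^sup>2\<^sup>)\<close> to the function that is supported at the leaf \<open>head t\<close> reached from the root by
  following the upper indices, with value the monomial \<open>forget t\<close> without upper indices.  Hence the
  kernel of \<open>\<pi>\<^sup>(\<^sup>2\<^sup>)\<close> consists of the \<open>x\<close> such that all components \<open>x\<^sub>k\<close>, the sums of \<open>forget t\<close>
  over the terms with \<open>head t = k\<close>, lie in \<open>Ker \<pi>\<close>; it contains the generators of \<open>J(S)\<close>.
  Conversely, modulo \<open>J(S)\<close> a monomial is determined by \<open>forget t\<close> and \<open>head t\<close>: an upper index off the
  path to the head can be changed once its parent points to another branch, and the parent can be
  turned away and back again.  So \<open>x\<close> is congruent to the sum of the \<open>\<rho>(x\<^sub>k \<otimes> e\<^sub>k)\<close>.  The same congruence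
  shows that the \<open>a\<close> with \<open>\<rho>(a \<otimes> e\<^sub>k) \<in> J(S)\<close> for all \<open>k\<close> form an operad ideal; it contains \<open>S\<close>, thus
  \<open>Ker \<pi>\<close>, and all \<open>\<rho>(x\<^sub>k \<otimes> e\<^sub>k)\<close> lie in \<open>J(S)\<close>.
\<close>

section \<open>Vector spaces as module records: linear maps, submodules and spans\<close>

section \<open>Linear algebra over module records\<close>

text \<open>The operads \<open>P2 L S\<close> and \<open>di P\<close> are not compared directly:
  each is mapped isomorphically onto \<open>coord_operad P\<close>, and one of the two maps is
  inverted. This spares the operad axioms for cosets, since inverting a bijective morphism takes
  only closed operations. Three obstacles shape the rest. \<open>free_morphism\<close> is a choice,
  so nothing is known about \<open>zeta\<close> until a morphism with the prescribed values is
  exhibited and shown to be unique. An operad ideal is closed under compositions into consecutive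
  blocks of variables and under permutations, but not visibly under a replacement inside a monomial;
  each such replacement is therefore rewritten as a composition followed by a permutation. Finally,
  \<open>rho\<close> does not respect compositions, because it sets all indices off the path of the
  emphasized leaf to 1; it does so modulo the relations between nested monomials, which carries a
  statement about the elements of \<open>S\<close> over to the ideal they generate. The condition
  that arities are at least 2 provides the other branch to which a vertex is turned away.\<close>

abbreviation vspace :: "('k::field, 'a) module \<Rightarrow> bool"
  where "vspace M \<equiv> module scalars M"

lemma scalars_simps [simp]:
  "carrier scalars = UNIV" "mult scalars = (*)" "one scalars = 1" "zero scalars = 0" "add scalars = (+)"
  by (simp_all add: scalars_def)

lemma scalars_cring: "cring (scalars :: 'k::field ring)"
proof (rule cringI)
  show "abelian_group (scalars :: 'k ring)"
  proof (rule abelian_groupI)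
    fix x :: 'k
    show "\<exists>y\<in>carrier scalars. y \<oplus>\<^bsub>scalars\<^esub> x = \<zero>\<^bsub>scalars\<^esub>"
      by (auto intro: exI[of _ "- x"])
  qed (auto simp: algebra_simps)
  show "comm_monoid (scalars :: 'k ring)"
    by (rule comm_monoidI) (auto simp: algebra_simps)
qed (auto simp: algebra_simps)

lemma vspace_abelian_monoid: "vspace M \<Longrightarrow> abelian_monoid M"
  by (simp add: module_def abelian_group_def)

text \<open>The scalar \<open>-1\<close> supplies additive inverses, so no separate inverse is asked
  of the record.\<close>

lemma vspaceI:
  assumes "\<And>x y. x \<in> carrier M \<Longrightarrow> y \<in> carrier M \<Longrightarrow> x \<oplus>\<^bsub>M\<^esub> y \<in> carrier M"
    and "\<zero>\<^bsub>M\<^esub> \<in> carrier M"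
    and "\<And>x y z. x \<in> carrier M \<Longrightarrow> y \<in> carrier M \<Longrightarrow> z \<in> carrier M \<Longrightarrow>
      (x \<oplus>\<^bsub>M\<^esub> y) \<oplus>\<^bsub>M\<^esub> z = x \<oplus>\<^bsub>M\<^esub> (y \<oplus>\<^bsub>M\<^esub> z)"
    and "\<And>x y. x \<in> carrier M \<Longrightarrow> y \<in> carrier M \<Longrightarrow> x \<oplus>\<^bsub>M\<^esub> y = y \<oplus>\<^bsub>M\<^esub> x"
    and "\<And>x. x \<in> carrier M \<Longrightarrow> \<zero>\<^bsub>M\<^esub> \<oplus>\<^bsub>M\<^esub> x = x"
    and "\<And>x. x \<in> carrier M \<Longrightarrow> (-1) \<odot>\<^bsub>M\<^esub> x \<oplus>\<^bsub>M\<^esub> x = \<zero>\<^bsub>M\<^esub>"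
    and "\<And>c x. x \<in> carrier M \<Longrightarrow> c \<odot>\<^bsub>M\<^esub> x \<in> carrier M"
    and "\<And>c d x. x \<in> carrier M \<Longrightarrow> (c + d) \<odot>\<^bsub>M\<^esub> x = c \<odot>\<^bsub>M\<^esub> x \<oplus>\<^bsub>M\<^esub> d \<odot>\<^bsub>M\<^esub> x"
    and "\<And>c x y. x \<in> carrier M \<Longrightarrow> y \<in> carrier M \<Longrightarrow>
      c \<odot>\<^bsub>M\<^esub> (x \<oplus>\<^bsub>M\<^esub> y) = c \<odot>\<^bsub>M\<^esub> x \<oplus>\<^bsub>M\<^esub> c \<odot>\<^bsub>M\<^esub> y"
    and "\<And>c d x. x \<in> carrier M \<Longrightarrow> (c * d) \<odot>\<^bsub>M\<^esub> x = c \<odot>\<^bsub>M\<^esub> (d \<odot>\<^bsub>M\<^esub> x)"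
    and "\<And>x. x \<in> carrier M \<Longrightarrow> 1 \<odot>\<^bsub>M\<^esub> x = x"
  shows "vspace M"
proof (rule moduleI)
  show "abelian_group M"
  proof (rule abelian_groupI)
    fix x assume "x \<in> carrier M"
    then show "\<exists>y\<in>carrier M. y \<oplus>\<^bsub>M\<^esub> x = \<zero>\<^bsub>M\<^esub>"
      using assms(6,7) by blast
  qed (fact assms)+
qed (use assms in \<open>auto simp: scalars_cring\<close>)

lemma vspace_a_inv:
  assumes "vspace M" "x \<in> carrier M"
  shows "\<ominus>\<^bsub>M\<^esub> x = (-1) \<odot>\<^bsub>M\<^esub> x"
proof -
  interpret module scalars M by fact
  have "(-1) \<odot>\<^bsub>M\<^esub> x \<oplus>\<^bsub>M\<^esub> x = (-1 + 1) \<odot>\<^bsub>M\<^esub> x"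
    using assms smult_l_distr[of "-1" 1 x] smult_one[of x] by simp
  also have "\<dots> = \<zero>\<^bsub>M\<^esub>" using smult_l_null[of x] assms by simp
  finally show ?thesis using assms smult_closed[of "-1" x] by (simp add: M.minus_equality)
qed

lemma vspace_submoduleI:
  assumes "vspace M" "H \<subseteq> carrier M" "\<zero>\<^bsub>M\<^esub> \<in> H"
    and "\<And>a b. a \<in> H \<Longrightarrow> b \<in> H \<Longrightarrow> a \<oplus>\<^bsub>M\<^esub> b \<in> H"
    and "\<And>c x. x \<in> H \<Longrightarrow> c \<odot>\<^bsub>M\<^esub> x \<in> H"
  shows "submodule H scalars M"
  by (rule module.submoduleI[OF assms(1)]) (use assms vspace_a_inv[OF assms(1)] in auto)

lemma vspace_submoduleD:
  assumes "vspace M" "submodule H scalars M"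
  shows "H \<subseteq> carrier M" "\<zero>\<^bsub>M\<^esub> \<in> H"
    and "\<And>a b. a \<in> H \<Longrightarrow> b \<in> H \<Longrightarrow> a \<oplus>\<^bsub>M\<^esub> b \<in> H"
    and "\<And>c x. x \<in> H \<Longrightarrow> c \<odot>\<^bsub>M\<^esub> x \<in> H"
proof -
  show "\<zero>\<^bsub>M\<^esub> \<in> H" using subgroup.one_closed[OF submodule.axioms(1)[OF assms(2)]] by simp
qed (use module.submoduleE[OF assms] in auto)

lemma linear_mapI:
  assumes "\<And>x. x \<in> carrier M \<Longrightarrow> h x \<in> carrier N"
    and "\<And>x y. x \<in> carrier M \<Longrightarrow> y \<in> carrier M \<Longrightarrow> h (x \<oplus>\<^bsub>M\<^esub> y) = h x \<oplus>\<^bsub>N\<^esub> h y"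
    and "\<And>c x. x \<in> carrier M \<Longrightarrow> h (c \<odot>\<^bsub>M\<^esub> x) = c \<odot>\<^bsub>N\<^esub> h x"
  shows "linear_map M N h"
  using assms by (auto simp: linear_map_def)

lemma linear_mapD:
  assumes "linear_map M N h"
  shows "x \<in> carrier M \<Longrightarrow> h x \<in> carrier N"
    and "x \<in> carrier M \<Longrightarrow> y \<in> carrier M \<Longrightarrow> h (x \<oplus>\<^bsub>M\<^esub> y) = h x \<oplus>\<^bsub>N\<^esub> h y"
    and "x \<in> carrier M \<Longrightarrow> h (c \<odot>\<^bsub>M\<^esub> x) = c \<odot>\<^bsub>N\<^esub> h x"
  using assms by (auto simp: linear_map_def)

lemma linear_map_comp:
  "linear_map M N h \<Longrightarrow> linear_map N K g \<Longrightarrow> linear_map M K (\<lambda>x. g (h x))"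
  by (intro linear_mapI) (simp_all add: linear_mapD)

lemma linear_map_zero:
  assumes "vspace M" "vspace N" "linear_map M N h"
  shows "h \<zero>\<^bsub>M\<^esub> = \<zero>\<^bsub>N\<^esub>"
proof -
  interpret M: module scalars M by fact
  interpret N: module scalars N by fact
  have "h (0 \<odot>\<^bsub>M\<^esub> \<zero>\<^bsub>M\<^esub>) = 0 \<odot>\<^bsub>N\<^esub> h \<zero>\<^bsub>M\<^esub>"
    by (rule linear_mapD(3)[OF assms(3)]) simp
  then show ?thesis
    using M.smult_l_null[of "\<zero>\<^bsub>M\<^esub>"] N.smult_l_null[of "h \<zero>\<^bsub>M\<^esub>"] linear_mapD(1)[OF assms(3)]
    by simp
qed

lemma linear_map_finsum:
  assumes "vspace M" "vspace N" "linear_map M N h" "f \<in> A \<rightarrow> carrier M"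
  shows "h (finsum M f A) = finsum N (\<lambda>a. h (f a)) A"
proof (cases "finite A")
  interpret M: module scalars M by fact
  interpret N: module scalars N by fact
  case True
  then show ?thesis using assms(4)
  proof (induction A)
    case (insert a A)
    then have "(\<lambda>a. h (f a)) \<in> A \<rightarrow> carrier N" "h (f a) \<in> carrier N"
      using linear_mapD(1)[OF assms(3)] by auto
    with insert show ?case
      by (simp add: linear_mapD(2)[OF assms(3)] Pi_def)
  qed (simp add: linear_map_zero[OF assms(1-3)])
next
  interpret M: module scalars M by fact
  interpret N: module scalars N by fact
  case False
  then show ?thesis
    by (simp add: M.finsum_infinite N.finsum_infinite linear_map_zero[OF assms(1-3)])
qed

lemma linear_map_finsum_pointwise:
  assumes "vspace N" "\<And>a. a \<in> A \<Longrightarrow> linear_map M N (h a)" "finite A"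
  shows "linear_map M N (\<lambda>x. finsum N (\<lambda>a. h a x) A)"
proof -
  interpret N: module scalars N by fact
  have *: "(\<lambda>a. h a x) \<in> A \<rightarrow> carrier N" if "x \<in> carrier M" for x
    using linear_mapD(1)[OF assms(2)] that by auto
  show ?thesis
  proof (rule linear_mapI)
    fix x y c assume x: "x \<in> carrier M"
    show "finsum N (\<lambda>a. h a x) A \<in> carrier N" using *[OF x] by simp
    have "finsum N (\<lambda>a. h a (c \<odot>\<^bsub>M\<^esub> x)) A = finsum N (\<lambda>a. c \<odot>\<^bsub>N\<^esub> h a x) A"
      by (rule N.finsum_cong') (use *[OF x] linear_mapD(3)[OF assms(2)] x in \<open>auto simp: Pi_def\<close>)
    then show "finsum N (\<lambda>a. h a (c \<odot>\<^bsub>M\<^esub> x)) A = c \<odot>\<^bsub>N\<^esub> finsum N (\<lambda>a. h a x) A"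
      using N.finsum_smult_ldistr[OF assms(3), of c "\<lambda>a. h a x"] *[OF x] by simp
    assume y: "y \<in> carrier M"
    have "finsum N (\<lambda>a. h a (x \<oplus>\<^bsub>M\<^esub> y)) A = finsum N (\<lambda>a. h a x \<oplus>\<^bsub>N\<^esub> h a y) A"
      by (rule N.finsum_cong') (use *[OF x] *[OF y] linear_mapD(2)[OF assms(2)] x y in \<open>auto simp: Pi_def\<close>)
    then show "finsum N (\<lambda>a. h a (x \<oplus>\<^bsub>M\<^esub> y)) A = finsum N (\<lambda>a. h a x) A \<oplus>\<^bsub>N\<^esub> finsum N (\<lambda>a. h a y) A"
      using N.finsum_addf[OF *[OF x] *[OF y]] by simp
  qed
qed

lemma finsum_delta:
  assumes "vspace M" "finite A" "a \<in> A" "x \<in> carrier M"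
  shows "finsum M (\<lambda>b. if b = a then x else \<zero>\<^bsub>M\<^esub>) A = x"
proof -
  interpret M: module scalars M by fact
  have "finsum M (\<lambda>b. if a = b then (\<lambda>_. x) b else \<zero>\<^bsub>M\<^esub>) A = x"
    by (rule M.finsum_singleton) (use assms in auto)
  then show ?thesis by (simp add: eq_commute cong: if_cong)
qed

lemma submodule_kernel:
  assumes "vspace M" "vspace N" "linear_map M N h"
  shows "submodule {x \<in> carrier M. h x = \<zero>\<^bsub>N\<^esub>} scalars M"
proof -
  interpret M: module scalars M by fact
  interpret N: module scalars N by fact
  show ?thesis
    by (rule vspace_submoduleI[OF assms(1)])
      (auto simp: linear_map_zero[OF assms] linear_mapD[OF assms(3)])
qed

lemma linear_span_submodule:
  assumes "vspace M" "X \<subseteq> carrier M"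
  shows "submodule (linear_span M X) scalars M"
proof -
  interpret M: module scalars M by fact
  have c: "carrier M \<in> {H. submodule H scalars M \<and> X \<subseteq> H}"
    using M.carrier_is_submodule assms by simp
  show ?thesis
  proof (rule vspace_submoduleI[OF assms(1)])
    show "linear_span M X \<subseteq> carrier M"
      unfolding linear_span_def using c by (rule Inter_lower)
  qed (auto simp: linear_span_def vspace_submoduleD[OF assms(1)])
qed

lemma linear_span_superset: "X \<subseteq> linear_span M X"
  by (auto simp: linear_span_def)

lemma linear_span_least: "submodule H scalars M \<Longrightarrow> X \<subseteq> H \<Longrightarrow> linear_span M X \<subseteq> H"
  by (auto simp: linear_span_def)

section \<open>Free vector spaces and linear extension from a basis\<close>

subsection \<open>Free modules\<close>

lemma lookup_pm_scale [simp]: "Poly_Mapping.lookup (pm_scale c p) x = c * Poly_Mapping.lookup p x"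
  by (simp add: pm_scale_def map.rep_eq when_def)

lemma keys_pm_scale: "Poly_Mapping.keys (pm_scale c p) \<subseteq> Poly_Mapping.keys p"
  by (auto simp: in_keys_iff)

lemma pm_scale_add_right: "pm_scale c (p + q) = pm_scale c p + pm_scale c q"
  by (rule poly_mapping_eqI) (simp add: lookup_add algebra_simps)

lemma pm_scale_add_left: "pm_scale (c + d) p = pm_scale c p + pm_scale d p"
  by (rule poly_mapping_eqI) (simp add: lookup_add algebra_simps)

lemma pm_scale_scale [simp]: "pm_scale c (pm_scale d p) = pm_scale (c * d) p"
  by (rule poly_mapping_eqI) (simp add: algebra_simps)

lemma pm_scale_one [simp]: "pm_scale 1 p = p"
  by (rule poly_mapping_eqI) simp

lemma pm_scale_zero [simp]: "pm_scale 0 p = 0"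
  by (rule poly_mapping_eqI) simp

lemma pm_scale_zero_right [simp]: "pm_scale c 0 = 0"
  by (rule poly_mapping_eqI) simp

lemma pm_scale_minus_one: "pm_scale (-1) p = - p"
  by (rule poly_mapping_eqI) simp

lemma pm_scale_diff_right: "pm_scale c (p - q) = pm_scale c p - pm_scale c q"
  by (rule poly_mapping_eqI) (simp add: lookup_minus algebra_simps)

lemma pm_scale_sum: "pm_scale c (sum f A) = (\<Sum>a\<in>A. pm_scale c (f a))"
  by (induction A rule: infinite_finite_induct) (auto simp: pm_scale_add_right)

lemma keys_basis [simp]: "Poly_Mapping.keys (basis x :: 'x \<Rightarrow>\<^sub>0 'k::field) = {x}"
  by (simp add: basis_def)

lemma lookup_basis: "Poly_Mapping.lookup (basis x) y = (if x = y then 1 else 0)"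
  by (simp add: basis_def lookup_single when_def)

lemma keys_plus_subset: "Poly_Mapping.keys p \<subseteq> X \<Longrightarrow> Poly_Mapping.keys q \<subseteq> X \<Longrightarrow> Poly_Mapping.keys (p + q) \<subseteq> X"
  using Poly_Mapping.keys_add[of p q] by blast

lemma keys_diff_subset: "Poly_Mapping.keys p \<subseteq> X \<Longrightarrow> Poly_Mapping.keys q \<subseteq> X \<Longrightarrow> Poly_Mapping.keys (p - q :: 'x \<Rightarrow>\<^sub>0 'k::field) \<subseteq> X"
  using Poly_Mapping.keys_diff[of p q] by blast

lemma keys_pm_scale_subset: "Poly_Mapping.keys p \<subseteq> X \<Longrightarrow> Poly_Mapping.keys (pm_scale c p) \<subseteq> X"
  using keys_pm_scale[of c p] by blast

lemma keys_sum_subset: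
  "(\<And>a. a \<in> A \<Longrightarrow> Poly_Mapping.keys (f a) \<subseteq> X) \<Longrightarrow> Poly_Mapping.keys (sum f A) \<subseteq> X"
  by (induction A rule: infinite_finite_induct) (simp_all add: keys_plus_subset)

lemma free_module_simps [simp]:
  "carrier (free_module X) = {p. Poly_Mapping.keys p \<subseteq> X}" "zero (free_module X) = 0"
  "add (free_module X) = (+)" "smult (free_module X) = pm_scale"
  by (simp_all add: free_module_def)

lemma vspace_free_module: "vspace (free_module X)"
  by (rule vspaceI)
    (auto simp: keys_pm_scale_subset[THEN subsetD] pm_scale_add_right pm_scale_add_left algebra_simps
      pm_scale_minus_one dest: keys_plus_subset[THEN subsetD, rotated -1])

text \<open>The record operations of a free module are those of the type class, so closure can be
  used for ordinary sums and differences of polynomial mappings.\<close>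

lemma submodule_free_moduleD:
  assumes "submodule H scalars (free_module X)"
  shows "p \<in> H \<Longrightarrow> Poly_Mapping.keys p \<subseteq> X" "0 \<in> H" "p \<in> H \<Longrightarrow> q \<in> H \<Longrightarrow> p + q \<in> H"
    "p \<in> H \<Longrightarrow> pm_scale c p \<in> H" "p \<in> H \<Longrightarrow> q \<in> H \<Longrightarrow> p - q \<in> H"
    "(\<And>a. a \<in> A \<Longrightarrow> g a \<in> H) \<Longrightarrow> sum g A \<in> H"
proof -
  note D = vspace_submoduleD[OF vspace_free_module assms, simplified]
  show "p \<in> H \<Longrightarrow> Poly_Mapping.keys p \<subseteq> X" "0 \<in> H" and add: "p \<in> H \<Longrightarrow> q \<in> H \<Longrightarrow> p + q \<in> H"
    and "p \<in> H \<Longrightarrow> pm_scale c p \<in> H" for p q c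
    using D by auto
  show "p - q \<in> H" if "p \<in> H" "q \<in> H" for p q
    using D(3)[OF that(1) D(4)[OF that(2), of "-1"]] by (simp add: pm_scale_minus_one)
  show "(\<And>a. a \<in> A \<Longrightarrow> g a \<in> H) \<Longrightarrow> sum g A \<in> H"
    by (induction A rule: infinite_finite_induct) (auto intro: D)
qed

text \<open>Subtracting the term at one key removes that key from the support; the induction runs
  over a finite set \<open>K\<close> containing the support.\<close>

lemma free_module_induct [consumes 1, case_names zero basis add scale]:
  assumes p: "Poly_Mapping.keys p \<subseteq> X"
    and zero: "Q 0" and basis: "\<And>x. x \<in> X \<Longrightarrow> Q (basis x)"
    and add: "\<And>p q. Poly_Mapping.keys p \<subseteq> X \<Longrightarrow> Poly_Mapping.keys q \<subseteq> X \<Longrightarrow> Q p \<Longrightarrow> Q q \<Longrightarrow> Q (p + q)"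
    and scale: "\<And>c p. Poly_Mapping.keys p \<subseteq> X \<Longrightarrow> Q p \<Longrightarrow> Q (pm_scale c p)"
  shows "Q p"
proof -
  have "Q p" if "finite K" "Poly_Mapping.keys p \<subseteq> K" "K \<subseteq> X" for p K
    using that
  proof (induction K arbitrary: p rule: finite_induct)
    case empty
    then show ?case using zero by simp
  next
    case (insert x K)
    define c where "c = Poly_Mapping.lookup p x"
    define q where "q = p - pm_scale c (basis x)"
    have "Poly_Mapping.keys q \<subseteq> K"
      using insert.prems(1) by (auto simp: q_def c_def in_keys_iff lookup_minus lookup_basis split: if_splits)
    moreover have "p = pm_scale c (basis x) + q" by (simp add: q_def)
    moreover have "Q (pm_scale c (basis x))"
      using insert.prems by (auto intro!: scale basis)
    moreover have "Poly_Mapping.keys (pm_scale c (basis x)) \<subseteq> X"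
      using insert.prems by (intro keys_pm_scale_subset) auto
    ultimately show ?case using insert by (auto intro!: add)
  qed
  from this[OF finite_keys order_refl p] show ?thesis .
qed

lemma linear_map_eq_on_basis:
  assumes "vspace N" "linear_map (free_module X) N h" "linear_map (free_module X) N g"
    and "\<And>x. x \<in> X \<Longrightarrow> h (basis x) = g (basis x)" and "Poly_Mapping.keys p \<subseteq> X"
  shows "h p = g p"
  using assms(5)
proof (induction rule: free_module_induct)
  case zero
  then show ?case
    using linear_map_zero[OF vspace_free_module assms(1,2)] linear_map_zero[OF vspace_free_module assms(1,3)] by simp
next
  case (add p q)
  then show ?case using linear_mapD(2)[OF assms(2), of p q] linear_mapD(2)[OF assms(3), of p q] by simp
next
  case (scale c p)
  then show ?case using linear_mapD(3)[OF assms(2), of p c] linear_mapD(3)[OF assms(3), of p c] by simp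
qed (use assms in auto)

text \<open>Linear extension with values in an arbitrary module record, whereas
  \<open>lin_ext\<close> takes values in a free module.\<close>

definition lext :: "('k::field, 'b) module \<Rightarrow> ('x \<Rightarrow> 'b) \<Rightarrow> ('x \<Rightarrow>\<^sub>0 'k) \<Rightarrow> 'b"
  where "lext N f p = finsum N (\<lambda>x. Poly_Mapping.lookup p x \<odot>\<^bsub>N\<^esub> f x) (Poly_Mapping.keys p)"

lemma lext_superset:
  assumes "vspace N" "f \<in> K \<rightarrow> carrier N" "finite K" "Poly_Mapping.keys p \<subseteq> K"
  shows "lext N f p = finsum N (\<lambda>x. Poly_Mapping.lookup p x \<odot>\<^bsub>N\<^esub> f x) K"
proof -
  interpret N: module scalars N by fact
  show ?thesis unfolding lext_def
    by (rule N.add.finprod_mono_neutral_cong_left) (use assms N.smult_l_null in \<open>auto simp: in_keys_iff Pi_def\<close>)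
qed

lemma linear_map_lext:
  fixes N :: "('k::field, 'b) module" and X :: "'x set"
  assumes "vspace N" "f \<in> X \<rightarrow> carrier N"
  shows "linear_map (free_module X) N (lext N f)"
proof -
  interpret N: module scalars N by fact
  have cl: "f x \<in> carrier N" if "x \<in> X" for x using assms that by auto
  show ?thesis
  proof (rule linear_mapI)
    fix p q :: "'x \<Rightarrow>\<^sub>0 'k" and c assume p: "p \<in> carrier (free_module X)"
    then show "lext N f p \<in> carrier N" unfolding lext_def using cl by (auto intro!: N.finsum_closed)
    have K: "finite (Poly_Mapping.keys p)" "f \<in> Poly_Mapping.keys p \<rightarrow> carrier N" using cl p by auto
    have "lext N f (pm_scale c p) = finsum N (\<lambda>x. c \<odot>\<^bsub>N\<^esub> (Poly_Mapping.lookup p x \<odot>\<^bsub>N\<^esub> f x)) (Poly_Mapping.keys p)"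
      unfolding lext_superset[OF assms(1) K(2,1) keys_pm_scale]
      by (rule N.finsum_cong') (use p cl N.smult_assoc1 in \<open>auto simp: Pi_def\<close>)
    also have "\<dots> = c \<odot>\<^bsub>N\<^esub> lext N f p" unfolding lext_def
      by (rule N.finsum_smult_ldistr[symmetric]) (use p cl in \<open>auto simp: Pi_def\<close>)
    finally show "lext N f (c \<odot>\<^bsub>free_module X\<^esub> p) = c \<odot>\<^bsub>N\<^esub> lext N f p" by simp
    assume q: "q \<in> carrier (free_module X)"
    define K where "K = Poly_Mapping.keys p \<union> Poly_Mapping.keys q"
    have K: "finite K" "f \<in> K \<rightarrow> carrier N" using p q cl by (auto simp: K_def)
    have sub: "Poly_Mapping.keys p \<subseteq> K" "Poly_Mapping.keys q \<subseteq> K" "Poly_Mapping.keys (p + q) \<subseteq> K"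
      using Poly_Mapping.keys_add[of p q] by (auto simp: K_def)
    have "lext N f (p + q) = finsum N (\<lambda>x. Poly_Mapping.lookup p x \<odot>\<^bsub>N\<^esub> f x \<oplus>\<^bsub>N\<^esub> Poly_Mapping.lookup q x \<odot>\<^bsub>N\<^esub> f x) K"
      unfolding lext_superset[OF assms(1) K(2,1) sub(3)]
      by (rule N.finsum_cong') (use K N.smult_l_distr in \<open>auto simp: Pi_def lookup_add\<close>)
    also have "\<dots> = lext N f p \<oplus>\<^bsub>N\<^esub> lext N f q"
      unfolding lext_superset[OF assms(1) K(2,1) sub(1)] lext_superset[OF assms(1) K(2,1) sub(2)]
      by (rule N.finsum_addf) (use K in \<open>auto simp: Pi_def\<close>)
    finally show "lext N f (p \<oplus>\<^bsub>free_module X\<^esub> q) = lext N f p \<oplus>\<^bsub>N\<^esub> lext N f q" by simp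
  qed
qed

lemma lext_basis:
  assumes "vspace N" "f x \<in> carrier N"
  shows "lext N f (basis x) = f x"
proof -
  interpret N: module scalars N by fact
  show ?thesis using assms N.smult_one by (simp add: lext_def lookup_basis)
qed

lemma lin_ext_superset:
  assumes "finite K" "Poly_Mapping.keys p \<subseteq> K"
  shows "lin_ext f p = (\<Sum>x\<in>K. pm_scale (Poly_Mapping.lookup p x) (f x))"
  unfolding lin_ext_def by (rule sum.mono_neutral_left) (use assms in \<open>auto simp: in_keys_iff\<close>)

lemma lin_ext_add: "lin_ext f (p + q) = lin_ext f p + lin_ext f q"
proof -
  define K where "K = Poly_Mapping.keys p \<union> Poly_Mapping.keys q"
  have "finite K" "Poly_Mapping.keys p \<subseteq> K" "Poly_Mapping.keys q \<subseteq> K" "Poly_Mapping.keys (p + q) \<subseteq> K"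
    using Poly_Mapping.keys_add[of p q] by (auto simp: K_def)
  then show ?thesis
    by (simp add: lin_ext_superset[of K] lookup_add pm_scale_add_left sum.distrib)
qed

lemma lin_ext_scale: "lin_ext f (pm_scale c p) = pm_scale c (lin_ext f p)"
  unfolding lin_ext_superset[OF finite_keys keys_pm_scale, of f c p] by (simp add: lin_ext_def pm_scale_sum)

lemma lin_ext_zero [simp]: "lin_ext f 0 = 0"
  by (simp add: lin_ext_def)

lemma lin_ext_basis [simp]: "lin_ext f (basis x) = f x"
  by (simp add: lin_ext_def lookup_basis)

lemma keys_lin_ext:
  assumes "\<And>x. x \<in> X \<Longrightarrow> Poly_Mapping.keys (f x) \<subseteq> Y" "Poly_Mapping.keys p \<subseteq> X"
  shows "Poly_Mapping.keys (lin_ext f p) \<subseteq> Y"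
  unfolding lin_ext_def using assms by (intro keys_sum_subset keys_pm_scale_subset) auto

lemma linear_map_lin_ext:
  "(\<And>x. x \<in> X \<Longrightarrow> Poly_Mapping.keys (f x) \<subseteq> Y) \<Longrightarrow> linear_map (free_module X) (free_module Y) (lin_ext f)"
  by (rule linear_mapI) (simp_all add: lin_ext_add lin_ext_scale keys_lin_ext[of X])

section \<open>Multilinear extension and induction over lists of vectors\<close>

subsection \<open>Multilinear maps\<close>

text \<open>The positions are freed one after the other: if the property holds with every basis
  element in a position, sums and scalar multiples extend it to every vector there.\<close>

lemma multilinear_induct:
  assumes "list_all2 (\<lambda>X p. Poly_Mapping.keys p \<subseteq> X) Xs ps"
    and zero: "\<And>ps i. list_all2 (\<lambda>X p. Poly_Mapping.keys p \<subseteq> X) Xs ps \<Longrightarrow> i < length Xs \<Longrightarrow> Q (ps[i := 0])"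
    and add: "\<And>ps i p q. list_all2 (\<lambda>X p. Poly_Mapping.keys p \<subseteq> X) Xs ps \<Longrightarrow> i < length Xs \<Longrightarrow>
      Poly_Mapping.keys p \<subseteq> Xs ! i \<Longrightarrow> Poly_Mapping.keys q \<subseteq> Xs ! i \<Longrightarrow> Q (ps[i := p]) \<Longrightarrow> Q (ps[i := q]) \<Longrightarrow>
      Q (ps[i := p + q])"
    and scale: "\<And>ps i c p. list_all2 (\<lambda>X p. Poly_Mapping.keys p \<subseteq> X) Xs ps \<Longrightarrow> i < length Xs \<Longrightarrow>
      Poly_Mapping.keys p \<subseteq> Xs ! i \<Longrightarrow> Q (ps[i := p]) \<Longrightarrow> Q (ps[i := pm_scale c p])"
    and basis: "\<And>xs. list_all2 (\<lambda>X x. x \<in> X) Xs xs \<Longrightarrow> Q (map basis xs)"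
  shows "Q ps"
proof -
  \<comment> \<open>Entries before position \<open>j\<close> are arbitrary, those from
    \<open>j\<close> on are basis elements; the case \<open>j = length Xs\<close> is the
    claim.\<close>
  have "Q ps" if "j \<le> length Xs" "list_all2 (\<lambda>X p. Poly_Mapping.keys p \<subseteq> X) Xs ps"
    "\<forall>i<length Xs. j \<le> i \<longrightarrow> (\<exists>x\<in>Xs ! i. ps ! i = basis x)" for j ps
    using that
  proof (induction j arbitrary: ps)
    case 0
    then have "\<exists>x. i < length Xs \<longrightarrow> x \<in> Xs ! i \<and> ps ! i = basis x" for i by auto
    then obtain x where x: "\<And>i. i < length Xs \<Longrightarrow> x i \<in> Xs ! i \<and> ps ! i = basis (x i)" by metis
    have "ps = map basis (map x [0..<length Xs])"
      using 0 x by (auto intro!: nth_equalityI simp: list_all2_lengthD)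
    moreover have "Q \<dots>" by (rule basis) (use x in \<open>auto simp: list_all2_conv_all_nth\<close>)
    ultimately show ?case by simp
  next
    case (Suc j)
    have len: "length ps = length Xs" using Suc.prems(2) by (simp add: list_all2_lengthD)
    have j: "j < length Xs" using Suc.prems(1) by simp
    have "Q (ps[j := q])" if "Poly_Mapping.keys q \<subseteq> Xs ! j" for q
      using that
    proof (induction rule: free_module_induct)
      case zero
      show ?case by (rule assms(2)[OF Suc.prems(2) j])
    next
      case (basis x)
      show ?case
      proof (rule Suc.IH)
        show "\<forall>i<length Xs. j \<le> i \<longrightarrow> (\<exists>x'\<in>Xs ! i. ps[j := Defs.basis x] ! i = Defs.basis x')"
        proof (intro allI impI)
          fix i assume i: "i < length Xs" "j \<le> i"
          show "\<exists>x'\<in>Xs ! i. ps[j := Defs.basis x] ! i = Defs.basis x'"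
          proof (cases "i = j")
            case True
            then show ?thesis using basis len j by auto
          next
            case False
            then show ?thesis using Suc.prems(3) i by simp
          qed
        qed
        show "list_all2 (\<lambda>X p. Poly_Mapping.keys p \<subseteq> X) Xs (ps[j := Defs.basis x])"
          using Suc.prems(2) basis j by (simp add: list_all2_conv_all_nth nth_list_update)
      qed (use j in simp)
    next
      case (add p q)
      show ?case by (rule assms(3)[OF Suc.prems(2) j add])
    next
      case (scale c p)
      show ?case by (rule assms(4)[OF Suc.prems(2) j scale])
    qed
    moreover have "Poly_Mapping.keys (ps ! j) \<subseteq> Xs ! j"
      using Suc.prems(2) j by (simp add: list_all2_conv_all_nth)
    ultimately have "Q (ps[j := ps ! j])" .
    then show ?case by simp
  qed
  from this[of "length Xs"] show ?thesis using assms(1) by auto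
qed

lemma in_listset_iff: "ys \<in> listset As \<longleftrightarrow> list_all2 (\<lambda>A y. y \<in> A) As ys"
  by (induction As arbitrary: ys) (auto simp: set_Cons_def list_all2_Cons1)

lemma finite_listset: "(\<And>A. A \<in> set As \<Longrightarrow> finite A) \<Longrightarrow> finite (listset As)"
proof (induction As)
  case (Cons A As)
  have "set_Cons A (listset As) = (\<lambda>(x, xs). x # xs) ` (A \<times> listset As)"
    by (auto simp: set_Cons_def)
  with Cons show ?case by simp
qed simp

text \<open>Larger index sets only add summands in which some coefficient is 0.\<close>

lemma multilin_ext_superset:
  assumes "finite A" "Poly_Mapping.keys p \<subseteq> A" "\<And>K. K \<in> set Ks \<Longrightarrow> finite K"
    "list_all2 (\<lambda>K q. Poly_Mapping.keys q \<subseteq> K) Ks qs"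
  shows "multilin_ext h p qs = (\<Sum>x\<in>A. \<Sum>ys\<in>listset Ks.
    pm_scale (Poly_Mapping.lookup p x * (\<Prod>i<length qs. Poly_Mapping.lookup (qs ! i) (ys ! i))) (basis (h x ys)))"
proof -
  have 1: "(\<Sum>ys\<in>listset (map Poly_Mapping.keys qs). pm_scale (Poly_Mapping.lookup p x * (\<Prod>i<length qs. Poly_Mapping.lookup (qs ! i) (ys ! i))) (basis (h x ys)))
    = (\<Sum>ys\<in>listset Ks. pm_scale (Poly_Mapping.lookup p x * (\<Prod>i<length qs. Poly_Mapping.lookup (qs ! i) (ys ! i))) (basis (h x ys)))" for x
  proof (rule sum.mono_neutral_left)
    show "finite (listset Ks)" by (rule finite_listset) (use assms in auto)
    show "listset (map Poly_Mapping.keys qs) \<subseteq> listset Ks"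
      using assms(4) by (fastforce simp: in_listset_iff list_all2_conv_all_nth)
    have "(\<Prod>i<length qs. Poly_Mapping.lookup (qs ! i) (ys ! i)) = 0"
      if ys: "ys \<in> listset Ks - listset (map Poly_Mapping.keys qs)" for ys
    proof -
      have "length ys = length qs" using ys assms(4) by (auto simp: in_listset_iff list_all2_lengthD dest!: list_all2_lengthD)
      then obtain i where "i < length qs" "ys ! i \<notin> Poly_Mapping.keys (qs ! i)"
        using ys by (auto simp: in_listset_iff list_all2_conv_all_nth)
      then show ?thesis by (auto simp: in_keys_iff)
    qed
    then show "\<forall>ys\<in>listset Ks - listset (map Poly_Mapping.keys qs). pm_scale (Poly_Mapping.lookup p x * (\<Prod>i<length qs. Poly_Mapping.lookup (qs ! i) (ys ! i))) (basis (h x ys)) = 0"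
      by (metis mult_zero_right pm_scale_zero)
  qed
  show ?thesis unfolding multilin_ext_def 1
    by (rule sum.mono_neutral_left) (use assms in \<open>auto simp: in_keys_iff\<close>)
qed

lemma multilin_ext_left: "multilin_ext h p qs = lin_ext (\<lambda>x. multilin_ext h (basis x) qs) p"
  by (simp add: multilin_ext_def lin_ext_def lookup_basis pm_scale_sum)

lemma multilin_ext_right:
  fixes q :: "'y \<Rightarrow>\<^sub>0 'k::field"
  assumes "i < length qs"
  shows "multilin_ext h p (qs[i := q]) = lin_ext (\<lambda>y. multilin_ext h p (qs[i := basis y])) q"
proof -
  \<comment> \<open>One index set that serves \<open>q\<close> as well as \<open>basis y\<close> for
    every \<open>y\<close> in its support, so that the order of summation can be changed.\<close>
  let ?K = "map Poly_Mapping.keys (qs[i := q])"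
  let ?F = "\<lambda>ys. \<Prod>j\<in>{..<length qs} - {i}. Poly_Mapping.lookup (qs ! j) (ys ! j)"
  let ?X = "\<lambda>y ys. if y = ys ! i then (1::'k) else 0"
  have split: "(\<Prod>j<length qs. Poly_Mapping.lookup (qs[i := r] ! j) (ys ! j)) = Poly_Mapping.lookup r (ys ! i) * ?F ys" for r ys
  proof -
    have "(\<Prod>j<length qs. Poly_Mapping.lookup (qs[i := r] ! j) (ys ! j)) = Poly_Mapping.lookup (qs[i := r] ! i) (ys ! i) * (\<Prod>j\<in>{..<length qs} - {i}. Poly_Mapping.lookup (qs[i := r] ! j) (ys ! j))"
      by (rule prod.remove) (use assms in auto)
    also have "(\<Prod>j\<in>{..<length qs} - {i}. Poly_Mapping.lookup (qs[i := r] ! j) (ys ! j)) = ?F ys"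
      by (rule prod.cong) auto
    finally show ?thesis using assms by simp
  qed
  have expand: "multilin_ext h p (qs[i := r]) = (\<Sum>x\<in>Poly_Mapping.keys p. \<Sum>ys\<in>listset ?K.
      pm_scale (Poly_Mapping.lookup p x * (Poly_Mapping.lookup r (ys ! i) * ?F ys)) (basis (h x ys)))"
    if "Poly_Mapping.keys r \<subseteq> Poly_Mapping.keys q" for r
  proof -
    have "list_all2 (\<lambda>K q. Poly_Mapping.keys q \<subseteq> K) ?K (qs[i := r])"
      using that assms by (auto simp: list_all2_conv_all_nth nth_list_update)
    moreover have "finite K" if "K \<in> set ?K" for K using that by auto
    ultimately show ?thesis
      by (subst multilin_ext_superset[OF finite_keys order_refl, where Ks = ?K]) (auto simp: split)
  qed
  have "lin_ext (\<lambda>y. multilin_ext h p (qs[i := basis y])) q =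
    (\<Sum>y\<in>Poly_Mapping.keys q. \<Sum>x\<in>Poly_Mapping.keys p. \<Sum>ys\<in>listset ?K.
      pm_scale (Poly_Mapping.lookup q y) (pm_scale (Poly_Mapping.lookup p x * (?X y ys * ?F ys)) (basis (h x ys))))"
    by (simp add: lin_ext_def expand lookup_basis pm_scale_sum)
  also have "\<dots> = (\<Sum>x\<in>Poly_Mapping.keys p. \<Sum>ys\<in>listset ?K. \<Sum>y\<in>Poly_Mapping.keys q.
      pm_scale (Poly_Mapping.lookup q y) (pm_scale (Poly_Mapping.lookup p x * (?X y ys * ?F ys)) (basis (h x ys))))"
    by (subst sum.swap) (intro sum.cong refl sum.swap)
  also have "\<dots> = (\<Sum>x\<in>Poly_Mapping.keys p. \<Sum>ys\<in>listset ?K.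
      pm_scale (Poly_Mapping.lookup p x * (Poly_Mapping.lookup q (ys ! i) * ?F ys)) (basis (h x ys)))"
  proof (intro sum.cong refl)
    fix x ys assume "ys \<in> listset ?K"
    then have "ys ! i \<in> Poly_Mapping.keys q"
      using assms by (auto simp: in_listset_iff list_all2_conv_all_nth nth_list_update)
    moreover have "(\<Sum>y\<in>Poly_Mapping.keys q.
      pm_scale (Poly_Mapping.lookup q y) (pm_scale (Poly_Mapping.lookup p x * (?X y ys * ?F ys)) (basis (h x ys))))
      = (\<Sum>y\<in>Poly_Mapping.keys q. if y = ys ! i then
      pm_scale (Poly_Mapping.lookup p x * (Poly_Mapping.lookup q y * ?F ys)) (basis (h x ys)) else 0)"
      by (rule sum.cong) (auto simp: algebra_simps)
    ultimately show "(\<Sum>y\<in>Poly_Mapping.keys q.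
      pm_scale (Poly_Mapping.lookup q y) (pm_scale (Poly_Mapping.lookup p x * (?X y ys * ?F ys)) (basis (h x ys))))
      = pm_scale (Poly_Mapping.lookup p x * (Poly_Mapping.lookup q (ys ! i) * ?F ys)) (basis (h x ys))"
      by simp
  qed
  also have "\<dots> = multilin_ext h p (qs[i := q])" by (rule expand[OF order_refl, symmetric])
  finally show ?thesis ..
qed

lemma multilin_ext_basis:
  "multilin_ext h (basis x :: 'x \<Rightarrow>\<^sub>0 'k::field) (map basis (ys :: 'y list)) = basis (h x ys)"
proof -
  have "listset (map (Poly_Mapping.keys \<circ> (basis :: 'y \<Rightarrow> 'y \<Rightarrow>\<^sub>0 'k)) ys) = {ys}"
    by (induction ys) (auto simp: set_Cons_def)
  then show ?thesis unfolding multilin_ext_def list.map_comp by (simp add: lookup_basis)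
qed

lemma keys_multilin_ext:
  assumes "\<And>x ys. x \<in> X \<Longrightarrow> list_all2 (\<lambda>Y y. y \<in> Y) Ys ys \<Longrightarrow> h x ys \<in> Z"
    and "Poly_Mapping.keys p \<subseteq> X" "list_all2 (\<lambda>Y q. Poly_Mapping.keys q \<subseteq> Y) Ys qs"
  shows "Poly_Mapping.keys (multilin_ext h p qs) \<subseteq> Z"
proof -
  have *: "list_all2 (\<lambda>Y y. y \<in> Y) Ys ys" if "ys \<in> listset (map Poly_Mapping.keys qs)" for ys
    using that assms(3) by (fastforce simp: in_listset_iff list_all2_conv_all_nth)
  show ?thesis unfolding multilin_ext_def
    by (intro keys_sum_subset keys_pm_scale_subset) (use assms * in auto)
qed

section \<open>Operads reduced to linear components, multilinear compositions and linear
  actions\<close>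

section \<open>Operads without associativity and equivariance\<close>

text \<open>The comparison of the two operads only uses that compositions are multilinear and actions are
  linear, so the auxiliary operads below need not satisfy the remaining axioms.\<close>

locale pre_operad =
  fixes P :: "('k::field, 'a) operad"
  assumes component_module: "n \<ge> 1 \<Longrightarrow> vspace (component P n)"
    and unit_closed: "op_unit P \<in> carrier (component P 1)"
    and act_linear: "n \<ge> 1 \<Longrightarrow> \<sigma> permutes {1..n} \<Longrightarrow>
      linear_map (component P n) (component P n) (op_act P n \<sigma>)"
    and comp_linear_left: "positive_arities ms \<Longrightarrow> op_args P ms bs \<Longrightarrow>
      linear_map (component P (length ms)) (component P (sum_list ms)) (\<lambda>a. op_comp P ms a bs)"
    and comp_linear_right:
      "positive_arities ms \<Longrightarrow> a \<in> carrier (component P (length ms)) \<Longrightarrow> op_args P ms bs \<Longrightarrow>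
      i < length ms \<Longrightarrow> linear_map (component P (ms ! i)) (component P (sum_list ms))
        (\<lambda>b. op_comp P ms a (bs[i := b]))"
begin

lemma act_closed:
  "n \<ge> 1 \<Longrightarrow> \<sigma> permutes {1..n} \<Longrightarrow> a \<in> carrier (component P n) \<Longrightarrow>
    op_act P n \<sigma> a \<in> carrier (component P n)"
  by (rule linear_mapD(1)[OF act_linear])

lemma comp_closed:
  "positive_arities ms \<Longrightarrow> a \<in> carrier (component P (length ms)) \<Longrightarrow> op_args P ms bs \<Longrightarrow>
    op_comp P ms a bs \<in> carrier (component P (sum_list ms))"
  by (rule linear_mapD(1)[OF comp_linear_left])

end

lemma operad_pre_operad: "operad P \<Longrightarrow> pre_operad P"
  by (intro pre_operad.intro operad.component_module operad.unit_closed operad.act_linear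
      operad.comp_linear_left operad.comp_linear_right)

lemma positive_aritiesD:
  assumes "positive_arities ms"
  shows "length ms \<ge> 1" "sum_list ms \<ge> 1" "i < length ms \<Longrightarrow> ms ! i \<ge> 1"
proof -
  show "length ms \<ge> 1" using assms by (cases ms) (auto simp: positive_arities_def)
  show "i < length ms \<Longrightarrow> ms ! i \<ge> 1" for i using assms by (auto simp: positive_arities_def)
  show "sum_list ms \<ge> 1" using assms by (cases ms) (auto simp: positive_arities_def)
qed

lemma op_argsD:
  assumes "op_args P ms bs"
  shows "length bs = length ms" "i < length ms \<Longrightarrow> bs ! i \<in> carrier (component P (ms ! i))"
  using assms by (auto simp: op_args_def list_all2_conv_all_nth)

lemma op_argsI:
  "length bs = length ms \<Longrightarrow> (\<And>i. i < length ms \<Longrightarrow> bs ! i \<in> carrier (component P (ms ! i))) \<Longrightarrow>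
    op_args P ms bs"
  by (auto simp: op_args_def list_all2_conv_all_nth)

lemma op_args_update:
  "op_args P ms bs \<Longrightarrow> b \<in> carrier (component P (ms ! i)) \<Longrightarrow> op_args P ms (bs[i := b])"
proof -
  assume bs: "op_args P ms bs" and b: "b \<in> carrier (component P (ms ! i))"
  show ?thesis
  proof (rule op_argsI)
    fix j assume j: "j < length ms"
    show "bs[i := b] ! j \<in> carrier (component P (ms ! j))"
      by (cases "j = i") (use j b op_argsD[OF bs] in auto)
  qed (simp add: op_argsD(1)[OF bs])
qed

lemma nth_map2_ext [simp]: "i < length xs \<Longrightarrow> i < length ys \<Longrightarrow> map2 f xs ys ! i = f (xs ! i) (ys ! i)"
  by simp

lemma map2_list_update:
  "length xs = length ys \<Longrightarrow> i < length ys \<Longrightarrow> map2 f xs (ys[i := y]) = (map2 f xs ys)[i := f (xs ! i) y]"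
  by (rule nth_equalityI) (auto simp: nth_list_update)

section \<open>Morphisms and the inversion of bijective morphisms\<close>

subsection \<open>Morphisms\<close>

lemma operad_homI:
  assumes "\<And>n. n \<ge> 1 \<Longrightarrow> linear_map (component P n) (component Q n) (\<phi> n)"
    and "\<And>n \<sigma> a. n \<ge> 1 \<Longrightarrow> a \<in> carrier (component P n) \<Longrightarrow> \<sigma> permutes {1..n} \<Longrightarrow>
       \<phi> n (op_act P n \<sigma> a) = op_act Q n \<sigma> (\<phi> n a)"
    and "\<phi> 1 (op_unit P) = op_unit Q"
    and "\<And>ms a bs. a \<in> carrier (component P (length ms)) \<Longrightarrow> positive_arities ms \<Longrightarrow> op_args P ms bs \<Longrightarrow>
       \<phi> (sum_list ms) (op_comp P ms a bs) = op_comp Q ms (\<phi> (length ms) a) (map2 \<phi> ms bs)"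
  shows "\<phi> \<in> operad_hom P Q"
  using assms unfolding operad_hom_def by blast

lemma operad_homD:
  assumes "\<phi> \<in> operad_hom P Q"
  shows "n \<ge> 1 \<Longrightarrow> linear_map (component P n) (component Q n) (\<phi> n)"
    and "n \<ge> 1 \<Longrightarrow> a \<in> carrier (component P n) \<Longrightarrow> \<sigma> permutes {1..n} \<Longrightarrow>
       \<phi> n (op_act P n \<sigma> a) = op_act Q n \<sigma> (\<phi> n a)"
    and "\<phi> 1 (op_unit P) = op_unit Q"
    and "a \<in> carrier (component P (length ms)) \<Longrightarrow> positive_arities ms \<Longrightarrow> op_args P ms bs \<Longrightarrow>
       \<phi> (sum_list ms) (op_comp P ms a bs) = op_comp Q ms (\<phi> (length ms) a) (map2 \<phi> ms bs)"
  using assms unfolding operad_hom_def by blast+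

lemma operad_hom_args:
  assumes "\<phi> \<in> operad_hom P Q" "positive_arities ms" "op_args P ms bs"
  shows "op_args Q ms (map2 \<phi> ms bs)"
  using positive_aritiesD(3)[OF assms(2)] op_argsD[OF assms(3)] linear_mapD(1)[OF operad_homD(1)[OF assms(1)]]
  by (intro op_argsI) auto

lemma operad_hom_comp:
  assumes "\<phi> \<in> operad_hom P Q" "\<psi> \<in> operad_hom Q R"
  shows "(\<lambda>n x. \<psi> n (\<phi> n x)) \<in> operad_hom P R"
proof (rule operad_homI)
  note D1 = operad_homD[OF assms(1)] and D2 = operad_homD[OF assms(2)]
  show "linear_map (component P n) (component R n) (\<lambda>x. \<psi> n (\<phi> n x))" if "n \<ge> 1" for n
    using linear_map_comp[OF D1(1)[OF that] D2(1)[OF that]] .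
  show "\<psi> n (\<phi> n (op_act P n \<sigma> a)) = op_act R n \<sigma> (\<psi> n (\<phi> n a))"
    if "n \<ge> 1" "a \<in> carrier (component P n)" "\<sigma> permutes {1..n}" for n \<sigma> a
    using D1(2)[OF that] D2(2)[OF that(1) _ that(3)] linear_mapD(1)[OF D1(1)[OF that(1)] that(2)] by simp
  show "\<psi> 1 (\<phi> 1 (op_unit P)) = op_unit R" by (simp only: D1(3) D2(3))
  fix ms a bs assume *: "a \<in> carrier (component P (length ms))" "positive_arities ms" "op_args P ms bs"
  have "map2 \<psi> ms (map2 \<phi> ms bs) = map2 (\<lambda>n x. \<psi> n (\<phi> n x)) ms bs"
    using op_argsD(1)[OF *(3)] by (intro nth_equalityI) auto
  then show "\<psi> (sum_list ms) (\<phi> (sum_list ms) (op_comp P ms a bs)) =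
    op_comp R ms (\<psi> (length ms) (\<phi> (length ms) a)) (map2 (\<lambda>n x. \<psi> n (\<phi> n x)) ms bs)"
    using D1(4)[OF *] D2(4)[OF _ *(2) operad_hom_args[OF assms(1) *(2,3)]]
      linear_mapD(1)[OF D1(1) *(1)] positive_aritiesD(1)[OF *(2)] by simp
qed

text \<open>What the inversion of a bijective morphism asks of its source: the candidate for the
  preimage of a result has to lie in the carrier. For quotients this is available without the module
  axioms for cosets.\<close>

definition closed_operations :: "('k::field, 'a) operad \<Rightarrow> bool"
  where "closed_operations P \<longleftrightarrow>
    (\<forall>n\<ge>1. \<forall>x\<in>carrier (component P n). \<forall>y\<in>carrier (component P n). x \<oplus>\<^bsub>component P n\<^esub> y \<in> carrier (component P n)) \<and>
    (\<forall>n\<ge>1. \<forall>c. \<forall>x\<in>carrier (component P n). c \<odot>\<^bsub>component P n\<^esub> x \<in> carrier (component P n)) \<and>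
    (\<forall>n\<ge>1. \<forall>\<sigma>. \<forall>x\<in>carrier (component P n). \<sigma> permutes {1..n} \<longrightarrow> op_act P n \<sigma> x \<in> carrier (component P n)) \<and>
    op_unit P \<in> carrier (component P 1) \<and>
    (\<forall>ms bs. \<forall>a\<in>carrier (component P (length ms)). positive_arities ms \<longrightarrow> op_args P ms bs \<longrightarrow>
       op_comp P ms a bs \<in> carrier (component P (sum_list ms)))"

lemma operad_iso_inverse:
  assumes iso: "\<phi> \<in> operad_iso P Q" and cl: "closed_operations P"
  shows "(\<lambda>n. inv_into (carrier (component P n)) (\<phi> n)) \<in> operad_iso Q P"
proof -
  define \<psi> where "\<psi> n = inv_into (carrier (component P n)) (\<phi> n)" for n
  have hom: "\<phi> \<in> operad_hom P Q"
    and bij: "\<And>n. n \<ge> 1 \<Longrightarrow> bij_betw (\<phi> n) (carrier (component P n)) (carrier (component Q n))"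
    using iso by (auto simp: operad_iso_def)
  note D = operad_homD[OF hom]
  have psi: "\<psi> n y \<in> carrier (component P n)" "\<phi> n (\<psi> n y) = y"
    if "n \<ge> 1" "y \<in> carrier (component Q n)" for n y
    using bij_betw_inv_into_right[OF bij[OF that(1)] that(2)]
      bij_betw_apply[OF bij_betw_inv_into[OF bij[OF that(1)]] that(2)] by (auto simp: \<psi>_def)
  \<comment> \<open>Every law for the inverse is checked by applying \<open>\<phi>\<close> to the
    expected value.\<close>
  have eqI: "\<psi> n y = x" if "n \<ge> 1" "x \<in> carrier (component P n)" "y = \<phi> n x" for n x y
    using bij_betw_inv_into_left[OF bij[OF that(1)] that(2)] that(3) by (simp add: \<psi>_def)
  have "\<psi> \<in> operad_hom Q P"
  proof (rule operad_homI)
    show "linear_map (component Q n) (component P n) (\<psi> n)" if n: "n \<ge> 1" for n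
    proof (rule linear_mapI)
      fix x c assume x: "x \<in> carrier (component Q n)"
      show "\<psi> n x \<in> carrier (component P n)" using psi n x by blast
      show "\<psi> n (c \<odot>\<^bsub>component Q n\<^esub> x) = c \<odot>\<^bsub>component P n\<^esub> \<psi> n x"
        by (rule eqI) (use n x psi cl linear_mapD(3)[OF D(1)] in \<open>auto simp: closed_operations_def\<close>)
      fix y assume y: "y \<in> carrier (component Q n)"
      show "\<psi> n (x \<oplus>\<^bsub>component Q n\<^esub> y) = \<psi> n x \<oplus>\<^bsub>component P n\<^esub> \<psi> n y"
        by (rule eqI) (use n x y psi cl linear_mapD(2)[OF D(1)] in \<open>auto simp: closed_operations_def\<close>)
    qed
    show "\<psi> n (op_act Q n \<sigma> a) = op_act P n \<sigma> (\<psi> n a)"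
      if "n \<ge> 1" "a \<in> carrier (component Q n)" "\<sigma> permutes {1..n}" for n \<sigma> a
      by (rule eqI) (use that psi cl D(2) in \<open>auto simp: closed_operations_def\<close>)
    show "\<psi> 1 (op_unit Q) = op_unit P"
      by (rule eqI) (use cl D(3) in \<open>auto simp: closed_operations_def\<close>)
    fix ms a bs assume *: "a \<in> carrier (component Q (length ms))" "positive_arities ms" "op_args Q ms bs"
    note len = positive_aritiesD[OF *(2)]
    have a: "\<psi> (length ms) a \<in> carrier (component P (length ms))" "\<phi> (length ms) (\<psi> (length ms) a) = a"
      using psi len * by auto
    have args: "op_args P ms (map2 \<psi> ms bs)"
      using op_argsD[OF *(3)] len psi by (intro op_argsI) auto
    have "map2 \<phi> ms (map2 \<psi> ms bs) = bs"
      using op_argsD[OF *(3)] len psi by (intro nth_equalityI) auto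
    then show "\<psi> (sum_list ms) (op_comp Q ms a bs) = op_comp P ms (\<psi> (length ms) a) (map2 \<psi> ms bs)"
      by (intro eqI) (use len a args *(2) cl D(4)[OF a(1) *(2) args] in \<open>auto simp: closed_operations_def\<close>)
  qed
  then show ?thesis
    using bij bij_betw_inv_into by (auto simp: operad_iso_def \<psi>_def[abs_def])
qed

text \<open>The two operads meet in the common target \<open>R\<close>; closure of the operations of
  \<open>Q\<close> serves to invert its isomorphism.\<close>

lemma operads_isomorphicI:
  assumes "\<phi> \<in> operad_iso P R" "\<psi> \<in> operad_iso Q R" "closed_operations Q"
  shows "operads_isomorphic P Q"
proof -
  note inv = operad_iso_inverse[OF assms(2,3)]
  let ?\<chi> = "\<lambda>n x. inv_into (carrier (component Q n)) (\<psi> n) (\<phi> n x)"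
  have "?\<chi> \<in> operad_hom P Q"
    using operad_hom_comp assms(1) inv by (auto simp: operad_iso_def)
  moreover have "bij_betw (?\<chi> n) (carrier (component P n)) (carrier (component Q n))" if "n \<ge> 1" for n
    using bij_betw_trans[of "\<phi> n" _ _ "inv_into (carrier (component Q n)) (\<psi> n)"] that assms(1) inv
    by (force simp: operad_iso_def comp_def)
  ultimately show ?thesis unfolding operads_isomorphic_def operad_iso_def by blast
qed

section \<open>Operads spanned by sets, and morphisms defined on a basis\<close>

subsection \<open>Linearized operads\<close>

lemma linearized_operad_simps [simp]:
  "component (linearized_operad B cmp u act) = (\<lambda>n. free_module (B n))"
  "op_comp (linearized_operad B cmp u act) = (\<lambda>ms. multilin_ext (cmp ms))"
  "op_unit (linearized_operad B cmp u act) = basis u"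
  "op_act (linearized_operad B cmp u act) = (\<lambda>n \<sigma>. lin_ext (\<lambda>x. basis (act n \<sigma> x)))"
  by (simp_all add: linearized_operad_def)

text \<open>Covers the three linearized operads that occur: Perm, the free operad, and the pairs
  from which a Hadamard product is formed.\<close>

locale set_operad =
  fixes B :: "nat \<Rightarrow> 'x set" and cmp :: "nat list \<Rightarrow> 'x \<Rightarrow> 'x list \<Rightarrow> 'x" and u :: 'x
    and act :: "nat \<Rightarrow> (nat \<Rightarrow> nat) \<Rightarrow> 'x \<Rightarrow> 'x"
  assumes set_unit: "u \<in> B 1"
    and set_act: "n \<ge> 1 \<Longrightarrow> \<sigma> permutes {1..n} \<Longrightarrow> x \<in> B n \<Longrightarrow> act n \<sigma> x \<in> B n"
    and set_comp: "positive_arities ms \<Longrightarrow> x \<in> B (length ms) \<Longrightarrow> list_all2 (\<lambda>m y. y \<in> B m) ms ys \<Longrightarrow>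
      cmp ms x ys \<in> B (sum_list ms)"
begin

abbreviation lin :: "('k::field, 'x \<Rightarrow>\<^sub>0 'k) operad"
  where "lin \<equiv> linearized_operad B cmp u act"

lemma lin_args: "op_args lin ms bs \<longleftrightarrow> list_all2 (\<lambda>X p. Poly_Mapping.keys p \<subseteq> X) (map B ms) bs"
  by (simp add: op_args_def list_all2_conv_all_nth)

lemma lin_comp_keys:
  assumes "positive_arities ms" "Poly_Mapping.keys a \<subseteq> B (length ms)" "op_args lin ms bs"
  shows "Poly_Mapping.keys (multilin_ext (cmp ms) a bs) \<subseteq> B (sum_list ms)"
  by (rule keys_multilin_ext[OF _ assms(2) assms(3)[unfolded lin_args]])
    (use set_comp[OF assms(1)] in \<open>auto simp: list_all2_conv_all_nth\<close>)

lemma lin_comp_update: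
  assumes "op_args lin ms bs" "i < length ms" "Poly_Mapping.keys b \<subseteq> B (ms ! i)"
  shows "op_args lin ms (bs[i := b])"
  using assms by (intro op_args_update) auto

lemma pre_operad_lin: "pre_operad (lin :: ('k::field, 'x \<Rightarrow>\<^sub>0 'k) operad)"
proof (rule pre_operad.intro)
  let ?L = "lin :: ('k, 'x \<Rightarrow>\<^sub>0 'k) operad"
  show "vspace (component ?L n)" for n by (simp add: vspace_free_module)
  show "op_unit ?L \<in> carrier (component ?L 1)" using set_unit by simp
  show "linear_map (component ?L n) (component ?L n) (op_act ?L n \<sigma>)"
    if "n \<ge> 1" "\<sigma> permutes {1..n}" for n \<sigma>
    using set_act[OF that] by (simp add: linear_map_lin_ext)
  fix ms and bs :: "('x \<Rightarrow>\<^sub>0 'k) list" assume ms: "positive_arities ms" and bs: "op_args ?L ms bs"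
  show "linear_map (component ?L (length ms)) (component ?L (sum_list ms)) (\<lambda>a. op_comp ?L ms a bs)"
    unfolding linearized_operad_simps
  proof (rule linear_mapI)
    fix x y :: "'x \<Rightarrow>\<^sub>0 'k" and c assume "x \<in> carrier (free_module (B (length ms)))"
    then show "multilin_ext (cmp ms) x bs \<in> carrier (free_module (B (sum_list ms)))"
      using lin_comp_keys[OF ms _ bs] by simp
    show "multilin_ext (cmp ms) (c \<odot>\<^bsub>free_module (B (length ms))\<^esub> x) bs =
      c \<odot>\<^bsub>free_module (B (sum_list ms))\<^esub> multilin_ext (cmp ms) x bs"
      using multilin_ext_left[of "cmp ms" x bs] multilin_ext_left[of "cmp ms" "pm_scale c x" bs]
      by (simp add: lin_ext_scale)
    show "multilin_ext (cmp ms) (x \<oplus>\<^bsub>free_module (B (length ms))\<^esub> y) bs =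
      multilin_ext (cmp ms) x bs \<oplus>\<^bsub>free_module (B (sum_list ms))\<^esub> multilin_ext (cmp ms) y bs"
      using multilin_ext_left[of "cmp ms" x bs] multilin_ext_left[of "cmp ms" y bs]
        multilin_ext_left[of "cmp ms" "x + y" bs] by (simp add: lin_ext_add)
  qed
  fix a :: "'x \<Rightarrow>\<^sub>0 'k" and i assume a: "a \<in> carrier (component ?L (length ms))" and i: "i < length ms"
  have i': "i < length bs" using i op_argsD(1)[OF bs] by simp
  show "linear_map (component ?L (ms ! i)) (component ?L (sum_list ms)) (\<lambda>b. op_comp ?L ms a (bs[i := b]))"
    unfolding linearized_operad_simps
  proof (rule linear_mapI)
    fix x y :: "'x \<Rightarrow>\<^sub>0 'k" and c assume "x \<in> carrier (free_module (B (ms ! i)))"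
    then show "multilin_ext (cmp ms) a (bs[i := x]) \<in> carrier (free_module (B (sum_list ms)))"
      using lin_comp_keys[OF ms _ lin_comp_update[OF bs i]] a by auto
    show "multilin_ext (cmp ms) a (bs[i := c \<odot>\<^bsub>free_module (B (ms ! i))\<^esub> x]) =
      c \<odot>\<^bsub>free_module (B (sum_list ms))\<^esub> multilin_ext (cmp ms) a (bs[i := x])"
      by (simp add: multilin_ext_right[OF i', of _ _ x] multilin_ext_right[OF i', of _ _ "pm_scale c x"] lin_ext_scale)
    show "multilin_ext (cmp ms) a (bs[i := x \<oplus>\<^bsub>free_module (B (ms ! i))\<^esub> y]) =
      multilin_ext (cmp ms) a (bs[i := x]) \<oplus>\<^bsub>free_module (B (sum_list ms))\<^esub> multilin_ext (cmp ms) a (bs[i := y])"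
      by (simp add: multilin_ext_right[OF i', of _ _ x] multilin_ext_right[OF i', of _ _ y]
          multilin_ext_right[OF i', of _ _ "x + y"] lin_ext_add)
  qed
qed

text \<open>The predicate form of the principle that multilinear maps are determined by basis elements; it
  also covers congruences modulo a subspace.\<close>

lemma lin_args_induct:
  fixes a :: "'x \<Rightarrow>\<^sub>0 'k::field" and bs :: "('x \<Rightarrow>\<^sub>0 'k) list"
  assumes ms: "positive_arities ms" and a: "Poly_Mapping.keys a \<subseteq> B (length ms)"
    and bs: "op_args lin ms bs"
    and left: "\<And>bs. op_args lin ms bs \<Longrightarrow> submodule {a. Poly_Mapping.keys a \<subseteq> B (length ms) \<and> Q a bs} scalars (free_module (B (length ms)))"
    and right: "\<And>a bs i. Poly_Mapping.keys a \<subseteq> B (length ms) \<Longrightarrow> op_args lin ms bs \<Longrightarrow> i < length ms \<Longrightarrow>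
      submodule {b. Poly_Mapping.keys b \<subseteq> B (ms ! i) \<and> Q a (bs[i := b])} scalars (free_module (B (ms ! i)))"
    and basis: "\<And>x ys. x \<in> B (length ms) \<Longrightarrow> list_all2 (\<lambda>m y. y \<in> B m) ms ys \<Longrightarrow> Q (basis x) (map basis ys)"
  shows "Q a bs"
  using bs[unfolded lin_args]
proof (rule multilinear_induct)
  fix ps :: "('x \<Rightarrow>\<^sub>0 'k) list" and i assume ps: "list_all2 (\<lambda>X p. Poly_Mapping.keys p \<subseteq> X) (map B ms) ps" and i: "i < length (map B ms)"
  note H = submodule_free_moduleD[OF right[OF a ps[folded lin_args]]]
  show "Q a (ps[i := 0])" using H(2)[of i] i by simp
  show "Q a (ps[i := p + q])" if "Poly_Mapping.keys p \<subseteq> map B ms ! i" "Poly_Mapping.keys q \<subseteq> map B ms ! i"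
    "Q a (ps[i := p])" "Q a (ps[i := q])" for p q using H(3)[of i p q] i that by simp
  show "Q a (ps[i := pm_scale c p])" if "Poly_Mapping.keys p \<subseteq> map B ms ! i"
    "Q a (ps[i := p])" for c p using H(4)[of i p c] i that by simp
next
  fix ys assume ys: "list_all2 (\<lambda>X x. x \<in> X) (map B ms) ys"
  then have ys': "list_all2 (\<lambda>m y. y \<in> B m) ms ys" by (simp add: list_all2_conv_all_nth)
  have args: "op_args lin ms (map Defs.basis ys)"
    using ys by (auto simp: lin_args list_all2_conv_all_nth)
  note H = submodule_free_moduleD[OF left[OF args]]
  show "Q a (map Defs.basis ys)" using a
  proof (induction rule: free_module_induct)
    case zero then show ?case using H(2) by simp
  next
    case (basis x) then show ?case using assms(6) ys' by blast
  next
    case (add p q) then show ?case using H(3)[of p q] by simp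
  next
    case (scale c p) then show ?case using H(4)[of p c] by simp
  qed
qed

end

text \<open>Puts an equation between two linear maps into the form of a subspace, as the hypotheses
  of \<open>lin_args_induct\<close> require.\<close>

lemma submodule_equalizer:
  assumes "vspace N" "linear_map (free_module X) N g" "linear_map (free_module X) N h"
  shows "submodule {a. Poly_Mapping.keys a \<subseteq> X \<and> g a = h a} scalars (free_module X)"
  by (rule vspace_submoduleI[OF vspace_free_module])
    (use linear_map_zero[OF vspace_free_module assms(1,2)] linear_map_zero[OF vspace_free_module assms(1,3)]
      linear_mapD[OF assms(2)] linear_mapD[OF assms(3)] in
      \<open>auto simp: keys_pm_scale_subset[THEN subsetD] keys_plus_subset[THEN subsetD]\<close>)

text \<open>The counterpart for congruences: lying in \<open>H\<close> after a linear map is again a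
  linear condition.\<close>

lemma submodule_linear_preimage:
  assumes "submodule H scalars (free_module Y)" "linear_map (free_module X) (free_module Y) h"
  shows "submodule {a. Poly_Mapping.keys a \<subseteq> X \<and> h a \<in> H} scalars (free_module X)"
  by (rule vspace_submoduleI[OF vspace_free_module])
    (use linear_map_zero[OF vspace_free_module vspace_free_module assms(2)] submodule_free_moduleD[OF assms(1)]
      linear_mapD[OF assms(2)] in
      \<open>auto simp: keys_pm_scale_subset[THEN subsetD] keys_plus_subset[THEN subsetD]\<close>)

context set_operad
begin

text \<open>Both sides of the composition law are linear in the root and in each argument, so
  \<open>lin_args_induct\<close> spreads agreement on basis elements to all vectors.\<close>

lemma lin_homI:
  fixes Q :: "('k::field, 'b) operad" and \<phi> :: "nat \<Rightarrow> ('x \<Rightarrow>\<^sub>0 'k) \<Rightarrow> 'b"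
  assumes Q: "pre_operad Q"
    and lin: "\<And>n. n \<ge> 1 \<Longrightarrow> linear_map (free_module (B n)) (component Q n) (\<phi> n)"
    and act: "\<And>n \<sigma> x. n \<ge> 1 \<Longrightarrow> x \<in> B n \<Longrightarrow> \<sigma> permutes {1..n} \<Longrightarrow>
      \<phi> n (basis (act n \<sigma> x)) = op_act Q n \<sigma> (\<phi> n (basis x))"
    and unit: "\<phi> 1 (basis u) = op_unit Q"
    and comp: "\<And>ms x ys. positive_arities ms \<Longrightarrow> x \<in> B (length ms) \<Longrightarrow> list_all2 (\<lambda>m y. y \<in> B m) ms ys \<Longrightarrow>
       \<phi> (sum_list ms) (basis (cmp ms x ys)) =
       op_comp Q ms (\<phi> (length ms) (basis x)) (map2 (\<lambda>m y. \<phi> m (basis y)) ms ys)"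
  shows "\<phi> \<in> operad_hom lin Q"
proof (rule operad_homI)
  interpret L: pre_operad "lin :: ('k, 'x \<Rightarrow>\<^sub>0 'k) operad" by (rule pre_operad_lin)
  interpret Q: pre_operad Q by fact
  show "linear_map (component (lin :: ('k, 'x \<Rightarrow>\<^sub>0 'k) operad) n) (component Q n) (\<phi> n)" if "n \<ge> 1" for n using lin[OF that] by simp
  show "\<phi> 1 (op_unit lin) = op_unit Q" using unit by simp
  show "\<phi> n (op_act lin n \<sigma> a) = op_act Q n \<sigma> (\<phi> n a)"
    if n: "n \<ge> 1" and a: "a \<in> carrier (component lin n)" and s: "\<sigma> permutes {1..n}" for n \<sigma> and a :: "'x \<Rightarrow>\<^sub>0 'k"
  proof (rule linear_map_eq_on_basis[where X = "B n"])
    show "vspace (component Q n)" using Q.component_module[OF n] .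
    show "linear_map (free_module (B n)) (component Q n) (\<lambda>a. \<phi> n (op_act lin n \<sigma> a))"
      using linear_map_comp[OF L.act_linear[OF n s], of "component Q n" "\<phi> n"] lin[OF n] by simp
    show "linear_map (free_module (B n)) (component Q n) (\<lambda>a. op_act Q n \<sigma> (\<phi> n a))"
      using linear_map_comp[OF lin[OF n] Q.act_linear[OF n s]] .
  qed (use a act n s in auto)
  fix ms and a :: "'x \<Rightarrow>\<^sub>0 'k" and bs :: "('x \<Rightarrow>\<^sub>0 'k) list"
  assume a: "a \<in> carrier (component lin (length ms))" and ms: "positive_arities ms" and bs: "op_args lin ms bs"
  note pos = positive_aritiesD[OF ms]
  have args: "op_args Q ms (map2 \<phi> ms bs)" if "op_args lin ms bs" for bs :: "('x \<Rightarrow>\<^sub>0 'k) list"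
    using op_argsD[OF that] linear_mapD(1)[OF lin[OF pos(3)]] by (intro op_argsI) auto
  note NQ = Q.component_module[OF pos(2)]
  let ?L = "\<lambda>a bs. \<phi> (sum_list ms) (op_comp lin ms a bs)"
  let ?R = "\<lambda>a bs. op_comp Q ms (\<phi> (length ms) a) (map2 \<phi> ms bs)"
  have "?L a bs = ?R a bs"
  proof (rule lin_args_induct[OF ms _ bs])
    show "Poly_Mapping.keys a \<subseteq> B (length ms)" using a by simp
    show "submodule {a. Poly_Mapping.keys a \<subseteq> B (length ms) \<and> ?L a bs = ?R a bs} scalars (free_module (B (length ms)))"
      if bs: "op_args lin ms bs" for bs :: "('x \<Rightarrow>\<^sub>0 'k) list"
    proof (rule submodule_equalizer[OF NQ])
      show "linear_map (free_module (B (length ms))) (component Q (sum_list ms)) (\<lambda>a. ?L a bs)"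
        using linear_map_comp[OF L.comp_linear_left[OF ms bs], of "component Q (sum_list ms)" "\<phi> (sum_list ms)"]
          lin[OF pos(2)] by simp
      show "linear_map (free_module (B (length ms))) (component Q (sum_list ms)) (\<lambda>a. ?R a bs)"
        using linear_map_comp[OF lin[OF pos(1)] Q.comp_linear_left[OF ms args[OF bs]]] .
    qed
    show "submodule {b. Poly_Mapping.keys b \<subseteq> B (ms ! i) \<and> ?L a (bs[i := b]) = ?R a (bs[i := b])} scalars (free_module (B (ms ! i)))"
      if a: "Poly_Mapping.keys a \<subseteq> B (length ms)" and bs: "op_args lin ms bs" and i: "i < length ms" for a :: "'x \<Rightarrow>\<^sub>0 'k" and bs i
    proof (rule submodule_equalizer[OF NQ])
      have a': "a \<in> carrier (component lin (length ms))" using a by simp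
      have a2: "\<phi> (length ms) a \<in> carrier (component Q (length ms))" using linear_mapD(1)[OF lin[OF pos(1)]] a by simp
      show "linear_map (free_module (B (ms ! i))) (component Q (sum_list ms)) (\<lambda>b. ?L a (bs[i := b]))"
        using linear_map_comp[OF L.comp_linear_right[OF ms a' bs i], of "component Q (sum_list ms)" "\<phi> (sum_list ms)"]
          lin[OF pos(2)] by simp
      have "map2 \<phi> ms (bs[i := b]) = (map2 \<phi> ms bs)[i := \<phi> (ms ! i) b]" for b
        by (rule map2_list_update) (use op_argsD(1)[OF bs] i in auto)
      then show "linear_map (free_module (B (ms ! i))) (component Q (sum_list ms)) (\<lambda>b. ?R a (bs[i := b]))"
        using linear_map_comp[OF lin[OF pos(3)[OF i]] Q.comp_linear_right[OF ms a2 args[OF bs] i]] by simp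
    qed
    fix x ys assume x: "x \<in> B (length ms)" and ys: "list_all2 (\<lambda>m y. y \<in> B m) ms ys"
    have "map2 \<phi> ms (map basis ys) = map2 (\<lambda>m y. \<phi> m (basis y)) ms ys"
      using list_all2_lengthD[OF ys] by (intro nth_equalityI) auto
    then show "?L (basis x) (map basis ys) = ?R (basis x) (map basis ys)"
      using comp[OF ms x ys] by (simp add: multilin_ext_basis)
  qed
  then show "\<phi> (sum_list ms) (op_comp lin ms a bs) = op_comp Q ms (\<phi> (length ms) a) (map2 \<phi> ms bs)" .
qed

end

section \<open>Operad ideals: kernels and generated ideals\<close>

subsection \<open>Ideals\<close>

lemma operad_idealI:
  assumes "\<And>n. n \<ge> 1 \<Longrightarrow> submodule (I n) scalars (component P n)"
    and "\<And>n \<sigma> a. n \<ge> 1 \<Longrightarrow> a \<in> I n \<Longrightarrow> \<sigma> permutes {1..n} \<Longrightarrow> op_act P n \<sigma> a \<in> I n"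
    and "\<And>ms a bs. positive_arities ms \<Longrightarrow> a \<in> carrier (component P (length ms)) \<Longrightarrow> op_args P ms bs \<Longrightarrow>
       a \<in> I (length ms) \<or> (\<exists>i<length ms. bs ! i \<in> I (ms ! i)) \<Longrightarrow> op_comp P ms a bs \<in> I (sum_list ms)"
  shows "operad_ideal P I"
  using assms unfolding operad_ideal_def by blast

lemma operad_idealD:
  assumes "operad_ideal P I"
  shows "n \<ge> 1 \<Longrightarrow> submodule (I n) scalars (component P n)"
    and "n \<ge> 1 \<Longrightarrow> a \<in> I n \<Longrightarrow> \<sigma> permutes {1..n} \<Longrightarrow> op_act P n \<sigma> a \<in> I n"
    and "positive_arities ms \<Longrightarrow> a \<in> carrier (component P (length ms)) \<Longrightarrow> op_args P ms bs \<Longrightarrow>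
       a \<in> I (length ms) \<Longrightarrow> op_comp P ms a bs \<in> I (sum_list ms)"
    and "positive_arities ms \<Longrightarrow> a \<in> carrier (component P (length ms)) \<Longrightarrow> op_args P ms bs \<Longrightarrow>
       i < length ms \<Longrightarrow> bs ! i \<in> I (ms ! i) \<Longrightarrow> op_comp P ms a bs \<in> I (sum_list ms)"
  using assms unfolding operad_ideal_def by blast+

lemma operad_kernel_iff:
  "x \<in> operad_kernel P Q \<phi> n \<longleftrightarrow> x \<in> carrier (component P n) \<and> \<phi> n x = \<zero>\<^bsub>component Q n\<^esub>"
  by (simp add: operad_kernel_def a_kernel_def')

lemma operad_ideal_kernel:
  assumes P: "pre_operad P" and Q: "pre_operad Q" and hom: "\<phi> \<in> operad_hom P Q"
  shows "operad_ideal P (operad_kernel P Q \<phi>)"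
proof (rule operad_idealI)
  interpret P: pre_operad P by fact
  interpret Q: pre_operad Q by fact
  note D = operad_homD[OF hom]
  show "submodule (operad_kernel P Q \<phi> n) scalars (component P n)" if "n \<ge> 1" for n
    using submodule_kernel[OF P.component_module[OF that] Q.component_module[OF that] D(1)[OF that]]
    by (simp add: operad_kernel_def a_kernel_def')
  show "op_act P n \<sigma> a \<in> operad_kernel P Q \<phi> n"
    if "n \<ge> 1" "a \<in> operad_kernel P Q \<phi> n" "\<sigma> permutes {1..n}" for n \<sigma> a
    using that D(2)[OF that(1) _ that(3)] P.act_closed[OF that(1,3)]
      linear_map_zero[OF Q.component_module[OF that(1)] Q.component_module[OF that(1)] Q.act_linear[OF that(1,3)]]
    by (auto simp: operad_kernel_iff)
  fix ms a bs assume ms: "positive_arities ms" and a: "a \<in> carrier (component P (length ms))" and bs: "op_args P ms bs"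
    and ker: "a \<in> operad_kernel P Q \<phi> (length ms) \<or> (\<exists>i<length ms. bs ! i \<in> operad_kernel P Q \<phi> (ms ! i))"
  note pos = positive_aritiesD[OF ms]
  note args = operad_hom_args[OF hom ms bs]
  have fa: "\<phi> (length ms) a \<in> carrier (component Q (length ms))" using linear_mapD(1)[OF D(1)[OF pos(1)] a] .
  have "op_comp Q ms (\<phi> (length ms) a) (map2 \<phi> ms bs) = \<zero>\<^bsub>component Q (sum_list ms)\<^esub>"
    using ker
  proof
    assume "a \<in> operad_kernel P Q \<phi> (length ms)"
    then show ?thesis
      using linear_map_zero[OF Q.component_module[OF pos(1)] Q.component_module[OF pos(2)] Q.comp_linear_left[OF ms args]]
      by (simp add: operad_kernel_iff)
  next
    assume "\<exists>i<length ms. bs ! i \<in> operad_kernel P Q \<phi> (ms ! i)"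
    then obtain i where i: "i < length ms" "\<phi> (ms ! i) (bs ! i) = \<zero>\<^bsub>component Q (ms ! i)\<^esub>"
      by (auto simp: operad_kernel_iff)
    \<comment> \<open>The zero in slot \<open>i\<close> is written as a list update, so that
      linearity in that slot yields a zero composite.\<close>
    then have "map2 \<phi> ms bs = (map2 \<phi> ms bs)[i := \<zero>\<^bsub>component Q (ms ! i)\<^esub>]"
      using op_argsD(1)[OF bs] by (metis list_update_id nth_map2_ext)
    then show ?thesis
      using linear_map_zero[OF Q.component_module[OF pos(3)[OF i(1)]] Q.component_module[OF pos(2)]
          Q.comp_linear_right[OF ms fa args i(1)]] by simp
  qed
  then show "op_comp P ms a bs \<in> operad_kernel P Q \<phi> (sum_list ms)"
    using P.comp_closed[OF ms a bs] D(4)[OF a ms bs] by (simp add: operad_kernel_iff)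
qed

lemma generated_ideal_iff:
  "x \<in> generated_ideal P S n \<longleftrightarrow>
    (\<forall>I. operad_ideal P I \<longrightarrow> (\<forall>m\<ge>1. S \<inter> carrier (component P m) \<subseteq> I m) \<longrightarrow> x \<in> I n)"
  by (auto simp: generated_ideal_def)

lemma generated_ideal_least:
  assumes "operad_ideal P I" "\<And>m. m \<ge> 1 \<Longrightarrow> S \<inter> carrier (component P m) \<subseteq> I m"
  shows "generated_ideal P S n \<subseteq> I n"
  using assms unfolding generated_ideal_def by blast

lemma generated_ideal_superset: "m \<ge> 1 \<Longrightarrow> x \<in> S \<Longrightarrow> x \<in> carrier (component P m) \<Longrightarrow> x \<in> generated_ideal P S m"
  by (auto simp: generated_ideal_def)

lemma operad_ideal_generated:
  assumes "pre_operad P"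
  shows "operad_ideal P (generated_ideal P S)"
proof -
  interpret pre_operad P by fact
  \<comment> \<open>The whole operad is an ideal, so the intersection runs over a nonempty family
    and stays inside the carriers.\<close>
  have full: "operad_ideal P (\<lambda>n. carrier (component P n))"
    by (rule operad_idealI)
      (use module.carrier_is_submodule[OF component_module] act_closed comp_closed in auto)
  show ?thesis
  proof (rule operad_idealI)
    fix n :: nat assume n: "n \<ge> 1"
    show "submodule (generated_ideal P S n) scalars (component P n)"
    proof (rule vspace_submoduleI[OF component_module[OF n]])
      show "generated_ideal P S n \<subseteq> carrier (component P n)"
        by (rule generated_ideal_least[OF full]) auto
    qed (use vspace_submoduleD[OF component_module[OF n] operad_idealD(1)[OF _ n]] in
        \<open>simp_all add: generated_ideal_iff\<close>)
    show "op_act P n \<sigma> a \<in> generated_ideal P S n" if "a \<in> generated_ideal P S n" "\<sigma> permutes {1..n}" for \<sigma> a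
      unfolding generated_ideal_iff
    proof (intro allI impI)
      fix I assume I: "operad_ideal P I" "\<forall>m\<ge>1. S \<inter> carrier (component P m) \<subseteq> I m"
      with that(1) have "a \<in> I n" by (simp add: generated_ideal_iff)
      then show "op_act P n \<sigma> a \<in> I n" by (rule operad_idealD(2)[OF I(1) n _ that(2)])
    qed
  next
    fix ms a bs assume ms: "positive_arities ms" "a \<in> carrier (component P (length ms))" "op_args P ms bs"
      and ker: "a \<in> generated_ideal P S (length ms) \<or> (\<exists>i<length ms. bs ! i \<in> generated_ideal P S (ms ! i))"
    have "op_comp P ms a bs \<in> I (sum_list ms)"
      if I: "operad_ideal P I" "\<forall>m\<ge>1. S \<inter> carrier (component P m) \<subseteq> I m" for I
      using ker operad_idealD(3)[OF I(1) ms] operad_idealD(4)[OF I(1) ms]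
        generated_ideal_least[OF I(1), of S] I(2) by blast
    then show "op_comp P ms a bs \<in> generated_ideal P S (sum_list ms)"
      by (simp add: generated_ideal_iff)
  qed
qed

section \<open>The first isomorphism theorem for operads\<close>

subsection \<open>Quotients by kernels\<close>

text \<open>Cosets are handled as fibres of \<open>\<phi>\<close>, and equations between cosets as
  equations in \<open>C\<close>. The set \<open>I n\<close> is prescribed for
  \<open>n \<ge> 1\<close> only, the range in which components have a meaning.\<close>

locale operad_quotient = A: pre_operad A + C: pre_operad C
  for A :: "('k::field, 'a) operad" and C :: "('k, 'c) operad" +
  fixes \<phi> :: "nat \<Rightarrow> 'a \<Rightarrow> 'c" and I :: "nat \<Rightarrow> 'a set"
  assumes hom: "\<phi> \<in> operad_hom A C"
    and kernel: "n \<ge> 1 \<Longrightarrow> I n = operad_kernel A C \<phi> n"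
    and surj: "n \<ge> 1 \<Longrightarrow> \<phi> n ` carrier (component A n) = carrier (component C n)"
begin

abbreviation quot where "quot \<equiv> quotient_operad A I"
abbreviation proj where "proj \<equiv> quotient_map A I"

text \<open>On a coset \<open>\<phi>\<close> is constant, so its image there has exactly one element
  for \<open>the_elem\<close> to extract.\<close>

definition induced :: "nat \<Rightarrow> 'a set \<Rightarrow> 'c"
  where "induced n X = the_elem (\<phi> n ` X)"

lemmas homD = operad_homD[OF hom]

text \<open>Two vectors with equal images differ by an element of the kernel. Unions over a coset
  thereby become unions over a fibre.\<close>

lemma proj_eq:
  assumes n: "n \<ge> 1" and x: "x \<in> carrier (component A n)"
  shows "proj n x = {y \<in> carrier (component A n). \<phi> n y = \<phi> n x}"
proof -
  interpret M: module scalars "component A n" using A.component_module[OF n] .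
  interpret N: module scalars "component C n" using C.component_module[OF n] .
  note lin = linear_mapD[OF homD(1)[OF n]]
  have phi_minus: "\<phi> n (y \<ominus>\<^bsub>component A n\<^esub> x) = \<phi> n y \<ominus>\<^bsub>component C n\<^esub> \<phi> n x"
    if "y \<in> carrier (component A n)" for y
    using that x by (simp add: a_minus_def lin vspace_a_inv[OF A.component_module[OF n]]
        vspace_a_inv[OF C.component_module[OF n]] M.smult_closed[of "-1"])
  show ?thesis
  proof (intro Set.set_eqI iffI)
    fix y assume "y \<in> proj n x"
    then obtain h where "h \<in> I n" "y = h \<oplus>\<^bsub>component A n\<^esub> x"
      by (auto simp: quotient_map_def a_r_coset_def')
    then show "y \<in> {y \<in> carrier (component A n). \<phi> n y = \<phi> n x}"
      using kernel[OF n] x lin by (auto simp: operad_kernel_iff)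
  next
    fix y assume y: "y \<in> {y \<in> carrier (component A n). \<phi> n y = \<phi> n x}"
    then have "\<phi> n (y \<ominus>\<^bsub>component A n\<^esub> x) = \<zero>\<^bsub>component C n\<^esub>"
      using phi_minus[of y] lin(1)[of x] x by (simp add: N.r_neg a_minus_def)
    moreover have "y = (y \<ominus>\<^bsub>component A n\<^esub> x) \<oplus>\<^bsub>component A n\<^esub> x"
      using x y by (simp add: a_minus_def M.a_assoc M.l_neg)
    moreover have "y \<ominus>\<^bsub>component A n\<^esub> x \<in> carrier (component A n)" using x y by simp
    ultimately have "\<exists>h\<in>I n. y = h \<oplus>\<^bsub>component A n\<^esub> x"
      unfolding kernel[OF n] operad_kernel_iff Bex_def by blast
    then show "y \<in> proj n x" by (simp add: quotient_map_def a_r_coset_def')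
  qed
qed

lemma proj_eq_iff:
  assumes "n \<ge> 1" "x \<in> carrier (component A n)" "y \<in> carrier (component A n)"
  shows "proj n x = proj n y \<longleftrightarrow> \<phi> n x = \<phi> n y"
  using assms by (auto simp: proj_eq)

lemma proj_self: "n \<ge> 1 \<Longrightarrow> x \<in> carrier (component A n) \<Longrightarrow> x \<in> proj n x"
  by (simp add: proj_eq)

lemma induced_proj: "n \<ge> 1 \<Longrightarrow> x \<in> carrier (component A n) \<Longrightarrow> induced n (proj n x) = \<phi> n x"
proof -
  assume "n \<ge> 1" "x \<in> carrier (component A n)"
  then have "\<phi> n ` proj n x = {\<phi> n x}" by (auto simp: proj_eq)
  then show ?thesis by (simp add: induced_def)
qed

lemma quot_carrier: "carrier (component quot n) = proj n ` carrier (component A n)"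
  by (auto simp: quotient_operad_def quotient_module_def A_RCOSETS_def' quotient_map_def)

lemma I_proj: "n \<ge> 1 \<Longrightarrow> I n = proj n \<zero>\<^bsub>component A n\<^esub>"
proof -
  assume n: "n \<ge> 1"
  interpret M: module scalars "component A n" using A.component_module[OF n] .
  show ?thesis using linear_map_zero[OF A.component_module[OF n] C.component_module[OF n] homD(1)[OF n]]
    by (auto simp: proj_eq[OF n M.zero_closed] kernel[OF n] operad_kernel_iff)
qed

lemma proj_zero_iff:
  assumes "n \<ge> 1" "x \<in> carrier (component A n)"
  shows "proj n x = \<zero>\<^bsub>component quot n\<^esub> \<longleftrightarrow> \<phi> n x = \<zero>\<^bsub>component C n\<^esub>"
proof -
  interpret M: module scalars "component A n" using A.component_module[OF assms(1)] .
  show ?thesis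
    using proj_eq_iff[OF assms M.zero_closed] I_proj[OF assms(1)]
      linear_map_zero[OF A.component_module C.component_module homD(1)] assms(1)
    by (simp add: quotient_operad_def quotient_module_def)
qed

text \<open>Most quotient operations are unions over all choices of representatives; such a union
  collapses because \<open>\<phi>\<close> takes the same value on every result.\<close>

lemma proj_UN:
  assumes n: "n \<ge> 1" and z: "z \<in> carrier (component A n)" and "Z \<noteq> {}"
    and "\<And>y. y \<in> Z \<Longrightarrow> f y \<in> carrier (component A n) \<and> \<phi> n (f y) = \<phi> n z"
  shows "(\<Union>y\<in>Z. proj n (f y)) = proj n z"
proof -
  have "proj n (f y) = proj n z" if "y \<in> Z" for y
    using assms(4)[OF that] proj_eq_iff[OF n _ z] by blast
  with \<open>Z \<noteq> {}\<close> show ?thesis by auto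
qed

text \<open>Addition of cosets is a sum of sets and not a union of cosets, so the law for additive
  cosets takes the place of \<open>proj_UN\<close>.\<close>

lemma quot_add:
  assumes n: "n \<ge> 1" and x: "x \<in> carrier (component A n)" and y: "y \<in> carrier (component A n)"
  shows "proj n x \<oplus>\<^bsub>component quot n\<^esub> proj n y = proj n (x \<oplus>\<^bsub>component A n\<^esub> y)"
proof -
  interpret M: module scalars "component A n" using A.component_module[OF n] .
  note sub = operad_idealD(1)[OF operad_ideal_kernel[OF A.pre_operad_axioms C.pre_operad_axioms hom] n]
  interpret abelian_subgroup "I n" "component A n"
    by (rule abelian_subgroupI3)
      (use submodule.axioms(1)[OF sub] kernel[OF n] M.abelian_group_axioms in \<open>auto intro: additive_subgroup.intro\<close>)
  show ?thesis using a_rcos_sum[OF x y]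
    by (simp add: quotient_operad_def quotient_module_def quotient_map_def)
qed

lemma quot_smult:
  assumes n: "n \<ge> 1" and x: "x \<in> carrier (component A n)"
  shows "c \<odot>\<^bsub>component quot n\<^esub> proj n x = proj n (c \<odot>\<^bsub>component A n\<^esub> x)"
proof -
  interpret M: module scalars "component A n" using A.component_module[OF n] .
  have "c \<odot>\<^bsub>component quot n\<^esub> proj n x = (\<Union>y\<in>proj n x. proj n (c \<odot>\<^bsub>component A n\<^esub> y))"
    by (simp add: quotient_operad_def quotient_module_def quotient_map_def)
  also have "\<dots> = proj n (c \<odot>\<^bsub>component A n\<^esub> x)"
    by (rule proj_UN) (use n x proj_self[OF n x] proj_eq[OF n x] linear_mapD(3)[OF homD(1)[OF n]] in auto)
  finally show ?thesis .
qed

lemma quot_act: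
  assumes n: "n \<ge> 1" and x: "x \<in> carrier (component A n)" and s: "\<sigma> permutes {1..n}"
  shows "op_act quot n \<sigma> (proj n x) = proj n (op_act A n \<sigma> x)"
proof -
  have "op_act quot n \<sigma> (proj n x) = (\<Union>y\<in>proj n x. proj n (op_act A n \<sigma> y))"
    by (simp add: quotient_operad_def quotient_map_def)
  also have "\<dots> = proj n (op_act A n \<sigma> x)"
    by (rule proj_UN) (use n x s proj_self[OF n x] proj_eq[OF n x] homD(2)[OF n] A.act_closed in auto)
  finally show ?thesis .
qed

lemma quot_unit: "op_unit quot = proj 1 (op_unit A)"
  by (simp add: quotient_operad_def quotient_map_def)

lemma quot_comp:
  assumes ms: "positive_arities ms" and a: "a \<in> carrier (component A (length ms))" and bs: "op_args A ms bs"
  shows "op_comp quot ms (proj (length ms) a) (map2 proj ms bs) = proj (sum_list ms) (op_comp A ms a bs)"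
proof -
  note pos = positive_aritiesD[OF ms]
  \<comment> \<open>The union over roots and the union over argument lists are merged into a single
    one over pairs, the form in which \<open>proj_UN\<close> applies.\<close>
  have "op_comp quot ms (proj (length ms) a) (map2 proj ms bs) =
    (\<Union>z\<in>proj (length ms) a \<times> listset (map2 proj ms bs). proj (sum_list ms) (op_comp A ms (fst z) (snd z)))"
    unfolding quotient_operad_def quotient_map_def operad.simps by (fastforce simp only: UN_iff SigmaI fst_conv snd_conv mem_Sigma_iff split_paired_all)
  also have "\<dots> = proj (sum_list ms) (op_comp A ms a bs)"
  proof (rule proj_UN[OF pos(2) A.comp_closed[OF ms a bs]])
    have "bs \<in> listset (map2 proj ms bs)"
      using op_argsD[OF bs] pos(3) proj_self by (auto simp: in_listset_iff list_all2_conv_all_nth)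
    then show "proj (length ms) a \<times> listset (map2 proj ms bs) \<noteq> {}" using proj_self[OF pos(1) a] by auto
    fix z assume "z \<in> proj (length ms) a \<times> listset (map2 proj ms bs)"
    then obtain a' bs' where z: "z = (a', bs')" "a' \<in> proj (length ms) a" "bs' \<in> listset (map2 proj ms bs)" by auto
    have a': "a' \<in> carrier (component A (length ms))" "\<phi> (length ms) a' = \<phi> (length ms) a"
      using z proj_eq[OF pos(1) a] by auto
    have b: "bs' ! i \<in> carrier (component A (ms ! i))" "\<phi> (ms ! i) (bs' ! i) = \<phi> (ms ! i) (bs ! i)"
      if "i < length ms" for i
      using z(3) that op_argsD[OF bs] proj_eq[OF pos(3)[OF that], of "bs ! i"]
      by (auto simp: in_listset_iff list_all2_conv_all_nth)
    have len: "length bs' = length ms"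
      using z(3) op_argsD(1)[OF bs] by (auto simp: in_listset_iff dest!: list_all2_lengthD)
    have args: "op_args A ms bs'" using b len by (intro op_argsI) auto
    have "map2 \<phi> ms bs' = map2 \<phi> ms bs"
      using b len op_argsD(1)[OF bs] by (intro nth_equalityI) auto
    then show "op_comp A ms (fst z) (snd z) \<in> carrier (component A (sum_list ms)) \<and>
      \<phi> (sum_list ms) (op_comp A ms (fst z) (snd z)) = \<phi> (sum_list ms) (op_comp A ms a bs)"
      using A.comp_closed[OF ms a'(1) args] homD(4)[OF a'(1) ms args] homD(4)[OF a ms bs] z(1) a'(2) by simp
  qed
  finally show ?thesis .
qed

lemma quot_args:
  assumes ms: "positive_arities ms" and bs: "op_args quot ms bs"
  obtains as where "op_args A ms as" "bs = map2 proj ms as"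
proof -
  have "\<exists>x. i < length ms \<longrightarrow> x \<in> carrier (component A (ms ! i)) \<and> bs ! i = proj (ms ! i) x" for i
    using op_argsD(2)[OF bs, of i] by (auto simp: quot_carrier)
  then obtain x where x: "\<And>i. i < length ms \<Longrightarrow> x i \<in> carrier (component A (ms ! i)) \<and> bs ! i = proj (ms ! i) (x i)"
    by metis
  show ?thesis
  proof
    show "op_args A ms (map x [0..<length ms])" by (rule op_argsI) (use x in auto)
    show "bs = map2 proj ms (map x [0..<length ms])"
      by (rule nth_equalityI) (use x op_argsD(1)[OF bs] in auto)
  qed
qed

lemma closed_operations_quot: "closed_operations quot"
  unfolding closed_operations_def
proof (intro conjI allI impI ballI)
  fix n :: nat assume n: "n \<ge> 1"
  interpret M: module scalars "component A n" using A.component_module[OF n] .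
  fix x assume x: "x \<in> carrier (component quot n)"
  show "c \<odot>\<^bsub>component quot n\<^esub> x \<in> carrier (component quot n)" for c
    using x quot_smult[OF n] by (auto simp: quot_carrier)
  show "op_act quot n \<sigma> x \<in> carrier (component quot n)" if "\<sigma> permutes {1..n}" for \<sigma>
    using x quot_act[OF n _ that] A.act_closed[OF n that] by (auto simp: quot_carrier)
  fix y assume y: "y \<in> carrier (component quot n)"
  show "x \<oplus>\<^bsub>component quot n\<^esub> y \<in> carrier (component quot n)"
    using x y quot_add[OF n] by (auto simp: quot_carrier)
next
  show "op_unit quot \<in> carrier (component quot 1)"
    using A.unit_closed unfolding quot_unit quot_carrier by blast
next
  fix ms bs a assume a: "a \<in> carrier (component quot (length ms))" and ms: "positive_arities ms" and bs: "op_args quot ms bs"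
  show "op_comp quot ms a bs \<in> carrier (component quot (sum_list ms))"
  proof -
    obtain a' where a': "a' \<in> carrier (component A (length ms))" "a = proj (length ms) a'" using a by (auto simp: quot_carrier)
    obtain bs' where bs': "op_args A ms bs'" "bs = map2 proj ms bs'" using quot_args[OF ms bs] .
    show ?thesis using quot_comp[OF ms a'(1) bs'(1)] A.comp_closed[OF ms a'(1) bs'(1)] a'(2) bs'(2)
      by (simp add: quot_carrier)
  qed
qed

lemma induced_iso: "induced \<in> operad_iso quot C"
proof -
  have "induced \<in> operad_hom quot C"
  proof (rule operad_homI)
    fix n :: nat assume n: "n \<ge> 1"
    interpret M: module scalars "component A n" using A.component_module[OF n] .
    note lin = linear_mapD[OF homD(1)[OF n]]
    show "linear_map (component quot n) (component C n) (induced n)"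
      by (rule linear_mapI) (auto simp: quot_carrier quot_add[OF n] quot_smult[OF n] induced_proj[OF n] lin)
    show "induced n (op_act quot n \<sigma> a) = op_act C n \<sigma> (induced n a)"
      if "a \<in> carrier (component quot n)" "\<sigma> permutes {1..n}" for \<sigma> a
      using that by (auto simp: quot_carrier quot_act[OF n] induced_proj[OF n] A.act_closed[OF n] homD(2)[OF n])
  next
    show "induced 1 (op_unit quot) = op_unit C"
      using induced_proj[of 1] A.unit_closed homD(3) by (simp add: quot_unit)
  next
    fix ms bs a assume a: "a \<in> carrier (component quot (length ms))" and ms: "positive_arities ms" and bs: "op_args quot ms bs"
    note pos = positive_aritiesD[OF ms]
    obtain a' where a': "a' \<in> carrier (component A (length ms))" "a = proj (length ms) a'" using a by (auto simp: quot_carrier)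
    obtain bs' where bs': "op_args A ms bs'" "bs = map2 proj ms bs'" using quot_args[OF ms bs] .
    have "map2 induced ms bs = map2 \<phi> ms bs'"
      using bs' op_argsD[OF bs'(1)] induced_proj pos(3) by (intro nth_equalityI) auto
    then show "induced (sum_list ms) (op_comp quot ms a bs) = op_comp C ms (induced (length ms) a) (map2 induced ms bs)"
      using induced_proj[OF pos(2) A.comp_closed[OF ms a'(1) bs'(1)]] induced_proj[OF pos(1) a'(1)]
        quot_comp[OF ms a'(1) bs'(1)] homD(4)[OF a'(1) ms bs'(1)] unfolding a'(2) bs'(2) by simp
  qed
  moreover have "bij_betw (induced n) (carrier (component quot n)) (carrier (component C n))" if n: "n \<ge> 1" for n
    unfolding bij_betw_def
  proof
    show "inj_on (induced n) (carrier (component quot n))"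
      unfolding quot_carrier
    proof (rule inj_onI, elim imageE)
      fix X Y x y assume "induced n X = induced n Y" "X = proj n x" "Y = proj n y"
        "x \<in> carrier (component A n)" "y \<in> carrier (component A n)"
      then show "X = Y" using proj_eq_iff[OF n] by (simp add: induced_proj[OF n])
    qed
    show "induced n ` carrier (component quot n) = carrier (component C n)"
      unfolding quot_carrier surj[OF n, symmetric] image_image
      by (rule image_cong) (auto simp: induced_proj[OF n])
  qed
  ultimately show ?thesis by (auto simp: operad_iso_def)
qed

end

section \<open>Positions in a concatenation of blocks\<close>

section \<open>Block decompositions\<close>

lemma offset_simps [simp]:
  "offset ms 0 = 0" "offset (m # ms) (Suc i) = m + offset ms i"
  by (simp_all add: offset_def)

text \<open>The inverse of \<open>(i, j) \<mapsto> offset ms i + j\<close>, with the block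
  \<open>i\<close> counted from 0 and the place \<open>j\<close> in it from 1. The value at the
  empty list is reached only by positions past the last block.\<close>

fun blk :: "nat list \<Rightarrow> nat \<Rightarrow> nat \<times> nat" where
  "blk [] k = (0, k)"
| "blk (m # ms) k = (if k \<le> m then (0, k) else (Suc (fst (blk ms (k - m))), snd (blk ms (k - m))))"

lemma blk_offset: "i < length ms \<Longrightarrow> 1 \<le> j \<Longrightarrow> j \<le> ms ! i \<Longrightarrow> blk ms (offset ms i + j) = (i, j)"
proof (induction ms arbitrary: i)
  case (Cons m ms)
  then show ?case by (cases i) auto
qed simp

lemma offset_le: "i < length ms \<Longrightarrow> j \<le> ms ! i \<Longrightarrow> offset ms i + j \<le> sum_list ms"
proof (induction ms arbitrary: i)
  case (Cons m ms)
  then show ?case by (cases i) auto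
qed simp

lemma block_cases:
  assumes "k \<in> {1..sum_list ms}"
  obtains i j where "i < length ms" "j \<in> {1..ms ! i}" "k = offset ms i + j" "blk ms k = (i, j)"
proof -
  have "\<exists>i<length ms. \<exists>j\<in>{1..ms ! i}. k = offset ms i + j"
    using assms
  proof (induction ms arbitrary: k)
    case (Cons m ms)
    show ?case
    proof (cases "k \<le> m")
      case True
      then show ?thesis using Cons.prems by (intro exI[of _ 0]) auto
    next
      case False
      then have "k - m \<in> {1..sum_list ms}" using Cons.prems by auto
      then obtain i j where "i < length ms" "j \<in> {1..ms ! i}" "k - m = offset ms i + j"
        using Cons.IH by blast
      then show ?thesis using False by (intro exI[of _ "Suc i"] conjI bexI[of _ j]) auto
    qed
  qed simp
  then show ?thesis using that blk_offset by auto
qed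

lemma offset_eq_iff:
  assumes "i < length ms" "j \<in> {1..ms ! i}" "i' < length ms" "j' \<in> {1..ms ! i'}"
  shows "offset ms i + j = offset ms i' + j' \<longleftrightarrow> i = i' \<and> j = j'"
proof
  assume "offset ms i + j = offset ms i' + j'"
  from arg_cong[OF this, of "blk ms"] show "i = i' \<and> j = j'"
    using blk_offset[of i ms j] blk_offset[of i' ms j'] assms by simp
qed simp

section \<open>Powers of a vector space and the operad structure on coordinates\<close>

section \<open>The operad of coordinates\<close>

text \<open>The \<open>n\<close>-fold power of \<open>M\<close>. Functions are extensional, so that
  vectors with equal coordinates at \<open>1..n\<close> are equal.\<close>

definition fun_module :: "('k::field, 'a) module \<Rightarrow> nat \<Rightarrow> ('k, nat \<Rightarrow> 'a) module"
  where "fun_module M n =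
    \<lparr>carrier = {1..n} \<rightarrow>\<^sub>E carrier M, mult = undefined, one = undefined,
     zero = (\<lambda>k\<in>{1..n}. \<zero>\<^bsub>M\<^esub>), add = (\<lambda>F G. \<lambda>k\<in>{1..n}. F k \<oplus>\<^bsub>M\<^esub> G k),
     smult = (\<lambda>c F. \<lambda>k\<in>{1..n}. c \<odot>\<^bsub>M\<^esub> F k)\<rparr>"

lemma fun_module_simps:
  "carrier (fun_module M n) = {1..n} \<rightarrow>\<^sub>E carrier M"
  "\<zero>\<^bsub>fun_module M n\<^esub> = (\<lambda>k\<in>{1..n}. \<zero>\<^bsub>M\<^esub>)"
  "F \<oplus>\<^bsub>fun_module M n\<^esub> G = (\<lambda>k\<in>{1..n}. F k \<oplus>\<^bsub>M\<^esub> G k)"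
  "c \<odot>\<^bsub>fun_module M n\<^esub> F = (\<lambda>k\<in>{1..n}. c \<odot>\<^bsub>M\<^esub> F k)"
  by (simp_all add: fun_module_def)

lemma fun_module_eqI:
  "F \<in> carrier (fun_module M n) \<Longrightarrow> G \<in> carrier (fun_module M n) \<Longrightarrow>
    (\<And>k. k \<in> {1..n} \<Longrightarrow> F k = G k) \<Longrightarrow> F = G"
  unfolding fun_module_simps by (rule PiE_ext)

lemma fun_module_mem: "F \<in> carrier (fun_module M n) \<Longrightarrow> k \<in> {1..n} \<Longrightarrow> F k \<in> carrier M"
  by (auto simp: fun_module_simps)

lemma vspace_fun_module:
  assumes "vspace M"
  shows "vspace (fun_module M n)"
proof -
  interpret M: module scalars M by fact
  have inv: "(-1) \<odot>\<^bsub>M\<^esub> x \<oplus>\<^bsub>M\<^esub> x = \<zero>\<^bsub>M\<^esub>" if "x \<in> carrier M" for x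
    using vspace_a_inv[OF assms that] M.l_neg[OF that] by simp
  have mem: "F k \<in> carrier M" if "F \<in> {1..n} \<rightarrow>\<^sub>E carrier M" "Suc 0 \<le> k" "k \<le> n" for F k
    using that by auto
  note simps = fun_module_simps mem inv M.smult_r_distr M.smult_l_distr[simplified]
    M.smult_assoc1[simplified] M.smult_one[simplified] M.a_assoc M.smult_closed
  show ?thesis
  proof (rule vspaceI)
    fix F G assume FG: "F \<in> carrier (fun_module M n)" "G \<in> carrier (fun_module M n)"
    then show add: "F \<oplus>\<^bsub>fun_module M n\<^esub> G \<in> carrier (fun_module M n)" by (auto simp: simps)
    show "F \<oplus>\<^bsub>fun_module M n\<^esub> G = G \<oplus>\<^bsub>fun_module M n\<^esub> F"
      using FG by (auto simp: fun_module_simps mem intro!: restrict_ext M.a_comm)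
    show "c \<odot>\<^bsub>fun_module M n\<^esub> (F \<oplus>\<^bsub>fun_module M n\<^esub> G) =
      c \<odot>\<^bsub>fun_module M n\<^esub> F \<oplus>\<^bsub>fun_module M n\<^esub> c \<odot>\<^bsub>fun_module M n\<^esub> G" for c
      using FG by (auto simp: simps intro!: restrict_ext)
    show "(F \<oplus>\<^bsub>fun_module M n\<^esub> G) \<oplus>\<^bsub>fun_module M n\<^esub> H =
      F \<oplus>\<^bsub>fun_module M n\<^esub> (G \<oplus>\<^bsub>fun_module M n\<^esub> H)" if "H \<in> carrier (fun_module M n)" for H
      using FG that by (auto simp: simps intro!: restrict_ext)
  next
    show zero: "\<zero>\<^bsub>fun_module M n\<^esub> \<in> carrier (fun_module M n)" by (auto simp: simps)
    fix F assume F: "F \<in> carrier (fun_module M n)"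
    show smult: "c \<odot>\<^bsub>fun_module M n\<^esub> F \<in> carrier (fun_module M n)" for c using F by (auto simp: simps)
    show "(-1) \<odot>\<^bsub>fun_module M n\<^esub> F \<oplus>\<^bsub>fun_module M n\<^esub> F = \<zero>\<^bsub>fun_module M n\<^esub>"
      using F by (auto simp: simps intro!: restrict_ext)
    show "(c + d) \<odot>\<^bsub>fun_module M n\<^esub> F = c \<odot>\<^bsub>fun_module M n\<^esub> F \<oplus>\<^bsub>fun_module M n\<^esub> d \<odot>\<^bsub>fun_module M n\<^esub> F"
      "(c * d) \<odot>\<^bsub>fun_module M n\<^esub> F = c \<odot>\<^bsub>fun_module M n\<^esub> (d \<odot>\<^bsub>fun_module M n\<^esub> F)" for c d
      using F by (auto simp: simps intro!: restrict_ext)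
    have "1 \<odot>\<^bsub>fun_module M n\<^esub> F \<in> carrier (fun_module M n)" by (rule smult)
    then show "1 \<odot>\<^bsub>fun_module M n\<^esub> F = F"
      by (rule fun_module_eqI[OF _ F]) (use F in \<open>auto simp: simps\<close>)
    have "\<zero>\<^bsub>fun_module M n\<^esub> \<oplus>\<^bsub>fun_module M n\<^esub> F \<in> carrier (fun_module M n)" using F by (auto simp: simps)
    then show "\<zero>\<^bsub>fun_module M n\<^esub> \<oplus>\<^bsub>fun_module M n\<^esub> F = F"
      by (rule fun_module_eqI[OF _ F]) (use F in \<open>auto simp: simps\<close>)
  qed
qed

lemma linear_map_fun_moduleI:
  assumes "\<And>k. k \<in> {1..n} \<Longrightarrow> linear_map M N (\<lambda>x. h x k)"
  shows "linear_map M (fun_module N n) (\<lambda>x. \<lambda>k\<in>{1..n}. h x k)"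
  by (rule linear_mapI) (auto simp: fun_module_simps linear_mapD[OF assms] intro!: restrict_ext)

lemma linear_map_eval: "k \<in> {1..n} \<Longrightarrow> linear_map (fun_module N n) N (\<lambda>F. F k)"
  by (rule linear_mapI) (auto simp: fun_module_simps)

lemma linear_map_total: "vspace N \<Longrightarrow> linear_map (fun_module N n) N (\<lambda>F. finsum N F {1..n})"
  using linear_map_finsum_pointwise[of N "{1..n}" "fun_module N n" "\<lambda>k F. F k"] linear_map_eval
  by auto

text \<open>\<open>coord_operad P\<close> is \<open>di P\<close> in coordinates: the tensor \<open>\<Sum>\<^sub>k a\<^sub>k \<otimes> e\<^sub>k\<close> becomes the function
  \<open>k \<mapsto> a\<^sub>k\<close>.  In a composition of such tensors, the coefficient at the position \<open>j\<close> of the block \<open>i\<close>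
  only sees the coefficient \<open>j\<close> of the argument \<open>i\<close>, but all coefficients of the other arguments.\<close>

definition slots :: "('k::field, 'a) operad \<Rightarrow> nat list \<Rightarrow> (nat \<Rightarrow> 'a) list \<Rightarrow> nat \<Rightarrow> nat \<Rightarrow> 'a list"
  where "slots P ms Gs i j = map (\<lambda>q. if q = i then (Gs ! q) j
    else finsum (component P (ms ! q)) (Gs ! q) {1..ms ! q}) [0..<length ms]"

text \<open>\<open>Suc\<close> turns the block index, counted from 0, into a coordinate. The action
  moves the basis element with index \<open>k\<close> to the one with index
  \<open>\<sigma> k\<close>, so the coefficient at \<open>k\<close> is taken from the preimage of
  \<open>k\<close>.\<close>

definition coord_operad :: "('k::field, 'a) operad \<Rightarrow> ('k, nat \<Rightarrow> 'a) operad"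
  where "coord_operad P =
    \<lparr>component = (\<lambda>n. fun_module (component P n) n),
     op_comp = (\<lambda>ms F Gs. \<lambda>k\<in>{1..sum_list ms}. op_comp P ms (F (Suc (fst (blk ms k))))
       (slots P ms Gs (fst (blk ms k)) (snd (blk ms k)))),
     op_unit = (\<lambda>k\<in>{1..1}. op_unit P),
     op_act = (\<lambda>n \<sigma> F. \<lambda>k\<in>{1..n}. op_act P n \<sigma> (F (inv_into UNIV \<sigma> k)))\<rparr>"

lemma coord_operad_simps [simp]:
  "component (coord_operad P) = (\<lambda>n. fun_module (component P n) n)"
  "op_comp (coord_operad P) = (\<lambda>ms F Gs. \<lambda>k\<in>{1..sum_list ms}. op_comp P ms (F (Suc (fst (blk ms k))))
       (slots P ms Gs (fst (blk ms k)) (snd (blk ms k))))"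
  "op_unit (coord_operad P) = (\<lambda>k\<in>{1..1}. op_unit P)"
  "op_act (coord_operad P) = (\<lambda>n \<sigma> F. \<lambda>k\<in>{1..n}. op_act P n \<sigma> (F (inv_into UNIV \<sigma> k)))"
  by (simp_all add: coord_operad_def)

lemma length_slots [simp]: "length (slots P ms Gs i j) = length ms"
  by (simp add: slots_def)

lemma slots_update:
  assumes "q < length ms" "length Gs = length ms"
  shows "slots P ms (Gs[q := G]) i j = (slots P ms Gs i j)[q := if q = i then G j
    else finsum (component P (ms ! q)) G {1..ms ! q}]"
  by (rule nth_equalityI) (use assms in \<open>auto simp: slots_def nth_list_update\<close>)

context pre_operad
begin

lemma slots_args:
  assumes "positive_arities ms" "op_args (coord_operad P) ms Gs" "i < length ms" "j \<in> {1..ms ! i}"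
  shows "op_args P ms (slots P ms Gs i j)"
proof (rule op_argsI)
  fix q assume q: "q < length ms"
  note pos = positive_aritiesD(3)[OF assms(1) q]
  interpret M: module scalars "component P (ms ! q)" using component_module[OF pos] .
  have G: "Gs ! q \<in> carrier (fun_module (component P (ms ! q)) (ms ! q))"
    using op_argsD(2)[OF assms(2) q] by simp
  then have "finsum (component P (ms ! q)) (Gs ! q) {1..ms ! q} \<in> carrier (component P (ms ! q))"
    using linear_mapD(1)[OF linear_map_total[OF component_module[OF pos]] G] by simp
  moreover have "q = i \<Longrightarrow> (Gs ! q) j \<in> carrier (component P (ms ! q))"
    using linear_mapD(1)[OF linear_map_eval G, of j] assms(4) by simp
  ultimately show "slots P ms Gs i j ! q \<in> carrier (component P (ms ! q))"
    using q by (simp add: slots_def)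
qed simp

text \<open>Each coordinate of an operation is an evaluation or a total sum followed by an operation
  of \<open>P\<close>, hence linear in each variable.\<close>

lemma pre_operad_coord: "pre_operad (coord_operad P)"
proof (rule pre_operad.intro)
  show "vspace (component (coord_operad P) n)" if "n \<ge> 1" for n
    using vspace_fun_module[OF component_module[OF that]] by simp
  show "op_unit (coord_operad P) \<in> carrier (component (coord_operad P) 1)"
    using unit_closed by (simp add: fun_module_simps)
  show "linear_map (component (coord_operad P) n) (component (coord_operad P) n) (op_act (coord_operad P) n \<sigma>)"
    if "n \<ge> 1" "\<sigma> permutes {1..n}" for n \<sigma>
    unfolding coord_operad_simps
  proof (rule linear_map_fun_moduleI)
    fix k assume "k \<in> {1..n}"
    then have "inv_into UNIV \<sigma> k \<in> {1..n}" using permutes_in_image[OF permutes_inv[OF that(2)]] by blast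
    from linear_map_comp[OF linear_map_eval[OF this] act_linear[OF that]]
    show "linear_map (fun_module (component P n) n) (component P n) (\<lambda>x. op_act P n \<sigma> (x (inv_into UNIV \<sigma> k)))" .
  qed
  fix ms Gs assume ms: "positive_arities ms" and Gs: "op_args (coord_operad P) ms Gs"
  note pos = positive_aritiesD[OF ms]
  show "linear_map (component (coord_operad P) (length ms)) (component (coord_operad P) (sum_list ms))
     (\<lambda>F. op_comp (coord_operad P) ms F Gs)"
    unfolding coord_operad_simps
  proof (rule linear_map_fun_moduleI)
    fix k assume "k \<in> {1..sum_list ms}"
    then obtain i j where ij: "i < length ms" "j \<in> {1..ms ! i}" "blk ms k = (i, j)" by (rule block_cases)
    then have "Suc i \<in> {1..length ms}" by simp
    from linear_map_comp[OF linear_map_eval[OF this] comp_linear_left[OF ms slots_args[OF ms Gs ij(1,2)]]]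
    show "linear_map (fun_module (component P (length ms)) (length ms)) (component P (sum_list ms))
      (\<lambda>F. op_comp P ms (F (Suc (fst (blk ms k)))) (slots P ms Gs (fst (blk ms k)) (snd (blk ms k))))"
      by (simp add: ij)
  qed
  fix F q assume F: "F \<in> carrier (component (coord_operad P) (length ms))" and q: "q < length ms"
  show "linear_map (component (coord_operad P) (ms ! q)) (component (coord_operad P) (sum_list ms))
     (\<lambda>G. op_comp (coord_operad P) ms F (Gs[q := G]))"
    unfolding coord_operad_simps
  proof (rule linear_map_fun_moduleI)
    fix k assume "k \<in> {1..sum_list ms}"
    then obtain i j where ij: "i < length ms" "j \<in> {1..ms ! i}" "blk ms k = (i, j)" by (rule block_cases)
    have Fi: "F (Suc i) \<in> carrier (component P (length ms))"
      using F ij(1) by (auto simp: fun_module_simps)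
    have "linear_map (fun_module (component P (ms ! q)) (ms ! q)) (component P (ms ! q))
      (\<lambda>G. if q = i then G j else finsum (component P (ms ! q)) G {1..ms ! q})"
      using linear_map_total[OF component_module[OF pos(3)[OF q]]] linear_map_eval[OF ij(2)] by (cases "q = i") auto
    from linear_map_comp[OF this comp_linear_right[OF ms Fi slots_args[OF ms Gs ij(1,2)] q]]
    show "linear_map (fun_module (component P (ms ! q)) (ms ! q)) (component P (sum_list ms))
      (\<lambda>G. op_comp P ms (F (Suc (fst (blk ms k)))) (slots P ms (Gs[q := G]) (fst (blk ms k)) (snd (blk ms k))))"
      unfolding slots_update[OF q op_argsD(1)[OF Gs]] ij(3) fst_conv snd_conv .
  qed
qed

text \<open>Multilinearity collected over all arguments; it gathers the scalars of pure tensors in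
  front of a composition.\<close>

lemma comp_scale:
  assumes ms: "positive_arities ms" and a: "a \<in> carrier (component P (length ms))" and bs: "op_args P ms bs"
  shows "op_comp P ms (c \<odot>\<^bsub>component P (length ms)\<^esub> a)
      (map (\<lambda>q. d q \<odot>\<^bsub>component P (ms ! q)\<^esub> (bs ! q)) [0..<length ms]) =
    (c * (\<Prod>q<length ms. d q)) \<odot>\<^bsub>component P (sum_list ms)\<^esub> op_comp P ms a bs"
proof -
  note pos = positive_aritiesD[OF ms]
  interpret N: module scalars "component P (sum_list ms)" using component_module[OF pos(2)] .
  have cl: "d q \<odot>\<^bsub>component P (ms ! q)\<^esub> (bs ! q) \<in> carrier (component P (ms ! q))" if "q < length ms" for q
    using module.smult_closed[OF component_module[OF pos(3)[OF that]], of "d q"] op_argsD(2)[OF bs that] by simp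
  \<comment> \<open>Only the first \<open>l\<close> arguments carry their scalars; the next scalar
    is pulled out by linearity in its own slot.\<close>
  have step: "op_comp P ms a (map (\<lambda>q. if q < l then d q \<odot>\<^bsub>component P (ms ! q)\<^esub> (bs ! q) else bs ! q) [0..<length ms]) =
    (\<Prod>q<l. d q) \<odot>\<^bsub>component P (sum_list ms)\<^esub> op_comp P ms a bs" if "l \<le> length ms" for l
    using that
  proof (induction l)
    case 0
    have "map (\<lambda>q. bs ! q) [0..<length ms] = bs" using op_argsD(1)[OF bs] by (simp add: map_nth flip: op_argsD(1)[OF bs])
    then show ?case using N.smult_one comp_closed[OF ms a bs] by simp
  next
    case (Suc l)
    let ?b = "\<lambda>l. map (\<lambda>q. if q < l then d q \<odot>\<^bsub>component P (ms ! q)\<^esub> (bs ! q) else bs ! q) [0..<length ms]"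
    have args: "op_args P ms (?b l)" by (rule op_argsI) (use cl op_argsD(2)[OF bs] in auto)
    have l: "l < length ms" using Suc.prems by simp
    have "?b (Suc l) = (?b l)[l := d l \<odot>\<^bsub>component P (ms ! l)\<^esub> (bs ! l)]"
      using l by (intro nth_equalityI) (auto simp: nth_list_update)
    moreover have "(?b l)[l := bs ! l] = ?b l"
      using l by (intro nth_equalityI) (auto simp: nth_list_update)
    ultimately have "op_comp P ms a (?b (Suc l)) = d l \<odot>\<^bsub>component P (sum_list ms)\<^esub> op_comp P ms a (?b l)"
      using linear_mapD(3)[OF comp_linear_right[OF ms a args l], of "bs ! l" "d l"] op_argsD(2)[OF bs l] by simp
    also have "\<dots> = (\<Prod>q<Suc l. d q) \<odot>\<^bsub>component P (sum_list ms)\<^esub> op_comp P ms a bs"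
      using Suc N.smult_assoc1[of "d l" "\<Prod>q<l. d q" "op_comp P ms a bs"] comp_closed[OF ms a bs]
      by (simp add: mult.commute)
    finally show ?case .
  qed
  let ?b = "map (\<lambda>q. d q \<odot>\<^bsub>component P (ms ! q)\<^esub> (bs ! q)) [0..<length ms]"
  have args: "op_args P ms ?b" by (rule op_argsI) (use cl in auto)
  have "?b = map (\<lambda>q. if q < length ms then d q \<odot>\<^bsub>component P (ms ! q)\<^esub> (bs ! q) else bs ! q) [0..<length ms]"
    by (rule nth_equalityI) auto
  then have "op_comp P ms a ?b = (\<Prod>q<length ms. d q) \<odot>\<^bsub>component P (sum_list ms)\<^esub> op_comp P ms a bs"
    using step[OF order_refl] by (rule ssubst)
  then show ?thesis
    using linear_mapD(3)[OF comp_linear_left[OF ms args] a, of c] N.smult_assoc1[of c "\<Prod>q<length ms. d q" "op_comp P ms a bs"] comp_closed[OF ms a bs]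
    by simp
qed

end

section \<open>Composition and coefficients in Perm\<close>

subsection \<open>The operad Perm\<close>

abbreviation perm_comp :: "nat list \<Rightarrow> nat \<Rightarrow> nat list \<Rightarrow> nat"
  where "perm_comp \<equiv> \<lambda>ms k js. offset ms (k - 1) + js ! (k - 1)"

interpretation perm: set_operad "\<lambda>n. {1..n}" perm_comp 1 "\<lambda>n \<sigma>. \<sigma>"
proof
  fix n \<sigma> and x :: nat assume "\<sigma> permutes {1..n}" "x \<in> {1..n}"
  then show "\<sigma> x \<in> {1..n}" by (simp only: permutes_in_image)
next
  fix ms k js assume "positive_arities ms" and k: "k \<in> {1..length ms}" and js: "list_all2 (\<lambda>m y. y \<in> {1..m}) ms js"
  then have "js ! (k - 1) \<in> {1..ms ! (k - 1)}" "k - 1 < length ms" by (auto simp: list_all2_conv_all_nth)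
  then show "perm_comp ms k js \<in> {1..sum_list ms}" using offset_le[of "k - 1" ms "js ! (k - 1)"] by auto
qed simp

lemma perm_operad_eq: "perm_operad = perm.lin"
  by (simp add: perm_operad_def)

lemma pre_operad_perm: "pre_operad perm_operad"
  unfolding perm_operad_eq by (rule perm.pre_operad_lin)

lemma perm_operad_simps [simp]:
  "component perm_operad = (\<lambda>n. free_module {1..n})"
  "op_comp perm_operad = (\<lambda>ms. multilin_ext (perm_comp ms))"
  "op_unit perm_operad = basis 1"
  "op_act perm_operad = (\<lambda>n \<sigma>. lin_ext (\<lambda>x. basis (\<sigma> x)))"
  by (simp_all add: perm_operad_def)

text \<open>A composite of basis elements depends on the index of the root and on the index of the
  argument it selects. The remaining arguments therefore enter through the sums of all their
  coefficients.\<close>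

lemma lookup_perm_comp:
  fixes v :: "nat \<Rightarrow>\<^sub>0 'k::field"
  assumes ms: "positive_arities ms" and v: "Poly_Mapping.keys v \<subseteq> {1..length ms}"
    and ws: "op_args perm_operad ms ws" and i: "i < length ms" and j: "j \<in> {1..ms ! i}"
  shows "Poly_Mapping.lookup (multilin_ext (perm_comp ms) v ws) (offset ms i + j) =
    Poly_Mapping.lookup v (Suc i) * (\<Prod>q<length ms. if q = i then Poly_Mapping.lookup (ws ! q) j
      else \<Sum>l\<in>{1..ms ! q}. Poly_Mapping.lookup (ws ! q) l)"
proof -
  \<comment> \<open>The linear functional through which argument \<open>q\<close> contributes. With
    it both sides are linear in the root and in each argument, and only basis elements are left to
    check.\<close>
  define f where "f q w = (if q = i then Poly_Mapping.lookup w j else \<Sum>l\<in>{1..ms ! q}. Poly_Mapping.lookup w l)"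
    for q and w :: "nat \<Rightarrow>\<^sub>0 'k"
  have f: "f q 0 = 0" "f q (w + w') = f q w + f q w'" "f q (pm_scale c w) = c * f q w" for q w w' c
    by (auto simp: f_def lookup_add sum.distrib sum_distrib_left)
  interpret L: pre_operad "perm.lin :: ('k, nat \<Rightarrow>\<^sub>0 'k) operad" by (rule perm.pre_operad_lin)
  note pos = positive_aritiesD[OF ms]
  have "Poly_Mapping.lookup (multilin_ext (perm_comp ms) v ws) (offset ms i + j) =
    Poly_Mapping.lookup v (Suc i) * (\<Prod>q<length ms. f q (ws ! q))"
  proof (rule perm.lin_args_induct[OF ms v ws[unfolded perm_operad_eq]])
    fix ws :: "(nat \<Rightarrow>\<^sub>0 'k) list" assume ws: "op_args perm.lin ms ws"
    show "submodule {v. Poly_Mapping.keys v \<subseteq> {1..length ms} \<and>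
      Poly_Mapping.lookup (multilin_ext (perm_comp ms) v ws) (offset ms i + j) =
      Poly_Mapping.lookup v (Suc i) * (\<Prod>q<length ms. f q (ws ! q))} scalars (free_module {1..length ms})"
      using linear_mapD[OF L.comp_linear_left[OF ms ws]] linear_map_zero[OF L.component_module[OF pos(1)] L.component_module[OF pos(2)] L.comp_linear_left[OF ms ws]]
      by (intro vspace_submoduleI[OF vspace_free_module])
        (simp_all add: lookup_add distrib_left distrib_right mult.assoc mult.left_commute keys_pm_scale_subset keys_plus_subset subset_eq[of "Collect _"])
    fix v :: "nat \<Rightarrow>\<^sub>0 'k" and p assume v: "Poly_Mapping.keys v \<subseteq> {1..length ms}" and p: "p < length ms"
    have v': "v \<in> carrier (component perm.lin (length ms))" using v by simp
    have len: "length ws = length ms" using op_argsD(1)[OF ws] .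
    have prod: "(\<Prod>q<length ms. f q (ws[p := w] ! q)) = f p w * (\<Prod>q\<in>{..<length ms} - {p}. f q (ws ! q))" for w
    proof -
      have "(\<Prod>q<length ms. f q (ws[p := w] ! q)) = f p (ws[p := w] ! p) * (\<Prod>q\<in>{..<length ms} - {p}. f q (ws[p := w] ! q))"
        by (rule prod.remove) (use p in auto)
      also have "(\<Prod>q\<in>{..<length ms} - {p}. f q (ws[p := w] ! q)) = (\<Prod>q\<in>{..<length ms} - {p}. f q (ws ! q))"
        by (rule prod.cong) auto
      finally show ?thesis using p len by simp
    qed
    note R = L.comp_linear_right[OF ms v' ws p]
    show "submodule {w. Poly_Mapping.keys w \<subseteq> {1..ms ! p} \<and>
      Poly_Mapping.lookup (multilin_ext (perm_comp ms) v (ws[p := w])) (offset ms i + j) =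
      Poly_Mapping.lookup v (Suc i) * (\<Prod>q<length ms. f q (ws[p := w] ! q))} scalars (free_module {1..ms ! p})"
      unfolding prod
      using linear_mapD[OF R] linear_map_zero[OF L.component_module[OF pos(3)[OF p]] L.component_module[OF pos(2)] R]
      by (intro vspace_submoduleI[OF vspace_free_module])
        (simp_all add: f lookup_add distrib_left distrib_right mult.assoc mult.left_commute keys_pm_scale_subset keys_plus_subset subset_eq[of "Collect _"])
  next
    fix x js assume x: "x \<in> {1..length ms}" and js: "list_all2 (\<lambda>m y. y \<in> {1..m}) ms js"
    define x' where "x' = x - 1"
    have x': "x' < length ms" "x = Suc x'" using x by (auto simp: x'_def)
    have js': "length js = length ms" "\<And>q. q < length ms \<Longrightarrow> js ! q \<in> {1..ms ! q}"
      using js by (auto simp: list_all2_conv_all_nth)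
    \<comment> \<open>A basis element has total coefficient 1, and in slot \<open>i\<close> it has
      coefficient 1 precisely at its own index.\<close>
    have fb: "f q (basis (js ! q)) = (if q = i then if js ! i = j then 1 else 0 else 1)" if "q < length ms" for q
      using js'(2)[OF that] by (auto simp: f_def lookup_basis sum.delta')
    have "(\<Prod>q<length ms. f q (map basis js ! q)) = (\<Prod>q<length ms. if q = i then if js ! i = j then 1 else 0 else 1)"
      by (rule prod.cong) (use fb js' in auto)
    also have "\<dots> = (if js ! i = j then 1 else 0)" using i by (simp add: prod.delta)
    finally show "Poly_Mapping.lookup (multilin_ext (perm_comp ms) (basis x) (map basis js)) (offset ms i + j) =
      Poly_Mapping.lookup (basis x) (Suc i) * (\<Prod>q<length ms. f q (map basis js ! q))"
      using offset_eq_iff[OF x'(1) js'(2)[OF x'(1)] i j] x'(2)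
      by (auto simp: multilin_ext_basis lookup_basis)
  qed
  then show ?thesis by (simp add: f_def)
qed

section \<open>Tensors with Perm are determined by their coordinates\<close>

subsection \<open>Coordinates of the Hadamard product with Perm\<close>

text \<open>The basis consists of all pairs of vectors, not of pairs of basis vectors; bilinearity
  is imposed afterwards by the tensor relations.\<close>

lemma set_operad_product:
  assumes P: "pre_operad P" and Q: "pre_operad Q"
  shows "set_operad (\<lambda>n. carrier (component P n) \<times> carrier (component Q n))
    (\<lambda>ms x ys. (op_comp P ms (fst x) (map fst ys), op_comp Q ms (snd x) (map snd ys)))
    (op_unit P, op_unit Q) (\<lambda>n \<sigma> x. (op_act P n \<sigma> (fst x), op_act Q n \<sigma> (snd x)))"
proof
  interpret P: pre_operad P by fact
  interpret Q: pre_operad Q by fact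
  show "(op_unit P, op_unit Q) \<in> carrier (component P 1) \<times> carrier (component Q 1)"
    using P.unit_closed Q.unit_closed by simp
  show "(op_act P n \<sigma> (fst x), op_act Q n \<sigma> (snd x)) \<in> carrier (component P n) \<times> carrier (component Q n)"
    if "n \<ge> 1" "\<sigma> permutes {1..n}" "x \<in> carrier (component P n) \<times> carrier (component Q n)" for n \<sigma> x
    using that P.act_closed[of n \<sigma> "fst x"] Q.act_closed[of n \<sigma> "snd x"] by auto
  fix ms x ys assume ms: "positive_arities ms"
    and x: "x \<in> carrier (component P (length ms)) \<times> carrier (component Q (length ms))"
    and ys: "list_all2 (\<lambda>m y. y \<in> carrier (component P m) \<times> carrier (component Q m)) ms ys"
  have "op_args P ms (map fst ys)" "op_args Q ms (map snd ys)"
    using ys by (auto simp: op_args_def list_all2_conv_all_nth mem_Times_iff)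
  then show "(op_comp P ms (fst x) (map fst ys), op_comp Q ms (snd x) (map snd ys)) \<in>
    carrier (component P (sum_list ms)) \<times> carrier (component Q (sum_list ms))"
    using P.comp_closed[OF ms] Q.comp_closed[OF ms] x by (auto simp: mem_Times_iff)
qed

lemma linear_map_diff_eq_zero_iff:
  assumes "vspace N" "linear_map (free_module X) N h" "Poly_Mapping.keys p \<subseteq> X" "Poly_Mapping.keys q \<subseteq> X"
  shows "h (p - q) = \<zero>\<^bsub>N\<^esub> \<longleftrightarrow> h p = h q"
proof -
  interpret N: module scalars N by fact
  have d: "Poly_Mapping.keys (p - q) \<subseteq> X" by (rule keys_diff_subset[OF assms(3,4)])
  have "h p = h ((p - q) + q)" by simp
  also have "\<dots> = h (p - q) \<oplus>\<^bsub>N\<^esub> h q" using linear_mapD(2)[OF assms(2), of "p - q" q] d assms(4) by simp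
  finally show ?thesis using linear_mapD(1)[OF assms(2), of "p - q"] linear_mapD(1)[OF assms(2), of q] d assms(4)
    by (metis N.M.add.r_cancel_one' free_module_simps(1) mem_Collect_eq)
qed

lemma finsum_free_module:
  assumes "finite A" "\<And>a. a \<in> A \<Longrightarrow> Poly_Mapping.keys (g a) \<subseteq> X"
  shows "finsum (free_module X) g A = sum g A"
proof -
  interpret X: module scalars "free_module X" by (rule vspace_free_module)
  show ?thesis using assms
  proof (induction A)
    case empty
    then show ?case using X.finsum_empty by simp
  next
    case (insert a A)
    then show ?case using X.finsum_insert[of A a g] by (simp add: Pi_def)
  qed
qed

lemma submodule_tensor_relations:
  assumes "vspace M" "vspace N"
  shows "submodule (tensor_relations M N) scalars (free_module (carrier M \<times> carrier N))"
proof -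
  interpret M: module scalars M by fact
  interpret N: module scalars N by fact
  show ?thesis unfolding tensor_relations_def
    by (rule linear_span_submodule[OF vspace_free_module], intro Un_least subsetI; elim CollectE exE conjE)
      (simp_all add: keys_diff_subset keys_pm_scale_subset M.smult_closed N.smult_closed)
qed

lemma tensor_relations_memI:
  shows "x \<in> carrier M \<Longrightarrow> x' \<in> carrier M \<Longrightarrow> y \<in> carrier N \<Longrightarrow>
      basis (x \<oplus>\<^bsub>M\<^esub> x', y) - basis (x, y) - basis (x', y) \<in> tensor_relations M N"
    and "x \<in> carrier M \<Longrightarrow> y \<in> carrier N \<Longrightarrow> y' \<in> carrier N \<Longrightarrow>
      basis (x, y \<oplus>\<^bsub>N\<^esub> y') - basis (x, y) - basis (x, y') \<in> tensor_relations M N"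
    and "x \<in> carrier M \<Longrightarrow> y \<in> carrier N \<Longrightarrow>
      basis (c \<odot>\<^bsub>M\<^esub> x, y) - pm_scale c (basis (x, y)) \<in> tensor_relations M N"
    and "x \<in> carrier M \<Longrightarrow> y \<in> carrier N \<Longrightarrow>
      basis (x, c \<odot>\<^bsub>N\<^esub> y) - pm_scale c (basis (x, y)) \<in> tensor_relations M N"
  unfolding tensor_relations_def by (rule linear_span_superset[THEN subsetD]; blast)+

text \<open>A map that is bilinear on pairs kills the four families of relations, and so their span.
  This half of the universal property makes both the coordinates and \<open>rho\<close> well defined
  on tensors.\<close>

lemma tensor_relations_kernel:
  fixes M :: "('k::field, 'a) module" and N :: "('k, 'b) module"
  assumes M: "vspace M" and N: "vspace N" and K: "vspace K"
    and h: "linear_map (free_module (carrier M \<times> carrier N)) K h"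
    and "\<And>x x' y. x \<in> carrier M \<Longrightarrow> x' \<in> carrier M \<Longrightarrow> y \<in> carrier N \<Longrightarrow>
      h (basis (x \<oplus>\<^bsub>M\<^esub> x', y)) = h (basis (x, y)) \<oplus>\<^bsub>K\<^esub> h (basis (x', y))"
    and "\<And>x y y'. x \<in> carrier M \<Longrightarrow> y \<in> carrier N \<Longrightarrow> y' \<in> carrier N \<Longrightarrow>
      h (basis (x, y \<oplus>\<^bsub>N\<^esub> y')) = h (basis (x, y)) \<oplus>\<^bsub>K\<^esub> h (basis (x, y'))"
    and "\<And>c x y. x \<in> carrier M \<Longrightarrow> y \<in> carrier N \<Longrightarrow> h (basis (c \<odot>\<^bsub>M\<^esub> x, y)) = c \<odot>\<^bsub>K\<^esub> h (basis (x, y))"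
    and "\<And>c x y. x \<in> carrier M \<Longrightarrow> y \<in> carrier N \<Longrightarrow> h (basis (x, c \<odot>\<^bsub>N\<^esub> y)) = c \<odot>\<^bsub>K\<^esub> h (basis (x, y))"
    and p: "p \<in> tensor_relations M N"
  shows "h p = \<zero>\<^bsub>K\<^esub>"
proof -
  interpret M: module scalars M by fact
  interpret N: module scalars N by fact
  let ?X = "carrier M \<times> carrier N"
  let ?H = "{p \<in> carrier (free_module ?X). h p = \<zero>\<^bsub>K\<^esub>}"
  have kb: "Poly_Mapping.keys (basis z :: _ \<Rightarrow>\<^sub>0 'k) \<subseteq> ?X" if "z \<in> ?X" for z using that by simp
  have ks: "Poly_Mapping.keys (pm_scale c (basis z)) \<subseteq> ?X" if "z \<in> ?X" for z and c :: 'k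
    using keys_pm_scale_subset[OF kb[OF that]] .
  have memI: "p - q \<in> ?H" if "Poly_Mapping.keys p \<subseteq> ?X" "Poly_Mapping.keys q \<subseteq> ?X" "h p = h q" for p q
    using linear_map_diff_eq_zero_iff[OF K h that(1,2)] that keys_diff_subset by simp
  have h_add: "h (basis z + basis z') = h (basis z) \<oplus>\<^bsub>K\<^esub> h (basis z')" if "z \<in> ?X" "z' \<in> ?X" for z z'
    using linear_mapD(2)[OF h, of "basis z" "basis z'"] that by simp
  have h_scale: "h (pm_scale c (basis z)) = c \<odot>\<^bsub>K\<^esub> h (basis z)" if "z \<in> ?X" for c z
    using linear_mapD(3)[OF h, of "basis z" c] that by simp
  have "tensor_relations M N \<subseteq> ?H"
    unfolding tensor_relations_def
  proof (rule linear_span_least[OF submodule_kernel[OF vspace_free_module K h]], intro Un_least subsetI)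
    fix r :: "'a \<times> 'b \<Rightarrow>\<^sub>0 'k" assume "r \<in> {basis (x \<oplus>\<^bsub>M\<^esub> x', y) - basis (x, y) - basis (x', y) | x x' y.
        x \<in> carrier M \<and> x' \<in> carrier M \<and> y \<in> carrier N}"
    then obtain x x' y where r: "r = basis (x \<oplus>\<^bsub>M\<^esub> x', y) - (basis (x, y) + basis (x', y))"
      "x \<in> carrier M" "x' \<in> carrier M" "y \<in> carrier N" by (auto simp: algebra_simps)
    then show "r \<in> ?H" unfolding r(1) using assms(5) by (intro memI) (simp_all add: h_add keys_plus_subset)
  next
    fix r :: "'a \<times> 'b \<Rightarrow>\<^sub>0 'k" assume "r \<in> {basis (x, y \<oplus>\<^bsub>N\<^esub> y') - basis (x, y) - basis (x, y') | x y y'.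
        x \<in> carrier M \<and> y \<in> carrier N \<and> y' \<in> carrier N}"
    then obtain x y y' where r: "r = basis (x, y \<oplus>\<^bsub>N\<^esub> y') - (basis (x, y) + basis (x, y'))"
      "x \<in> carrier M" "y \<in> carrier N" "y' \<in> carrier N" by (auto simp: algebra_simps)
    then show "r \<in> ?H" unfolding r(1) using assms(6) by (intro memI) (simp_all add: h_add keys_plus_subset)
  next
    fix r :: "'a \<times> 'b \<Rightarrow>\<^sub>0 'k" assume "r \<in> {basis (c \<odot>\<^bsub>M\<^esub> x, y) - pm_scale c (basis (x, y)) | c x y. x \<in> carrier M \<and> y \<in> carrier N}"
    then obtain c x y where r: "r = basis (c \<odot>\<^bsub>M\<^esub> x, y) - pm_scale c (basis (x, y))" "x \<in> carrier M" "y \<in> carrier N"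
      by auto
    then show "r \<in> ?H" unfolding r(1) using assms(7) M.smult_closed[of c x] by (intro memI ks) (simp_all add: h_scale)
  next
    fix r :: "'a \<times> 'b \<Rightarrow>\<^sub>0 'k" assume "r \<in> {basis (x, c \<odot>\<^bsub>N\<^esub> y) - pm_scale c (basis (x, y)) | c x y. x \<in> carrier M \<and> y \<in> carrier N}"
    then obtain c x y where r: "r = basis (x, c \<odot>\<^bsub>N\<^esub> y) - pm_scale c (basis (x, y))" "x \<in> carrier M" "y \<in> carrier N"
      by auto
    then show "r \<in> ?H" unfolding r(1) using assms(8) N.smult_closed[of c y] by (intro memI ks) (simp_all add: h_scale)
  qed
  then show ?thesis using p by auto
qed

text \<open>The coordinates of the pure tensor of \<open>a\<close> with the basis element of index
  \<open>k\<close>.\<close>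

definition delta_fun :: "('k::field, 'a) module \<Rightarrow> nat \<Rightarrow> nat \<Rightarrow> 'a \<Rightarrow> nat \<Rightarrow> 'a"
  where "delta_fun M n k a = (\<lambda>l\<in>{1..n}. if l = k then a else \<zero>\<^bsub>M\<^esub>)"

definition tensor_coords :: "('k::field, 'a) module \<Rightarrow> nat \<Rightarrow> 'a \<times> (nat \<Rightarrow>\<^sub>0 'k) \<Rightarrow> nat \<Rightarrow> 'a"
  where "tensor_coords M n x = (\<lambda>k\<in>{1..n}. Poly_Mapping.lookup (snd x) k \<odot>\<^bsub>M\<^esub> fst x)"

context
  fixes M :: "('k::field, 'a) module" and n :: nat
  assumes M: "vspace M"
begin

interpretation M: module scalars M by (rule M)

abbreviation (input) "perm_basis \<equiv> {v :: nat \<Rightarrow>\<^sub>0 'k. Poly_Mapping.keys v \<subseteq> {1..n}}"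
abbreviation (input) "tensor_coord \<equiv> lext (fun_module M n) (tensor_coords M n)"
abbreviation (input) "T \<equiv> tensor_relations M (free_module {1..n} :: ('k, nat \<Rightarrow>\<^sub>0 'k) module)"

lemma delta_fun_closed: "a \<in> carrier M \<Longrightarrow> delta_fun M n k a \<in> carrier (fun_module M n)"
  by (auto simp: delta_fun_def fun_module_simps)

lemma tensor_coords_closed: "a \<in> carrier M \<Longrightarrow> tensor_coords M n (a, v) \<in> carrier (fun_module M n)"
  using M.smult_closed by (auto simp: tensor_coords_def fun_module_simps)

lemma tensor_coords_basis: "a \<in> carrier M \<Longrightarrow> tensor_coords M n (a, basis k) = delta_fun M n k a"
  using M.smult_one M.smult_l_null
  by (auto simp: tensor_coords_def delta_fun_def lookup_basis intro!: restrict_ext)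

lemma linear_map_tensor_coords:
  "linear_map (free_module (carrier M \<times> perm_basis)) (fun_module M n) tensor_coord"
  by (rule linear_map_lext[OF vspace_fun_module[OF M]]) (auto intro: tensor_coords_closed)

lemma lext_tensor_coords_basis: "a \<in> carrier M \<Longrightarrow> tensor_coord (basis (a, v)) = tensor_coords M n (a, v)"
  by (rule lext_basis[OF vspace_fun_module[OF M]]) (rule tensor_coords_closed)

lemma tensor_relations_coords:
  assumes "p \<in> T"
  shows "tensor_coord p = \<zero>\<^bsub>fun_module M n\<^esub>"
proof (rule tensor_relations_kernel[OF M vspace_free_module vspace_fun_module[OF M] _ _ _ _ _ assms])
  show "linear_map (free_module (carrier M \<times> carrier (free_module {1..n}))) (fun_module M n) tensor_coord"
    using linear_map_tensor_coords by simp
qed (simp_all add: lext_tensor_coords_basis M.smult_closed,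
    auto simp: tensor_coords_def fun_module_simps lookup_add M.smult_r_distr M.smult_l_distr[simplified]
      mult.commute simp flip: M.smult_assoc1[simplified] intro!: restrict_ext)

text \<open>A formal sum of pairs that represents the tensor with coordinates
  \<open>F\<close>.\<close>

abbreviation (input) "recombine \<equiv> \<lambda>F. \<Sum>k\<in>{1..n}. basis (F k, basis k :: nat \<Rightarrow>\<^sub>0 'k) :: _ \<Rightarrow>\<^sub>0 'k"

text \<open>Every tensor is the sum of its coordinates tensored with the standard basis: the second
  factor of a pure tensor is expanded, and its coefficients are moved to the first factor.\<close>

lemma recombine_coords:
  assumes p: "Poly_Mapping.keys p \<subseteq> carrier M \<times> perm_basis"
  shows "p - recombine (tensor_coord p) \<in> T"
proof -
  note sub = submodule_free_moduleD[OF submodule_tensor_relations[OF M vspace_free_module[of "{1..n}"]]]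
  note rel = tensor_relations_memI[where M = M and N = "free_module {1..n} :: ('k, nat \<Rightarrow>\<^sub>0 'k) module", unfolded free_module_simps mem_Collect_eq]
  \<comment> \<open>Expansion of the second factor alone, by induction on \<open>v\<close> for fixed
    \<open>a\<close>.\<close>
  have single: "basis (a, v) - (\<Sum>k\<in>{1..n}. pm_scale (Poly_Mapping.lookup v k) (basis (a, basis k))) \<in> T"
    if a: "a \<in> carrier M" and v: "Poly_Mapping.keys v \<subseteq> {1..n}" for a v
    using v
  proof (induction rule: free_module_induct)
    case zero
    show ?case using rel(4)[OF a, of 0 0] by simp
  next
    case (basis l)
    have "(\<Sum>k\<in>{1..n}. pm_scale (Poly_Mapping.lookup (basis l) k) (basis (a, basis k :: nat \<Rightarrow>\<^sub>0 'k) :: _ \<Rightarrow>\<^sub>0 'k)) =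
      (\<Sum>k\<in>{1..n}. if k = l then basis (a, basis k) else 0)"
      by (rule sum.cong) (auto simp: lookup_basis)
    then show ?case using basis sub(2) by simp
  next
    case (add v w)
    let ?S = "\<lambda>v. \<Sum>k\<in>{1..n}. pm_scale (Poly_Mapping.lookup v k) (basis (a, basis k :: nat \<Rightarrow>\<^sub>0 'k) :: _ \<Rightarrow>\<^sub>0 'k)"
    have "(basis (a, v + w) - basis (a, v) - basis (a, w)) + ((basis (a, v) - ?S v) + (basis (a, w) - ?S w)) \<in> T"
      using add rel(2)[OF a] by (intro sub(3))
    moreover have "?S (v + w) = ?S v + ?S w"
      by (simp add: lookup_add pm_scale_add_left sum.distrib)
    ultimately show ?case by (simp add: algebra_simps)
  next
    case (scale c v)
    let ?S = "\<lambda>v. \<Sum>k\<in>{1..n}. pm_scale (Poly_Mapping.lookup v k) (basis (a, basis k :: nat \<Rightarrow>\<^sub>0 'k) :: _ \<Rightarrow>\<^sub>0 'k)"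
    have "(basis (a, pm_scale c v) - pm_scale c (basis (a, v))) + pm_scale c (basis (a, v) - ?S v) \<in> T"
      using scale rel(4)[OF a] by (intro sub(3) sub(4))
    moreover have "?S (pm_scale c v) = pm_scale c (?S v)"
      by (simp add: pm_scale_sum)
    ultimately show ?case by (simp add: pm_scale_diff_right)
  qed
  \<comment> \<open>\<open>recombine\<close> is not linear, since the basis element of a pair does
    not depend linearly on its entries. It is linear modulo \<open>T\<close>, which the next three
    facts record.\<close>
  have R_zero: "recombine \<zero>\<^bsub>fun_module M n\<^esub> \<in> T"
  proof (rule sub(6))
    fix k assume "k \<in> {1..n}"
    then show "basis (\<zero>\<^bsub>fun_module M n\<^esub> k, basis k) \<in> T"
      using rel(3)[of "\<zero>\<^bsub>M\<^esub>" "basis k" 0] M.smult_l_null by (simp add: fun_module_simps)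
  qed
  have R_add: "recombine (F \<oplus>\<^bsub>fun_module M n\<^esub> G) - recombine F - recombine G \<in> T"
    if "F \<in> carrier (fun_module M n)" "G \<in> carrier (fun_module M n)" for F G
  proof -
    have "(\<Sum>k\<in>{1..n}. basis ((F \<oplus>\<^bsub>fun_module M n\<^esub> G) k, basis k :: nat \<Rightarrow>\<^sub>0 'k) - basis (F k, basis k) - basis (G k, basis k)) \<in> T"
    proof (rule sub(6))
      fix k assume k: "k \<in> {1..n}"
      show "basis ((F \<oplus>\<^bsub>fun_module M n\<^esub> G) k, basis k :: nat \<Rightarrow>\<^sub>0 'k) - basis (F k, basis k) - basis (G k, basis k) \<in> T"
        using rel(1)[OF fun_module_mem[OF that(1) k] fun_module_mem[OF that(2) k], of "basis k"] k
        by (simp add: fun_module_simps)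
    qed
    then show ?thesis by (simp add: sum_subtractf)
  qed
  have R_scale: "recombine (c \<odot>\<^bsub>fun_module M n\<^esub> F) - pm_scale c (recombine F) \<in> T"
    if "F \<in> carrier (fun_module M n)" for F c
  proof -
    have "(\<Sum>k\<in>{1..n}. basis ((c \<odot>\<^bsub>fun_module M n\<^esub> F) k, basis k :: nat \<Rightarrow>\<^sub>0 'k) - pm_scale c (basis (F k, basis k))) \<in> T"
    proof (rule sub(6))
      fix k assume k: "k \<in> {1..n}"
      show "basis ((c \<odot>\<^bsub>fun_module M n\<^esub> F) k, basis k :: nat \<Rightarrow>\<^sub>0 'k) - pm_scale c (basis (F k, basis k)) \<in> T"
        using rel(3)[OF fun_module_mem[OF that k], of "basis k" c] k by (simp add: fun_module_simps)
    qed
    then show ?thesis by (simp add: sum_subtractf pm_scale_sum)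
  qed
  note lin = linear_mapD[OF linear_map_tensor_coords, unfolded free_module_simps mem_Collect_eq]
  show ?thesis using p
  proof (induction rule: free_module_induct)
    case zero
    have "tensor_coord 0 = \<zero>\<^bsub>fun_module M n\<^esub>"
      using linear_map_zero[OF vspace_free_module vspace_fun_module[OF M] linear_map_tensor_coords] by simp
    then show ?case using sub(5)[OF sub(2) R_zero] by simp
  next
    case (basis x)
    obtain a v where x: "x = (a, v)" "a \<in> carrier M" "Poly_Mapping.keys v \<subseteq> {1..n}" using basis by auto
    have "(\<Sum>k\<in>{1..n}. basis (Poly_Mapping.lookup v k \<odot>\<^bsub>M\<^esub> a, basis k :: nat \<Rightarrow>\<^sub>0 'k) - pm_scale (Poly_Mapping.lookup v k) (basis (a, basis k))) \<in> T"
      by (rule sub(6)) (use x rel(3) in auto)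
    from sub(5)[OF single[OF x(2,3)] this]
    show ?case unfolding x(1) lext_tensor_coords_basis[OF x(2)]
      by (simp add: tensor_coords_def sum_subtractf algebra_simps)
  next
    case (add p q)
    have "(p - recombine (tensor_coord p)) + (q - recombine (tensor_coord q)) -
      (recombine (tensor_coord p \<oplus>\<^bsub>fun_module M n\<^esub> tensor_coord q) - recombine (tensor_coord p) - recombine (tensor_coord q)) \<in> T"
      by (rule sub(5)[OF sub(3)[OF add(3,4)] R_add[OF lin(1)[OF add(1)] lin(1)[OF add(2)]]])
    then show ?case using lin(2)[OF add(1,2)] by (simp add: algebra_simps)
  next
    case (scale c p)
    have "pm_scale c (p - recombine (tensor_coord p)) -
      (recombine (c \<odot>\<^bsub>fun_module M n\<^esub> tensor_coord p) - pm_scale c (recombine (tensor_coord p))) \<in> T"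
      by (rule sub(5)[OF sub(4)[OF scale(2)] R_scale[OF lin(1)[OF scale(1)]]])
    then show ?case using lin(3)[OF scale(1)] by (simp add: pm_scale_diff_right algebra_simps)
  qed
qed

text \<open>An element with zero coordinates is congruent to the recombination of zero, and so is 0
  itself. The difference of these two congruences removes that recombination, which need not be 0 as
  a formal sum.\<close>

lemma tensor_relations_iff:
  "p \<in> T \<longleftrightarrow> Poly_Mapping.keys p \<subseteq> carrier M \<times> perm_basis \<and> tensor_coord p = \<zero>\<^bsub>fun_module M n\<^esub>"
proof (intro iffI conjI; (elim conjE)?)
  note sub = submodule_free_moduleD[OF submodule_tensor_relations[OF M vspace_free_module[of "{1..n}"]]]
  show "Poly_Mapping.keys p \<subseteq> carrier M \<times> perm_basis" if "p \<in> T" using sub(1)[OF that] by simp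
  show "tensor_coord p = \<zero>\<^bsub>fun_module M n\<^esub>" if "p \<in> T" using tensor_relations_coords[OF that] .
  assume p: "Poly_Mapping.keys p \<subseteq> carrier M \<times> perm_basis" and z: "tensor_coord p = \<zero>\<^bsub>fun_module M n\<^esub>"
  have "tensor_coord 0 = \<zero>\<^bsub>fun_module M n\<^esub>"
    using linear_map_zero[OF vspace_free_module vspace_fun_module[OF M] linear_map_tensor_coords] by simp
  then have "p - recombine \<zero>\<^bsub>fun_module M n\<^esub> \<in> T" "0 - recombine \<zero>\<^bsub>fun_module M n\<^esub> \<in> T"
    using recombine_coords[OF p] recombine_coords[of 0] z by auto
  from sub(5)[OF this] show "p \<in> T" by simp
qed

text \<open>The summand with index \<open>k\<close> contributes to coordinate \<open>k\<close>
  alone; this gives surjectivity of the coordinates.\<close>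

lemma tensor_coord_recombine:
  assumes F: "F \<in> carrier (fun_module M n)"
  shows "tensor_coord (recombine F) = F" "Poly_Mapping.keys (recombine F) \<subseteq> carrier M \<times> perm_basis"
proof -
  let ?N = "fun_module M n"
  interpret N: module scalars ?N by (rule vspace_fun_module[OF M])
  have Fk: "F k \<in> carrier M" if "k \<in> {1..n}" for k using F that by (auto simp: fun_module_simps)
  show "Poly_Mapping.keys (recombine F) \<subseteq> carrier M \<times> perm_basis"
    by (rule keys_sum_subset) (use Fk in auto)
  have "tensor_coord (recombine F) = finsum ?N (\<lambda>k. tensor_coord (basis (F k, basis k))) {1..n}"
  proof -
    have "recombine F = finsum (free_module (carrier M \<times> perm_basis)) (\<lambda>k. basis (F k, basis k)) {1..n}"
      by (rule finsum_free_module[symmetric]) (use Fk in auto)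
    then show ?thesis
      using linear_map_finsum[OF vspace_free_module vspace_fun_module[OF M] linear_map_tensor_coords,
        of "\<lambda>k. basis (F k, basis k)" "{1..n}"] Fk by simp
  qed
  also have "\<dots> = finsum ?N (\<lambda>k. delta_fun M n k (F k)) {1..n}"
    by (rule N.finsum_cong') (use Fk in \<open>auto simp: lext_tensor_coords_basis tensor_coords_basis intro!: delta_fun_closed\<close>)
  also have "\<dots> = F"
  proof (rule fun_module_eqI[OF _ F])
    have cl: "(\<lambda>k. delta_fun M n k (F k)) \<in> {1..n} \<rightarrow> carrier ?N" using Fk by (auto intro!: delta_fun_closed)
    then show "finsum ?N (\<lambda>k. delta_fun M n k (F k)) {1..n} \<in> carrier ?N" by (rule N.finsum_closed)
    fix l assume l: "l \<in> {1..n}"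
    have "finsum ?N (\<lambda>k. delta_fun M n k (F k)) {1..n} l = finsum M (\<lambda>k. delta_fun M n k (F k) l) {1..n}"
      by (rule linear_map_finsum[OF vspace_fun_module[OF M] M linear_map_eval[OF l] cl])
    also have "\<dots> = finsum M (\<lambda>k. if k = l then F l else \<zero>\<^bsub>M\<^esub>) {1..n}"
      by (rule M.finsum_cong') (use l Fk in \<open>auto simp: delta_fun_def\<close>)
    also have "\<dots> = F l" by (rule finsum_delta[OF M _ l Fk[OF l]]) simp
    finally show "finsum ?N (\<lambda>k. delta_fun M n k (F k)) {1..n} l = F l" .
  qed
  finally show "tensor_coord (recombine F) = F" .
qed

end

definition coords :: "('k::field, 'a) operad \<Rightarrow> nat \<Rightarrow> ('a \<times> (nat \<Rightarrow>\<^sub>0 'k) \<Rightarrow>\<^sub>0 'k) \<Rightarrow> nat \<Rightarrow> 'a"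
  where "coords P n = lext (fun_module (component P n) n) (tensor_coords (component P n) n)"

lemma lookup_perm_act:
  assumes "bij \<sigma>"
  shows "Poly_Mapping.lookup (lin_ext (\<lambda>x. basis (\<sigma> x)) v) k = Poly_Mapping.lookup v (inv_into UNIV \<sigma> k)"
proof -
  have "Poly_Mapping.lookup (lin_ext (\<lambda>x. basis (\<sigma> x)) v) k =
    (\<Sum>x\<in>Poly_Mapping.keys v. if x = inv_into UNIV \<sigma> k then Poly_Mapping.lookup v x else 0)"
    unfolding lin_ext_def lookup_sum
    by (rule sum.cong) (use assms in \<open>auto simp: lookup_basis bij_def surj_f_inv_f inv_f_f\<close>)
  then show ?thesis by (simp add: in_keys_iff)
qed

lemma product_linearization_simps [simp]:
  "component (product_linearization P Q) = (\<lambda>n. free_module (carrier (component P n) \<times> carrier (component Q n)))"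
  by (simp add: product_linearization_def)

text \<open>A composite of pure tensors has one scalar from Perm and one vector from
  \<open>P\<close>. The scalar at a position is a product over the arguments, and multilinearity
  distributes its factors over the slots.\<close>

lemma coords_hom:
  assumes P: "pre_operad P"
  shows "coords P \<in> operad_hom (product_linearization P perm_operad) (coord_operad P)"
  unfolding product_linearization_def
proof (rule set_operad.lin_homI[OF set_operad_product[OF P pre_operad_perm] pre_operad.pre_operad_coord[OF P]])
  interpret P: pre_operad P by fact
  interpret Q: pre_operad "perm_operad :: ('a, nat \<Rightarrow>\<^sub>0 'a) operad" by (rule pre_operad_perm)
  show "linear_map (free_module (carrier (component P n) \<times> carrier (component perm_operad n)))
     (component (coord_operad P) n) (coords P n)" if "n \<ge> 1" for n
    using linear_map_tensor_coords[OF P.component_module[OF that]] by (simp add: coords_def)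
  have cb: "coords P n (basis (a, v)) = tensor_coords (component P n) n (a, v)"
    if "n \<ge> 1" "a \<in> carrier (component P n)" for n a v
    unfolding coords_def by (rule lext_tensor_coords_basis[OF P.component_module[OF that(1)] that(2)])
  show "coords P 1 (basis (op_unit P, op_unit perm_operad)) = op_unit (coord_operad P)"
    using cb[OF order_refl P.unit_closed, of "basis 1"] tensor_coords_basis[OF P.component_module[OF order_refl] P.unit_closed, of 1 1]
    by (auto simp: delta_fun_def intro!: restrict_ext)
  show "coords P n (basis (op_act P n \<sigma> (fst x), op_act perm_operad n \<sigma> (snd x))) =
      op_act (coord_operad P) n \<sigma> (coords P n (basis x))"
    if n: "n \<ge> 1" and x: "x \<in> carrier (component P n) \<times> carrier (component perm_operad n)" and s: "\<sigma> permutes {1..n}" for n \<sigma> x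
  proof -
    have a: "fst x \<in> carrier (component P n)" using x by auto
    have s': "inv_into UNIV \<sigma> k \<in> {1..n}" if "k \<in> {1..n}" for k
      using permutes_in_image[OF permutes_inv[OF s]] that by blast
    have "coords P n (basis (fst x, snd x)) = tensor_coords (component P n) n (fst x, snd x)" by (rule cb[OF n a])
    then show ?thesis
      using s' cb[OF n P.act_closed[OF n s a], of "op_act perm_operad n \<sigma> (snd x)"]
      by (auto simp: tensor_coords_def lookup_perm_act[OF permutes_bij[OF s]] linear_mapD(3)[OF P.act_linear[OF n s] a] intro!: restrict_ext)
  qed
  fix ms x ys assume ms: "positive_arities ms"
    and x: "x \<in> carrier (component P (length ms)) \<times> carrier (component (perm_operad :: ('a, nat \<Rightarrow>\<^sub>0 'a) operad) (length ms))"
    and ys: "list_all2 (\<lambda>m y. y \<in> carrier (component P m) \<times> carrier (component (perm_operad :: ('a, nat \<Rightarrow>\<^sub>0 'a) operad) m)) ms ys"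
  note pos = positive_aritiesD[OF ms]
  have bs: "op_args P ms (map fst ys)" and ws: "op_args perm_operad ms (map snd ys)"
    using ys by (auto simp: op_args_def list_all2_conv_all_nth mem_Times_iff)
  have a: "fst x \<in> carrier (component P (length ms))" and v: "Poly_Mapping.keys (snd x) \<subseteq> {1..length ms}"
    using x by (auto simp: mem_Times_iff)
  have len: "length ys = length ms" using list_all2_lengthD[OF ys] by simp
  define Gs where "Gs = map2 (\<lambda>m y. coords P m (basis y)) ms ys"
  have G: "Gs ! q = tensor_coords (component P (ms ! q)) (ms ! q) (ys ! q)" if "q < length ms" for q
    using that len cb[OF pos(3)[OF that], of "fst (ys ! q)" "snd (ys ! q)"] op_argsD(2)[OF bs that] by (simp add: Gs_def)
  let ?w = "\<lambda>q. Poly_Mapping.lookup (map snd ys ! q)"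
  \<comment> \<open>All coordinates of a pure tensor are multiples of one vector, so evaluation and
    total sum only affect the scalar in front of it.\<close>
  have slots: "slots P ms Gs i j = map (\<lambda>q. (if q = i then ?w q j else \<Sum>l\<in>{1..ms ! q}. ?w q l) \<odot>\<^bsub>component P (ms ! q)\<^esub> (map fst ys ! q)) [0..<length ms]"
    if i: "i < length ms" and j: "j \<in> {1..ms ! i}" for i j
  proof (rule nth_equalityI)
    fix q assume "q < length (slots P ms Gs i j)"
    then have q: "q < length ms" by simp
    let ?M = "component P (ms ! q)"
    interpret M: module scalars ?M by (rule P.component_module[OF pos(3)[OF q]])
    have b: "fst (ys ! q) \<in> carrier ?M" using op_argsD(2)[OF bs q] q len by simp
    have "finsum ?M (\<lambda>l. ?w q l \<odot>\<^bsub>?M\<^esub> fst (ys ! q)) A = (\<Sum>l\<in>A. ?w q l) \<odot>\<^bsub>?M\<^esub> fst (ys ! q)" if "finite A" for A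
      using that by (induction A) (use b M.smult_l_null M.smult_l_distr M.smult_closed in \<open>auto simp: Pi_def\<close>)
    moreover have "finsum ?M (Gs ! q) {1..ms ! q} = finsum ?M (\<lambda>l. ?w q l \<odot>\<^bsub>?M\<^esub> fst (ys ! q)) {1..ms ! q}"
      by (rule M.finsum_cong') (use b M.smult_closed G[OF q] q len in \<open>auto simp: tensor_coords_def\<close>)
    moreover have "q = i \<Longrightarrow> (Gs ! q) j = ?w q j \<odot>\<^bsub>?M\<^esub> fst (ys ! q)"
      using G[OF q] j q len by (simp add: tensor_coords_def)
    ultimately show "slots P ms Gs i j ! q = map (\<lambda>q. (if q = i then ?w q j else \<Sum>l\<in>{1..ms ! q}. ?w q l) \<odot>\<^bsub>component P (ms ! q)\<^esub> (map fst ys ! q)) [0..<length ms] ! q"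
      using q len by (auto simp: slots_def)
  qed simp
  have "coords P (length ms) (basis (fst x, snd x)) = tensor_coords (component P (length ms)) (length ms) (fst x, snd x)"
    by (rule cb[OF pos(1) a])
  then have cx: "coords P (length ms) (basis x) = tensor_coords (component P (length ms)) (length ms) x" by simp
  have "tensor_coords (component P (sum_list ms)) (sum_list ms) (op_comp P ms (fst x) (map fst ys), op_comp perm_operad ms (snd x) (map snd ys)) =
     op_comp (coord_operad P) ms (tensor_coords (component P (length ms)) (length ms) x) Gs"
    unfolding coord_operad_simps tensor_coords_def[of "component P (sum_list ms)"]
  proof (rule restrict_ext)
    fix k assume "k \<in> {1..sum_list ms}"
    then obtain i j where ij: "i < length ms" "j \<in> {1..ms ! i}" "k = offset ms i + j" "blk ms k = (i, j)" by (rule block_cases)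
    have "tensor_coords (component P (length ms)) (length ms) x (Suc i) = Poly_Mapping.lookup (snd x) (Suc i) \<odot>\<^bsub>component P (length ms)\<^esub> fst x"
      using ij(1) by (simp add: tensor_coords_def)
    then show "Poly_Mapping.lookup (snd (op_comp P ms (fst x) (map fst ys), op_comp perm_operad ms (snd x) (map snd ys))) k
        \<odot>\<^bsub>component P (sum_list ms)\<^esub> fst (op_comp P ms (fst x) (map fst ys), op_comp perm_operad ms (snd x) (map snd ys)) =
      op_comp P ms (tensor_coords (component P (length ms)) (length ms) x (Suc (fst (blk ms k)))) (slots P ms Gs (fst (blk ms k)) (snd (blk ms k)))"
      unfolding ij(4) fst_conv snd_conv perm_operad_simps
      using lookup_perm_comp[OF ms v ws ij(1,2)] P.comp_scale[OF ms a bs] by (simp only: slots[OF ij(1,2)] ij(3))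
  qed
  then show "coords P (sum_list ms) (basis (op_comp P ms (fst x) (map fst ys), op_comp perm_operad ms (snd x) (map snd ys))) =
     op_comp (coord_operad P) ms (coords P (length ms) (basis x)) (map2 (\<lambda>m y. coords P m (basis y)) ms ys)"
    using cb[OF pos(2) P.comp_closed[OF ms a bs]] cx by (simp only: Gs_def)
qed

text \<open>Identifies \<open>di P\<close> with \<open>coord_operad P\<close> by way of
  \<open>induced_iso\<close>: the tensor relations are the kernel of the coordinates, and
  recombination gives preimages.\<close>

lemma di_quotient:
  assumes P: "pre_operad P"
  shows "operad_quotient (product_linearization P perm_operad) (coord_operad P) (coords P) (hadamard_relations P perm_operad)"
proof -
  interpret P: pre_operad P by fact
  interpret C: pre_operad "coord_operad P" by (rule P.pre_operad_coord)
  interpret A: pre_operad "product_linearization P perm_operad"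
    unfolding product_linearization_def by (rule set_operad.pre_operad_lin[OF set_operad_product[OF P pre_operad_perm]])
  show ?thesis
  proof
    show "coords P \<in> operad_hom (product_linearization P perm_operad) (coord_operad P)" by (rule coords_hom[OF P])
    fix n :: nat assume n: "n \<ge> 1"
    show "hadamard_relations P perm_operad n = operad_kernel (product_linearization P perm_operad) (coord_operad P) (coords P) n"
      using tensor_relations_iff[OF P.component_module[OF n]]
      by (intro Set.set_eqI) (simp add: hadamard_relations_def operad_kernel_iff coords_def)
    show "coords P n ` carrier (component (product_linearization P perm_operad) n) = carrier (component (coord_operad P) n)"
    proof (intro equalityI subsetI)
      show "F \<in> carrier (component (coord_operad P) n)" if "F \<in> coords P n ` carrier (component (product_linearization P perm_operad) n)" for F
        using that linear_mapD(1)[OF operad_homD(1)[OF coords_hom[OF P] n]] by blast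
      fix F assume F: "F \<in> carrier (component (coord_operad P) n)"
      then show "F \<in> coords P n ` carrier (component (product_linearization P perm_operad) n)"
        using tensor_coord_recombine[OF P.component_module[OF n], of F n]
        by (intro image_eqI[where x = "\<Sum>k\<in>{1..n}. basis (F k, basis k)"]) (simp_all add: coords_def)
    qed
  qed
qed

section \<open>Monomials, substitution, and substitutions as operadic compositions\<close>

section \<open>Monomials\<close>

abbreviation rename :: "(nat \<Rightarrow> nat) \<Rightarrow> 'f monomial \<Rightarrow> 'f monomial"
  where "rename \<beta> \<equiv> subst (\<lambda>i. Var (\<beta> i))"

lemma subst_subst: "subst s (subst r t) = subst (\<lambda>i. subst s (r i)) t"
  by (induction t) auto

lemma subst_cong_leaves: "(\<And>i. i \<in> set (leaves t) \<Longrightarrow> s i = r i) \<Longrightarrow> subst s t = subst r t"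
  by (induction t) auto

lemma subst_Var: "(\<And>i. i \<in> set (leaves t) \<Longrightarrow> s i = Var i) \<Longrightarrow> subst s t = t"
  by (induction t) (auto intro!: map_idI)

lemma concat_map_concat: "concat (map g (concat xss)) = concat (map (\<lambda>xs. concat (map g xs)) xss)"
  by (induction xss) auto

lemma leaves_subst: "leaves (subst s t) = concat (map (\<lambda>i. leaves (s i)) (leaves t))"
  by (induction t) (simp_all add: concat_map_concat comp_def cong: map_cong)

lemma in_concat_map_iff: "x \<in> set (concat (map f zs)) \<longleftrightarrow> (\<exists>i<length zs. x \<in> set (f (zs ! i)))"
  by (simp, metis in_set_conv_nth)

lemma leaves_rename: "leaves (rename \<beta> t) = map \<beta> (leaves t)"
  by (simp add: leaves_subst)

lemma size_rename: "size (rename \<beta> t) = size t"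
  by (induction t) (auto simp: size_list_conv_sum_list comp_def cong: map_cong)

lemma well_formed_subst:
  "well_formed L t \<Longrightarrow> (\<And>i. i \<in> set (leaves t) \<Longrightarrow> well_formed L (s i)) \<Longrightarrow> well_formed L (subst s t)"
  by (induction t) auto

lemma well_formed_rename: "well_formed L t \<Longrightarrow> well_formed L (rename \<beta> t)"
  by (rule well_formed_subst) auto

text \<open>Arities of at least 2 exclude constants, so descending into arguments always ends at a
  variable.\<close>

lemma leaves_nonempty:
  assumes "language L" "well_formed L t"
  shows "leaves t \<noteq> []"
  using assms(2)
proof (induction t)
  case (App f ts)
  then have "length ts \<ge> 2" using assms(1) by (auto simp: language_def)
  then obtain t where "t \<in> set ts" by (cases ts) auto
  then show ?case using App by auto
qed simp

lemma distinct_concat_map: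
  assumes "distinct xs" "\<And>x. x \<in> set xs \<Longrightarrow> distinct (f x)"
    and "\<And>x y. x \<in> set xs \<Longrightarrow> y \<in> set xs \<Longrightarrow> x \<noteq> y \<Longrightarrow> set (f x) \<inter> set (f y) = {}"
  shows "distinct (concat (map f xs))"
  using assms
proof (induction xs)
  case (Cons x xs)
  have "set (f x) \<inter> set (concat (map f xs)) = {}" using Cons.prems by fastforce
  then show ?case using Cons by simp
qed simp

lemma distinct_concat_map_D:
  assumes "distinct (concat (map f xs))"
  shows distinct_concat_map_nth: "i < length xs \<Longrightarrow> distinct (f (xs ! i))"
    and distinct_concat_map_unique:
      "i < length xs \<Longrightarrow> j < length xs \<Longrightarrow> x \<in> set (f (xs ! i)) \<Longrightarrow> x \<in> set (f (xs ! j)) \<Longrightarrow> i = j"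
proof -
  show "i < length xs \<Longrightarrow> distinct (f (xs ! i))" using assms by (auto simp: distinct_concat_iff)
  show "i = j" if "i < length xs" "j < length xs" "x \<in> set (f (xs ! i))" "x \<in> set (f (xs ! j))"
    using assms that
  proof (induction xs arbitrary: i j)
    case (Cons a xs)
    have mem: "y \<notin> set (f a)" if "l < length xs" "y \<in> set (f (xs ! l))" for l y
      using Cons.prems(1) in_concat_map_iff[of y f xs] that by auto
    show ?case using Cons.prems mem Cons.IH by (cases i; cases j) auto
  qed simp
qed

lemma polylinear_monomialsI:
  "well_formed L t \<Longrightarrow> distinct (leaves t) \<Longrightarrow> set (leaves t) = {1..n} \<Longrightarrow> t \<in> polylinear_monomials L n"
  by (simp add: polylinear_monomials_def)

lemma polylinear_monomialsD:
  assumes "t \<in> polylinear_monomials L n"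
  shows "well_formed L t" "distinct (leaves t)" "set (leaves t) = {1..n}" "length (leaves t) = n"
  using assms distinct_card[of "leaves t"] by (auto simp: polylinear_monomials_def)

lemma rename_polylinear:
  assumes "well_formed L t" "distinct (leaves t)" "bij_betw \<beta> (set (leaves t)) {1..n}"
  shows "rename \<beta> t \<in> polylinear_monomials L n"
  using assms by (intro polylinear_monomialsI)
    (auto simp: well_formed_rename leaves_rename distinct_map bij_betw_def)

lemma leaves_monomial_comp:
  "leaves (monomial_comp ms t us) =
    concat (map (\<lambda>i. map ((+) (offset ms (i - 1))) (leaves (us ! (i - 1)))) (leaves t))"
  by (simp add: monomial_comp_def leaves_subst comp_def)

lemma set_operad_free: "set_operad (polylinear_monomials L) monomial_comp (Var 1) (\<lambda>n. rename)"
proof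
  show "Var 1 \<in> polylinear_monomials L 1" by (auto simp: polylinear_monomials_def)
  show "rename \<sigma> x \<in> polylinear_monomials L n"
    if "\<sigma> permutes {1..n}" "x \<in> polylinear_monomials L n" for n \<sigma> x
    using polylinear_monomialsD[OF that(2)] permutes_imp_bij[OF that(1)] by (intro rename_polylinear) auto
  fix ms t us assume ms: "positive_arities ms" and t: "t \<in> polylinear_monomials L (length ms)"
    and us: "list_all2 (\<lambda>m y. y \<in> polylinear_monomials L m) ms us"
  note t = polylinear_monomialsD[OF t]
  have u: "us ! q \<in> polylinear_monomials L (ms ! q)" if "q < length ms" for q
    using us that by (auto simp: list_all2_conv_all_nth)
  show "monomial_comp ms t us \<in> polylinear_monomials L (sum_list ms)"
  proof (rule polylinear_monomialsI)
    show "well_formed L (monomial_comp ms t us)"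
      unfolding monomial_comp_def
      by (rule well_formed_subst[OF t(1)], rule well_formed_rename)
        (use t(3) polylinear_monomialsD(1)[OF u] in auto)
    show "distinct (leaves (monomial_comp ms t us))"
      unfolding leaves_monomial_comp
    proof (rule distinct_concat_map[OF t(2)])
      fix i assume i: "i \<in> set (leaves t)"
      then have i': "i - 1 < length ms" using t(3) by auto
      show "distinct (map ((+) (offset ms (i - 1))) (leaves (us ! (i - 1))))"
        using polylinear_monomialsD(2)[OF u[OF i']] by (simp add: distinct_map)
      fix j assume j: "j \<in> set (leaves t)" "i \<noteq> j"
      then have j': "j - 1 < length ms" using t(3) by auto
      have "i - 1 \<noteq> j - 1" using i j t(3) by auto
      \<comment> \<open>Different arguments occupy different blocks, so their shifted variables
        cannot coincide.\<close>
      then have "offset ms (i - 1) + a \<noteq> offset ms (j - 1) + b"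
        if "a \<in> set (leaves (us ! (i - 1)))" "b \<in> set (leaves (us ! (j - 1)))" for a b
        using offset_eq_iff[OF i' _ j'] that
        unfolding polylinear_monomialsD(3)[OF u[OF i']] polylinear_monomialsD(3)[OF u[OF j']] by blast
      then show "set (map ((+) (offset ms (i - 1))) (leaves (us ! (i - 1)))) \<inter>
        set (map ((+) (offset ms (j - 1))) (leaves (us ! (j - 1)))) = {}"
        by fastforce
    qed
    show "set (leaves (monomial_comp ms t us)) = {1..sum_list ms}"
    proof (intro equalityI subsetI)
      fix k assume "k \<in> set (leaves (monomial_comp ms t us))"
      then obtain i j where ij: "i \<in> {1..length ms}" "j \<in> set (leaves (us ! (i - 1)))" "k = offset ms (i - 1) + j"
        using t(3) by (auto simp: leaves_monomial_comp)
      then have "j \<in> {1..ms ! (i - 1)}" using polylinear_monomialsD(3)[OF u, of "i - 1"] by auto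
      then show "k \<in> {1..sum_list ms}" using offset_le[of "i - 1" ms j] ij by auto
    next
      fix k assume "k \<in> {1..sum_list ms}"
      then obtain i j where ij: "i < length ms" "j \<in> {1..ms ! i}" "k = offset ms i + j" by (rule block_cases)
      then have "Suc i \<in> set (leaves t)" "j \<in> set (leaves (us ! i))"
        using t(3) polylinear_monomialsD(3)[OF u[OF ij(1)]] by auto
      then show "k \<in> set (leaves (monomial_comp ms t us))"
        unfolding leaves_monomial_comp using ij(3) by (auto intro!: bexI[of _ "Suc i"])
    qed
  qed
qed

lemma pre_operad_free: "pre_operad (free_operad L)"
  unfolding free_operad_def by (rule set_operad.pre_operad_lin[OF set_operad_free])

lemma free_operad_simps [simp]:
  "component (free_operad L) = (\<lambda>n. free_module (polylinear_monomials L n))"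
  "op_comp (free_operad L) = (\<lambda>ms. multilin_ext (monomial_comp ms))"
  "op_unit (free_operad L) = basis (Var 1)"
  "op_act (free_operad L) = (\<lambda>n \<sigma>. lin_ext (\<lambda>x. basis (rename \<sigma> x)))"
  by (simp_all add: free_operad_def)

text \<open>\<open>\<beta> i\<close> numbers the variables of the \<open>i\<close>-th term
  consecutively from 1, as an argument of a composition requires; \<open>\<sigma>\<close> restores
  the original variables from the positions in the blocks.\<close>

definition standardization ::
    "'f monomial list \<Rightarrow> nat \<Rightarrow> nat list \<Rightarrow> (nat \<Rightarrow> nat \<Rightarrow> nat) \<Rightarrow> (nat \<Rightarrow> nat) \<Rightarrow> bool"
  where "standardization zs N ms \<beta> \<sigma> \<longleftrightarrow>
    length ms = length zs \<and> positive_arities ms \<and> sum_list ms = N \<and> \<sigma> permutes {1..N} \<and>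
    (\<forall>i<length zs. ms ! i = length (leaves (zs ! i)) \<and> bij_betw (\<beta> i) (set (leaves (zs ! i))) {1..ms ! i} \<and>
      (\<forall>x\<in>set (leaves (zs ! i)). \<sigma> (offset ms i + \<beta> i x) = x))"

lemma standardizationD:
  assumes "standardization zs N ms \<beta> \<sigma>"
  shows "length ms = length zs" "positive_arities ms" "sum_list ms = N" "\<sigma> permutes {1..N}"
    and "i < length zs \<Longrightarrow> ms ! i = length (leaves (zs ! i))"
    and "i < length zs \<Longrightarrow> bij_betw (\<beta> i) (set (leaves (zs ! i))) {1..ms ! i}"
    and "i < length zs \<Longrightarrow> x \<in> set (leaves (zs ! i)) \<Longrightarrow> \<sigma> (offset ms i + \<beta> i x) = x"
  using assms unfolding standardization_def by blast+

text \<open>Every substitution with pairwise distinct variables is an operadic composition of renamed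
  arguments, followed by a permutation of the variables.  The data only depend on the sets of
  variables of the arguments.\<close>

lemma standardization_subst:
  assumes st: "standardization zs N ms \<beta> \<sigma>"
    and a: "set (leaves a) \<subseteq> {1..length zs}" and len: "length zs' = length zs"
    and eq: "\<And>i. i < length zs \<Longrightarrow> set (leaves (zs' ! i)) = set (leaves (zs ! i))"
  shows "subst (\<lambda>i. zs' ! (i - 1)) a =
      rename \<sigma> (monomial_comp ms a (map (\<lambda>i. rename (\<beta> i) (zs' ! i)) [0..<length zs]))"
  unfolding monomial_comp_def subst_subst subst.simps
proof (rule subst_cong_leaves)
  fix i assume "i \<in> set (leaves a)"
  with a have "i \<in> {1..length zs}" by blast
  then have i: "i - 1 < length zs" by auto
  have "subst (\<lambda>x. Var (\<sigma> (offset ms (i - 1) + \<beta> (i - 1) x))) (zs' ! (i - 1)) = zs' ! (i - 1)"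
    by (rule subst_Var) (use standardizationD(7)[OF st i] eq[OF i] in simp)
  then show "zs' ! (i - 1) = subst (\<lambda>j. Var (\<sigma> (offset ms (i - 1) + j)))
    (map (\<lambda>i. rename (\<beta> i) (zs' ! i)) [0..<length zs] ! (i - 1))"
    using i by (simp add: subst_subst)
qed

text \<open>Any numberings of the variables of the terms will do, and they determine
  \<open>\<sigma>\<close>. It maps \<open>{1..N}\<close> onto itself because each variable occurs in
  some term, and a surjection of a finite set onto itself is injective.\<close>

lemma standardization_exists:
  fixes zs :: "'f monomial list"
  assumes dist: "distinct (concat (map leaves zs))" and ne: "\<And>z. z \<in> set zs \<Longrightarrow> leaves z \<noteq> []"
    and vars: "set (concat (map leaves zs)) = {1..N}" and "zs \<noteq> []"
  obtains ms \<beta> \<sigma> where "standardization zs N ms \<beta> \<sigma>"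
proof -
  define ms where "ms = map (length \<circ> leaves) zs"
  have len: "length ms = length zs" by (simp add: ms_def)
  have ms: "ms ! i = length (leaves (zs ! i))" if "i < length zs" for i using that by (simp add: ms_def)
  have pos: "positive_arities ms"
    using ne \<open>zs \<noteq> []\<close> by (auto simp: positive_arities_def ms_def Suc_le_eq)
  have "sum_list ms = length (concat (map leaves zs))" by (simp add: ms_def length_concat comp_def)
  also have "\<dots> = N" using distinct_card[OF dist] vars by simp
  finally have sum: "sum_list ms = N" .
  have "\<exists>b. i < length zs \<longrightarrow> bij_betw b (set (leaves (zs ! i))) {1..ms ! i}" for i
  proof (cases "i < length zs")
    case True
    have "card (set (leaves (zs ! i))) = card {1..ms ! i}"
      using distinct_card[OF distinct_concat_map_nth[OF dist True]] ms[OF True] by simp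
    then show ?thesis using finite_same_card_bij[of "set (leaves (zs ! i))" "{1..ms ! i}"] by auto
  qed simp
  then obtain \<beta> where bij: "\<And>i. i < length zs \<Longrightarrow> bij_betw (\<beta> i) (set (leaves (zs ! i))) {1..ms ! i}"
    by metis
  \<comment> \<open>A block position goes to the variable that is numbered by it; outside
    \<open>{1..N}\<close> the identity is prescribed by \<open>permutes\<close>.\<close>
  define \<sigma> where "\<sigma> k = (if k \<in> {1..N} then
    inv_into (set (leaves (zs ! fst (blk ms k)))) (\<beta> (fst (blk ms k))) (snd (blk ms k)) else k)" for k
  have sigma: "\<sigma> (offset ms i + \<beta> i x) = x" if i: "i < length zs" and x: "x \<in> set (leaves (zs ! i))" for i x
  proof -
    have b: "\<beta> i x \<in> {1..ms ! i}" using bij_betw_apply[OF bij[OF i] x] .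
    then have "blk ms (offset ms i + \<beta> i x) = (i, \<beta> i x)" "offset ms i + \<beta> i x \<in> {1..N}"
      using blk_offset[of i ms] offset_le[of i ms] i len sum by auto
    then show ?thesis using bij_betw_inv_into_left[OF bij[OF i] x] by (simp add: \<sigma>_def)
  qed
  have "\<sigma> ` {1..N} = {1..N}"
  proof (intro equalityI subsetI)
    fix y assume "y \<in> \<sigma> ` {1..N}"
    then obtain k where k: "k \<in> {1..sum_list ms}" "y = \<sigma> k" by (auto simp: sum)
    from k(1) obtain i j where ij: "i < length ms" "j \<in> {1..ms ! i}" "k = offset ms i + j" "blk ms k = (i, j)"
      by (rule block_cases)
    have "y \<in> set (leaves (zs ! i))"
      using bij_betw_apply[OF bij_betw_inv_into[OF bij] ij(2)] ij k sum len by (simp add: \<sigma>_def)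
    then show "y \<in> {1..N}" using vars ij(1) len nth_mem by fastforce
  next
    fix x assume "x \<in> {1..N}"
    then obtain i where i: "i < length zs" "x \<in> set (leaves (zs ! i))"
      using vars in_concat_map_iff by metis
    have "\<beta> i x \<in> {1..ms ! i}" using bij_betw_apply[OF bij[OF i(1)] i(2)] .
    then have "offset ms i + \<beta> i x \<in> {1..N}" using offset_le[of i ms] i len sum by auto
    then show "x \<in> \<sigma> ` {1..N}" using sigma[OF i] by (metis imageI)
  qed
  then have "bij_betw \<sigma> {1..N} {1..N}"
    unfolding bij_betw_def using finite_surj_inj[of "{1..N}" \<sigma>] by auto
  then have perm: "\<sigma> permutes {1..N}" by (rule bij_imp_permutes) (auto simp: \<sigma>_def)
  show ?thesis
    by (rule that[of ms \<beta> \<sigma>]) (use len pos sum perm ms bij sigma in \<open>auto simp: standardization_def\<close>)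
qed

text \<open>Together with \<open>standardization_subst\<close> this presents a monomial as a
  generator composed with its renumbered branches.\<close>

lemma App_subst:
  assumes "length ts = n"
  shows "App f ts = subst (\<lambda>i. ts ! (i - 1)) (App f (map Var [1..<n + 1]))"
  using assms by (auto intro!: nth_equalityI simp del: upt_Suc)

lemma leaves_corolla [simp]: "leaves (App f (map Var [1..<n + 1])) = [1..<n + 1]"
  by (simp add: comp_def concat_map_singleton del: upt_Suc)

lemma corolla_polylinear:
  "f \<in> symbols L \<Longrightarrow> App f (map Var [1..<arity L f + 1]) \<in> polylinear_monomials L (arity L f)"
  by (rule polylinear_monomialsI; (unfold leaves_corolla)?) (auto simp del: upt_Suc)

text \<open>By induction on the size, a monomial is the unit or a permuted composition of a
  generator with smaller monomials. This is what makes the choice in \<open>free_morphism\<close>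
  harmless.\<close>

lemma free_operad_hom_unique:
  fixes L :: "'f language" and Q :: "('k::field, 'b) operad"
  assumes L: "language L" and Q: "pre_operad Q"
    and phi: "\<phi> \<in> operad_hom (free_operad L) Q" and psi: "\<psi> \<in> operad_hom (free_operad L) Q"
    and gen: "\<And>f. f \<in> symbols L \<Longrightarrow> \<phi> (arity L f) (generator L f) = \<psi> (arity L f) (generator L f)"
    and n: "n \<ge> 1" and x: "x \<in> carrier (component (free_operad L) n)"
  shows "\<phi> n x = \<psi> n x"
proof -
  interpret F: pre_operad "free_operad L" by (rule pre_operad_free)
  note D1 = operad_homD[OF phi] and D2 = operad_homD[OF psi]
  have mono: "\<phi> n (basis t) = \<psi> n (basis t)" if "n \<ge> 1" "t \<in> polylinear_monomials L n" for n t
    using that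
  proof (induction "size t" arbitrary: t n rule: less_induct)
    case less
    note t = polylinear_monomialsD[OF less.prems(2)]
    show ?case
    proof (cases t)
      case (Var i)
      \<comment> \<open>A single variable is polylinear only as \<open>Var 1\<close>, the operadic
        unit.\<close>
      then have "n = 1" "i = 1" using t(3,4) less.prems(1) by auto
      then show ?thesis using D1(3) D2(3) Var by simp
    next
      case (App f ts)
      have f: "f \<in> symbols L" "length ts = arity L f" "\<And>z. z \<in> set ts \<Longrightarrow> well_formed L z" using t(1) App by auto
      have "ts \<noteq> []" using f L by (auto simp: language_def)
      have dist: "distinct (concat (map leaves ts))" and vars: "set (concat (map leaves ts)) = {1..n}"
        using t(2,3) App by auto
      obtain ms \<beta> \<sigma> where st0: "standardization ts n ms \<beta> \<sigma>"
        using standardization_exists[OF dist leaves_nonempty[OF L f(3)] vars \<open>ts \<noteq> []\<close>] .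
      note st = standardizationD[OF st0]
      define us where "us = map (\<lambda>i. rename (\<beta> i) (ts ! i)) [0..<length ts]"
      have us: "us ! i \<in> polylinear_monomials L (ms ! i)" if "i < length ms" for i
        using that st(1) rename_polylinear[OF f(3) distinct_concat_map_nth[OF dist] st(6), of i] by (simp add: us_def)
      have t_eq: "t = rename \<sigma> (monomial_comp ms (App f (map Var [1..<arity L f + 1])) us)"
        unfolding us_def App App_subst[OF f(2)] by (rule standardization_subst[OF st0]; (unfold leaves_corolla)?) (use f(2) in \<open>auto simp del: upt_Suc\<close>)
      have args: "op_args (free_operad L) ms (map basis us)"
        by (rule op_argsI) (use us st(1) in \<open>auto simp: us_def\<close>)
      have g: "generator L f \<in> carrier (component (free_operad L) (length ms))"
        using corolla_polylinear[OF f(1)] st(1) f(2) by (simp add: generator_def del: upt_Suc)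
      have basis_t: "basis t = op_act (free_operad L) n \<sigma> (op_comp (free_operad L) ms (generator L f) (map basis us))"
        unfolding free_operad_simps generator_def multilin_ext_basis lin_ext_basis t_eq ..
      have expand: "\<chi> n (basis t) = op_act Q n \<sigma> (op_comp Q ms (\<chi> (length ms) (generator L f)) (map2 \<chi> ms (map basis us)))"
        if "\<chi> \<in> operad_hom (free_operad L) Q" for \<chi>
        unfolding basis_t
          operad_homD(2)[OF that less.prems(1) F.comp_closed[OF st(2) g args, unfolded st(3)] st(4)]
          operad_homD(4)[OF that g st(2) args, unfolded st(3)] ..
      have "map2 \<phi> ms (map basis us) = map2 \<psi> ms (map basis us)"
      proof (rule nth_equalityI)
        fix i assume "i < length (map2 \<phi> ms (map basis us))"
        then have i: "i < length ms" "i < length ts" using st(1) by auto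
        \<comment> \<open>Renumbering the variables preserves the size, so the arguments are smaller
          than \<open>t\<close>.\<close>
        have "size (us ! i) < size t"
          using i nth_mem[OF i(2)] size_list_estimation'[of "ts ! i" ts "size (ts ! i)" size]
          by (simp add: us_def size_rename App)
        then have "\<phi> (ms ! i) (basis (us ! i)) = \<psi> (ms ! i) (basis (us ! i))"
          using less.hyps us[OF i(1)] positive_aritiesD(3)[OF st(2) i(1)] by blast
        then show "map2 \<phi> ms (map basis us) ! i = map2 \<psi> ms (map basis us) ! i"
          using i by (simp add: us_def)
      qed simp
      moreover have "\<phi> (length ms) (generator L f) = \<psi> (length ms) (generator L f)"
        using gen[OF f(1)] f(2) st(1) by simp
      ultimately show ?thesis by (simp only: expand[OF phi] expand[OF psi])
    qed
  qed
  show ?thesis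
    by (rule linear_map_eq_on_basis[OF pre_operad.component_module[OF Q n], where X = "polylinear_monomials L n"])
      (use D1(1)[OF n] D2(1)[OF n] mono[OF n] x in simp_all)
qed

section \<open>The leaf selected by the upper indices, and emphasis of a given leaf\<close>

subsection \<open>Emphasized leaves\<close>

fun head :: "('f \<times> nat) monomial \<Rightarrow> nat" where
  "head (Var i) = i"
| "head (App F ts) = map head ts ! (snd F - 1)"

fun forget :: "('f \<times> nat) monomial \<Rightarrow> 'f monomial" where
  "forget (Var i) = Var i"
| "forget (App F ts) = App (fst F) (map forget ts)"

lemma leaves_forget [simp]: "leaves (forget t) = leaves t"
  by (induction t) (auto intro!: arg_cong[of _ _ concat])

lemma forget_subst: "forget (subst s t) = subst (\<lambda>i. forget (s i)) (forget t)"
  by (induction t) auto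

lemma well_formed_language2:
  "well_formed (language2 L) (App (f, k) ts) \<longleftrightarrow> f \<in> symbols L \<and> k \<in> {1..arity L f} \<and>
    length ts = arity L f \<and> (\<forall>t\<in>set ts. well_formed (language2 L) t)"
  by (auto simp: language2_def)

lemma language_language2: "language L \<Longrightarrow> language (language2 L)"
  by (auto simp: language_def language2_def)

lemma well_formed_forget: "well_formed (language2 L) t \<Longrightarrow> well_formed L (forget t)"
  by (induction t) (auto simp: well_formed_language2[of L "fst x1" "snd x1" for x1, simplified])

lemma forget_polylinear:
  "t \<in> polylinear_monomials (language2 L) n \<Longrightarrow> forget t \<in> polylinear_monomials L n"
  by (auto simp: polylinear_monomials_def well_formed_forget)

text \<open>The path from the root leaves \<open>t\<close> at its own head and continues inside the
  monomial substituted there.\<close>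

lemma head_subst: "well_formed (language2 L) t \<Longrightarrow> head (subst s t) = head (s (head t))"
proof (induction t)
  case (App F ts)
  obtain f k where F: "F = (f, k)" by fastforce
  from App.prems have "k - 1 < length ts" "\<forall>t\<in>set ts. well_formed (language2 L) t"
    unfolding F well_formed_language2 by auto
  then show ?case using App.IH[of "ts ! (k - 1)"] F by simp
qed simp

lemma head_in_leaves: "well_formed (language2 L) t \<Longrightarrow> head t \<in> set (leaves t)"
proof (induction t)
  case (App F ts)
  obtain f k where F: "F = (f, k)" by fastforce
  from App.prems have k: "k - 1 < length ts" "\<forall>t\<in>set ts. well_formed (language2 L) t"
    unfolding F well_formed_language2 by auto
  then have "head (ts ! (k - 1)) \<in> set (leaves (ts ! (k - 1)))" using App.IH by simp
  then show ?case using F k nth_mem by fastforce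
qed simp

lemma leaves_emphasize [simp]: "leaves (emphasize k t) = leaves t"
  by (induction t) (auto intro!: arg_cong[of _ _ concat])

lemma forget_emphasize [simp]: "forget (emphasize k t) = t"
  by (induction t) (auto intro!: map_idI)

text \<open>The default 1 is also a branch, as the list is nonempty.\<close>

lemma branch_in: "ts \<noteq> [] \<Longrightarrow> branch k ts \<in> {1..length ts}"
proof (cases "\<exists>q\<in>{1..length ts}. k \<in> set (leaves (ts ! (q - 1)))")
  case True
  then have "(LEAST q. q \<in> {1..length ts} \<and> k \<in> set (leaves (ts ! (q - 1)))) \<in> {1..length ts}"
    by (metis (no_types, lifting) LeastI)
  with True show ?thesis by (simp add: branch_def)
next
  case False
  assume "ts \<noteq> []"
  with False show ?thesis by (cases ts) (auto simp: branch_def)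
qed

lemma branch_leaf:
  assumes "k \<in> set (leaves (App f ts))"
  shows "k \<in> set (leaves (ts ! (branch k ts - 1)))"
proof -
  obtain i where "i < length ts" "k \<in> set (leaves (ts ! i))" using assms unfolding leaves.simps in_concat_map_iff by blast
  then have ex: "\<exists>q\<in>{1..length ts}. k \<in> set (leaves (ts ! (q - 1)))" by (auto intro!: bexI[of _ "Suc i"])
  then have "k \<in> set (leaves (ts ! ((LEAST q. q \<in> {1..length ts} \<and> k \<in> set (leaves (ts ! (q - 1)))) - 1)))"
    by (metis (no_types, lifting) LeastI)
  with ex show ?thesis by (simp add: branch_def)
qed

lemma well_formed_emphasize:
  assumes "language L"
  shows "well_formed L t \<Longrightarrow> well_formed (language2 L) (emphasize k t)"
proof (induction t)
  case (App f ts)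
  then have "ts \<noteq> []" using assms by (auto simp: language_def)
  then show ?case using App branch_in[of ts k] unfolding emphasize.simps well_formed_language2 by auto
qed simp

text \<open>Only the vertices on the path to \<open>k\<close> matter, and at each of them
  \<open>branch\<close> selects an argument that contains \<open>k\<close>.\<close>

lemma head_emphasize: "k \<in> set (leaves t) \<Longrightarrow> head (emphasize k t) = k"
proof (induction t)
  case (App f ts)
  then have "ts \<noteq> []" by auto
  then have b: "branch k ts - 1 < length ts" using branch_in[of ts k] by auto
  then show ?case using App.IH[OF nth_mem[OF b]] branch_leaf[OF App.prems] by simp
qed simp

lemma emphasize_polylinear:
  "language L \<Longrightarrow> t \<in> polylinear_monomials L n \<Longrightarrow> emphasize k t \<in> polylinear_monomials (language2 L) n"
  by (auto simp: polylinear_monomials_def well_formed_emphasize)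

lemma head_polylinear: "t \<in> polylinear_monomials (language2 L) n \<Longrightarrow> head t \<in> {1..n}"
  using head_in_leaves by (fastforce simp: polylinear_monomials_def)

text \<open>\<open>head\<close> turns composition of monomials into \<open>perm_comp\<close>, the
  composition of basis elements of Perm.\<close>

lemma head_monomial_comp:
  assumes "t \<in> polylinear_monomials (language2 L) (length ms)"
    and "list_all2 (\<lambda>m u. u \<in> polylinear_monomials (language2 L) m) ms us"
  shows "head (monomial_comp ms t us) = offset ms (head t - 1) + head (us ! (head t - 1))"
proof -
  have "head t - 1 < length ms" using head_polylinear[OF assms(1)] by auto
  then have "well_formed (language2 L) (us ! (head t - 1))"
    using assms(2) by (auto simp: list_all2_conv_all_nth polylinear_monomials_def)
  then show ?thesis
    using polylinear_monomialsD(1)[OF assms(1)] by (simp add: monomial_comp_def head_subst)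
qed

text \<open>The bound on the variables keeps the indices within \<open>us\<close>; beyond the end of
  a list, \<open>map forget\<close> need not commute with indexing.\<close>

lemma forget_monomial_comp:
  assumes "set (leaves t) \<subseteq> {1..length us}"
  shows "forget (monomial_comp ms t us) = monomial_comp ms (forget t) (map forget us)"
  unfolding monomial_comp_def forget_subst
proof (rule subst_cong_leaves)
  fix i assume "i \<in> set (leaves (forget t))"
  with assms have "i \<in> {1..length us}" unfolding leaves_forget by blast
  then have "i - 1 < length us" by auto
  then show "subst (\<lambda>i'. forget (Var (offset ms (i - 1) + i'))) (forget (us ! (i - 1))) =
    rename ((+) (offset ms (i - 1))) (map forget us ! (i - 1))" by simp
qed

section \<open>An explicit form of zeta in coordinates\<close>

section \<open>The morphism from the free operad to coordinates\<close>

text \<open>\<open>zeta\<close> in coordinates, given outright on monomials because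
  \<open>zeta\<close> itself is only a choice; their agreement is part of
  \<open>zeta_coords\<close>.\<close>

definition psi :: "'f language \<Rightarrow> nat \<Rightarrow> (('f \<times> nat) monomial \<Rightarrow>\<^sub>0 'k::field) \<Rightarrow> nat \<Rightarrow> ('f monomial \<Rightarrow>\<^sub>0 'k)"
  where "psi L n = lext (fun_module (free_module (polylinear_monomials L n)) n)
    (\<lambda>t. delta_fun (free_module (polylinear_monomials L n)) n (head t) (basis (forget t)))"

lemma psi_basis:
  assumes "t \<in> polylinear_monomials (language2 L) n"
  shows "psi L n (basis t) = delta_fun (free_module (polylinear_monomials L n)) n (head t) (basis (forget t))"
  unfolding psi_def
  by (rule lext_basis[OF vspace_fun_module[OF vspace_free_module]], rule delta_fun_closed[OF vspace_free_module])
    (use forget_polylinear[OF assms] in simp)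

lemma linear_map_psi:
  "linear_map (free_module (polylinear_monomials (language2 L) n)) (fun_module (free_module (polylinear_monomials L n)) n) (psi L n)"
  unfolding psi_def
  by (rule linear_map_lext[OF vspace_fun_module[OF vspace_free_module]])
    (auto intro!: delta_fun_closed[OF vspace_free_module] simp: forget_polylinear)

text \<open>Heads compose as in Perm and forgetting indices commutes with composition, so a
  composite of delta functions is the delta function at the composite head.\<close>

lemma psi_hom:
  "(psi L :: nat \<Rightarrow> (_ \<Rightarrow>\<^sub>0 'k::field) \<Rightarrow> _) \<in> operad_hom (free_operad (language2 L)) (coord_operad (free_operad L))"
  unfolding free_operad_def[of "language2 L"]
proof (rule set_operad.lin_homI[OF set_operad_free pre_operad.pre_operad_coord[OF pre_operad_free]])
  let ?B = "polylinear_monomials (language2 L)"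
  let ?F = "\<lambda>n. free_module (polylinear_monomials L n) :: ('k, _) module"
  interpret F: pre_operad "free_operad L" by (rule pre_operad_free)
  show "linear_map (free_module (?B n)) (component (coord_operad (free_operad L)) n) (psi L n)" for n
    using linear_map_psi by simp
  show "psi L 1 (basis (Var 1)) = op_unit (coord_operad (free_operad L))"
    by (subst psi_basis) (auto simp: polylinear_monomials_def delta_fun_def intro!: restrict_ext)
  show "psi L n (basis (rename \<sigma> t)) = op_act (coord_operad (free_operad L)) n \<sigma> (psi L n (basis t))"
    if n: "n \<ge> 1" and t: "t \<in> ?B n" and s: "\<sigma> permutes {1..n}" for n \<sigma> t
  proof -
    have s': "inv_into UNIV \<sigma> k \<in> {1..n}" if "k \<in> {1..n}" for k
      using permutes_in_image[OF permutes_inv[OF s]] that by blast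
    have eq: "k = \<sigma> (head t) \<longleftrightarrow> inv_into UNIV \<sigma> k = head t" for k
      using permutes_inverses[OF s] by metis
    have r: "rename \<sigma> t \<in> ?B n" using set_operad.set_act[OF set_operad_free n s t] .
    have hd: "head (rename \<sigma> t) = \<sigma> (head t)"
      using head_subst[OF polylinear_monomialsD(1)[OF t]] by simp
    show ?thesis
      unfolding psi_basis[OF t] psi_basis[OF r] coord_operad_simps hd delta_fun_def
      by (rule restrict_ext) (use s' in \<open>simp add: eq forget_subst\<close>)
  qed
  fix ms t us assume ms: "positive_arities ms" and t: "t \<in> ?B (length ms)" and us: "list_all2 (\<lambda>m u. u \<in> ?B m) ms us"
  note pos = positive_aritiesD[OF ms]
  have len: "length us = length ms" using us by (simp add: list_all2_lengthD)
  have u: "us ! q \<in> ?B (ms ! q)" if "q < length ms" for q using us that by (auto simp: list_all2_conv_all_nth)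
  define Gs where "Gs = map2 (\<lambda>m u. psi L m (basis u :: _ \<Rightarrow>\<^sub>0 'k)) ms us"
  have lenG: "length Gs = length ms" using len by (simp add: Gs_def)
  have G: "Gs ! q = delta_fun (?F (ms ! q)) (ms ! q) (head (us ! q)) (basis (forget (us ! q)))" if "q < length ms" for q
    using that len psi_basis[OF u[OF that]] by (simp add: Gs_def)
  have Gargs: "op_args (coord_operad (free_operad L)) ms Gs"
    by (rule op_argsI[OF lenG]) (simp add: G delta_fun_closed[OF vspace_free_module] forget_polylinear[OF u])
  let ?h = "head t - 1"
  have h: "?h < length ms" "head t = Suc ?h" using head_polylinear[OF t] by auto
  have hu: "head (us ! q) \<in> {1..ms ! q}" if "q < length ms" for q using head_polylinear[OF u[OF that]] .
  have comp_in: "monomial_comp ms t us \<in> ?B (sum_list ms)" using set_operad.set_comp[OF set_operad_free ms t us] .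
  \<comment> \<open>The total of a delta function is its single value, wherever that sits; only the
    evaluated slot \<open>i\<close> can become zero.\<close>
  have slots: "slots (free_operad L) ms Gs i j =
      (map basis (map forget us))[i := if j = head (us ! i) then basis (forget (us ! i)) else 0]"
    if i: "i < length ms" and j: "j \<in> {1..ms ! i}" for i j
  proof (rule nth_equalityI)
    fix q assume "q < length (slots (free_operad L) ms Gs i j)"
    then have q: "q < length ms" by simp
    have "Gs ! q \<in> {1..ms ! q} \<rightarrow> carrier (?F (ms ! q))"
      using op_argsD(2)[OF Gargs q] by (auto simp: fun_module_simps)
    then have "finsum (?F (ms ! q)) (Gs ! q) {1..ms ! q} =
      finsum (?F (ms ! q)) (\<lambda>l. if l = head (us ! q) then basis (forget (us ! q)) else \<zero>\<^bsub>?F (ms ! q)\<^esub>) {1..ms ! q}"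
      by (intro abelian_monoid.finsum_cong'[OF vspace_abelian_monoid[OF vspace_free_module]])
        (use forget_polylinear[OF u[OF q]] in \<open>auto simp: G[OF q] delta_fun_def\<close>)
    also have "\<dots> = basis (forget (us ! q))"
      by (rule finsum_delta[OF vspace_free_module _ hu[OF q]]) (use forget_polylinear[OF u[OF q]] in auto)
    finally have tot: "finsum (?F (ms ! q)) (Gs ! q) {1..ms ! q} = basis (forget (us ! q))" .
    show "slots (free_operad L) ms Gs i j ! q =
      (map basis (map forget us))[i := if j = head (us ! i) then basis (forget (us ! i)) else 0] ! q"
    proof (cases "q = i")
      case True
      then show ?thesis using i j len by (simp add: slots_def G[OF i] delta_fun_def)
    next
      case False
      then show ?thesis using q len tot by (simp add: slots_def)
    qed
  qed (simp add: len)
  have args: "op_args (free_operad L) ms (map basis (map forget us))"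
    by (rule op_argsI) (use len forget_polylinear[OF u] in auto)
  have ft: "basis (forget t) \<in> carrier (component (free_operad L) (length ms))"
    using forget_polylinear[OF t] by simp
  have "delta_fun (?F (sum_list ms)) (sum_list ms) (head (monomial_comp ms t us)) (basis (forget (monomial_comp ms t us))) =
    op_comp (coord_operad (free_operad L)) ms (delta_fun (?F (length ms)) (length ms) (head t) (basis (forget t))) Gs"
    unfolding coord_operad_simps delta_fun_def[of "?F (sum_list ms)"]
  proof (rule restrict_ext)
    fix k assume "k \<in> {1..sum_list ms}"
    then obtain i j where ij: "i < length ms" "j \<in> {1..ms ! i}" "k = offset ms i + j" "blk ms k = (i, j)" by (rule block_cases)
    have k: "k = head (monomial_comp ms t us) \<longleftrightarrow> i = ?h \<and> j = head (us ! i)"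
      unfolding head_monomial_comp[OF t us] ij(3) using offset_eq_iff[OF ij(1,2) h(1) hu[OF h(1)]] by auto
    have d: "delta_fun (?F (length ms)) (length ms) (head t) (basis (forget t)) (Suc i) = (if i = ?h then basis (forget t) else 0)"
      using ij(1) h by (auto simp: delta_fun_def)
    let ?bs = "map basis (map forget us) :: (_ \<Rightarrow>\<^sub>0 'k) list"
    \<comment> \<open>In a wrong block the root vanishes, at a wrong place in the right block the
      argument \<open>i\<close> vanishes, and at the head itself all factors are the monomials
      without indices.\<close>
    consider (eq) "i = ?h" "j = head (us ! i)" | (left) "i \<noteq> ?h" | (right) "i = ?h" "j \<noteq> head (us ! i)" by blast
    then show "(if k = head (monomial_comp ms t us) then basis (forget (monomial_comp ms t us)) else \<zero>\<^bsub>?F (sum_list ms)\<^esub>) =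
      op_comp (free_operad L) ms (delta_fun (?F (length ms)) (length ms) (head t) (basis (forget t)) (Suc (fst (blk ms k))))
        (slots (free_operad L) ms Gs (fst (blk ms k)) (snd (blk ms k)))"
      unfolding ij(4) fst_conv snd_conv d slots[OF ij(1,2)] k
    proof cases
      case eq
      have "(?bs :: (_ \<Rightarrow>\<^sub>0 'k) list)[i := basis (forget (us ! i))] = ?bs"
        using ij(1) len by (intro list_update_same_conv[THEN iffD2]) auto
      moreover have "forget (monomial_comp ms t us) = monomial_comp ms (forget t) (map forget us)"
        using polylinear_monomialsD(3)[OF t] len by (intro forget_monomial_comp) simp
      ultimately show "(if i = ?h \<and> j = head (us ! i) then basis (forget (monomial_comp ms t us)) else \<zero>\<^bsub>?F (sum_list ms)\<^esub>) =
        op_comp (free_operad L) ms (if i = ?h then basis (forget t) else 0)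
          (?bs[i := if j = head (us ! i) then basis (forget (us ! i)) else 0])"
        using eq multilin_ext_basis[of "monomial_comp ms" "forget t" "map forget us", where 'k = 'k] by simp
    next
      case left
      have a: "op_args (free_operad L) ms (?bs[i := if j = head (us ! i) then basis (forget (us ! i)) else 0])"
        by (rule op_args_update[OF args]) (use forget_polylinear[OF u[OF ij(1)]] in auto)
      show "(if i = ?h \<and> j = head (us ! i) then basis (forget (monomial_comp ms t us)) else \<zero>\<^bsub>?F (sum_list ms)\<^esub>) =
        op_comp (free_operad L) ms (if i = ?h then basis (forget t) else 0)
          (?bs[i := if j = head (us ! i) then basis (forget (us ! i)) else 0])"
        using linear_map_zero[OF F.component_module[OF pos(1)] F.component_module[OF pos(2)] F.comp_linear_left[OF ms a]] left
        by simp
    next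
      case right
      show "(if i = ?h \<and> j = head (us ! i) then basis (forget (monomial_comp ms t us)) else \<zero>\<^bsub>?F (sum_list ms)\<^esub>) =
        op_comp (free_operad L) ms (if i = ?h then basis (forget t) else 0)
          (?bs[i := if j = head (us ! i) then basis (forget (us ! i)) else 0])"
        using linear_map_zero[OF F.component_module[OF pos(3)[OF ij(1)]] F.component_module[OF pos(2)]
            F.comp_linear_right[OF ms ft args ij(1)]] right by simp
    qed
  qed
  then show "psi L (sum_list ms) (basis (monomial_comp ms t us) :: _ \<Rightarrow>\<^sub>0 'k) =
     op_comp (coord_operad (free_operad L)) ms (psi L (length ms) (basis t)) (map2 (\<lambda>m u. psi L m (basis u)) ms us)"
    by (simp only: psi_basis[OF t] psi_basis[OF comp_in] Gs_def)
qed

section \<open>Changing upper indices by the relations between nested monomials\<close>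

section \<open>Relabelling\<close>

text \<open>One step of this relation replaces the upper index of a symbol whose parent points to another
  branch, that is, it applies a defining relation of \<open>J(S)\<close> inside a monomial.\<close>

inductive relabel :: "('f \<times> nat) monomial \<Rightarrow> ('f \<times> nat) monomial \<Rightarrow> bool" where
  relabel_refl: "relabel t t"
| relabel_trans: "relabel t u \<Longrightarrow> relabel u v \<Longrightarrow> relabel t v"
| relabel_ctx: "relabel t t' \<Longrightarrow> i < length ts \<Longrightarrow> relabel (App F (ts[i := t])) (App F (ts[i := t']))"
| relabel_base: "j < length ts \<Longrightarrow> k \<noteq> Suc j \<Longrightarrow> l \<in> {1..length us} \<Longrightarrow> p \<in> {1..length us} \<Longrightarrow>
    relabel (App (f, k) (ts[j := App (g, l) us])) (App (f, k) (ts[j := App (g, p) us]))"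

text \<open>Interpolates between the lists by taking the first \<open>m\<close> entries from
  \<open>ys\<close> and the others from \<open>xs\<close>. The step is assumed for arbitrary
  remaining entries, so it fits every intermediate list.\<close>

lemma list_stepwise:
  assumes len: "length xs = length ys" and refl: "R xs xs" and trans: "\<And>as bs cs. R as bs \<Longrightarrow> R bs cs \<Longrightarrow> R as cs"
    and step: "\<And>i zs. i < length xs \<Longrightarrow> length zs = length xs \<Longrightarrow> R (zs[i := xs ! i]) (zs[i := ys ! i])"
  shows "R xs ys"
proof -
  have "R xs (take m ys @ drop m xs)" if "m \<le> length xs" for m
    using that
  proof (induction m)
    case (Suc m)
    let ?z = "take m ys @ drop m xs"
    have m: "m < length xs" "length ?z = length xs" using Suc.prems len by auto
    have "?z[m := xs ! m] = ?z" using m len by (intro list_update_same_conv[THEN iffD2]) (auto simp: nth_append)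
    moreover have "?z[m := ys ! m] = take (Suc m) ys @ drop (Suc m) xs"
      using m len by (intro nth_equalityI) (auto simp: nth_append nth_list_update less_Suc_eq)
    ultimately show ?case using trans[OF Suc.IH, of "take (Suc m) ys @ drop (Suc m) xs"] step[OF m] m(1) by simp
  qed (use refl in simp)
  from this[OF order_refl] show ?thesis using len by simp
qed

lemma relabel_forget: "relabel t t' \<Longrightarrow> forget t = forget t'"
  by (induction rule: relabel.induct) (auto simp: map_update)

lemma relabel_leaves: "relabel t t' \<Longrightarrow> leaves t = leaves t'"
  using relabel_forget leaves_forget by metis

lemma relabel_well_formed: "relabel t t' \<Longrightarrow> well_formed (language2 L) t \<longleftrightarrow> well_formed (language2 L) t'"
proof (induction rule: relabel.induct)
  case (relabel_ctx t t' i ts F)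
  then show ?case by (cases F) (auto simp: well_formed_language2 all_set_conv_all_nth nth_list_update simp del: well_formed.simps)
next
  case (relabel_base j ts k l us p f g)
  then show ?case by (auto simp: well_formed_language2 all_set_conv_all_nth nth_list_update simp del: well_formed.simps)
qed auto

lemma forget_eq_Var: "forget t = Var i \<Longrightarrow> t = Var i"
  by (cases t) auto

lemma forget_eq_App: "forget t = App f us \<Longrightarrow> \<exists>k ts. t = App (f, k) ts \<and> map forget ts = us"
  by (cases t) auto

text \<open>Induction on \<open>u\<close> for all contexts at once. The outer vertex keeps its index
  \<open>k\<close> away from \<open>u\<close>, so the index of the root of \<open>u\<close> is free
  to change; that root in turn can serve as the outer vertex for each of its own branches.\<close>

lemma relabel_off_path:
  fixes L :: "'f language"
  assumes L: "language L"
  shows "well_formed (language2 L) u \<Longrightarrow> well_formed (language2 L) u' \<Longrightarrow> forget u = forget u' \<Longrightarrow>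
    j < length ts \<Longrightarrow> k \<noteq> Suc j \<Longrightarrow> relabel (App (f, k) (ts[j := u])) (App (f, k) (ts[j := u']))"
proof (induction u arbitrary: u' f k ts j)
  case (Var i)
  then have "u' = Var i" using forget_eq_Var[of u' i] by simp
  then show ?case by (simp add: relabel_refl)
next
  case (App G us)
  obtain g l where G: "G = (g, l)" by fastforce
  obtain p us' where u': "u' = App (g, p) us'" and map: "map forget us' = map forget us"
    using forget_eq_App[of u' g "map forget us"] App.prems(3) G by auto
  have len: "length us' = length us" using map by (metis length_map)
  have wf: "l \<in> {1..length us}" "length us \<ge> 2" "\<forall>t\<in>set us. well_formed (language2 L) t"
    using App.prems(1) L unfolding G well_formed_language2 by (auto simp: language_def)
  have wf': "p \<in> {1..length us}" "\<forall>t\<in>set us'. well_formed (language2 L) t"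
    using App.prems(2) len unfolding u' well_formed_language2 by auto
  let ?C = "\<lambda>z. App (f, k) (ts[j := z])"
  have "relabel (?C (App (g, p) us)) (?C (App (g, p) us'))"
  proof (rule list_stepwise[OF len[symmetric], where R = "\<lambda>a b. relabel (?C (App (g, p) a)) (?C (App (g, p) b))"])
    fix i and zs :: "('f \<times> nat) monomial list" assume i: "i < length us" and zs: "length zs = length us"
    \<comment> \<open>A temporary index for \<open>g\<close> that points away from branch
      \<open>i\<close>, whose own index is \<open>Suc i\<close>; since the arity is at least 2, one
      of 1 and 2 qualifies. The induction hypothesis is used under \<open>q\<close>, and
      \<open>p\<close> is restored afterwards.\<close>
    define q :: nat where "q = (if i = 0 then 2 else 1)"
    have q: "q \<in> {1..length us}" "q \<noteq> Suc i" using wf(2) by (auto simp: q_def)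
    have "forget (us ! i) = forget (us' ! i)" using map i len by (metis nth_map)
    then have "relabel (App (g, q) (zs[i := us ! i])) (App (g, q) (zs[i := us' ! i]))"
      using App.IH[of "us ! i" "us' ! i" i zs q g] i zs q(2) wf(3) wf'(2) len by simp
    then have "relabel (?C (App (g, q) (zs[i := us ! i]))) (?C (App (g, q) (zs[i := us' ! i])))"
      using App.prems(4) by (rule relabel_ctx)
    moreover have "relabel (?C (App (g, p) (zs[i := us ! i]))) (?C (App (g, q) (zs[i := us ! i])))"
      "relabel (?C (App (g, q) (zs[i := us' ! i]))) (?C (App (g, p) (zs[i := us' ! i])))"
      by (rule relabel_base[OF App.prems(4,5)]; use q wf'(1) zs in simp)+
    ultimately show "relabel (?C (App (g, p) (zs[i := us ! i]))) (?C (App (g, p) (zs[i := us' ! i])))"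
      by (blast intro: relabel_trans)
  qed (auto intro: relabel_refl relabel_trans)
  moreover have "relabel (?C (App (g, l) us)) (?C (App (g, p) us))"
    by (rule relabel_base[OF App.prems(4,5) wf(1) wf'(1)])
  ultimately show ?case unfolding G u' by (blast intro: relabel_trans)
qed

text \<open>Distinct variables force the two roots to carry the same index. The branch selected by
  it is treated by induction, the other branches by \<open>relabel_off_path\<close>.\<close>

lemma relabel_complete:
  fixes L :: "'f language"
  assumes L: "language L"
  shows "well_formed (language2 L) t \<Longrightarrow> well_formed (language2 L) t' \<Longrightarrow> forget t = forget t' \<Longrightarrow>
    head t = head t' \<Longrightarrow> distinct (leaves t) \<Longrightarrow> relabel t t'"
proof (induction t arbitrary: t')
  case (Var i)
  then have "t' = Var i" using forget_eq_Var[of t' i] by simp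
  then show ?case by (simp add: relabel_refl)
next
  case (App F ts)
  obtain f k where F: "F = (f, k)" by fastforce
  obtain k' ts' where t': "t' = App (f, k') ts'" and map: "map forget ts' = map forget ts"
    using forget_eq_App[of t' f "map forget ts"] App.prems(3) F by auto
  have len: "length ts' = length ts" using map by (metis length_map)
  have fg: "forget (ts ! i) = forget (ts' ! i)" if "i < length ts" for i using map that len by (metis nth_map)
  have wf: "k \<in> {1..length ts}" "\<And>i. i < length ts \<Longrightarrow> well_formed (language2 L) (ts ! i)"
    using App.prems(1) unfolding F well_formed_language2 by auto
  have wf': "k' \<in> {1..length ts}" "\<And>i. i < length ts \<Longrightarrow> well_formed (language2 L) (ts' ! i)"
    using App.prems(2) len unfolding t' well_formed_language2 by auto
  have k: "k - 1 < length ts" "k' - 1 < length ts" using wf(1) wf'(1) by auto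
  have hd: "head (ts ! (k - 1)) = head (ts' ! (k' - 1))" using App.prems(4) F t' k len by simp
  have "head (ts ! (k - 1)) \<in> set (leaves (ts ! (k - 1)))" by (rule head_in_leaves[OF wf(2)[OF k(1)]])
  \<comment> \<open>The common head lies in branch \<open>k'\<close> of \<open>t'\<close>, and this
    branch has the same variables as branch \<open>k'\<close> of \<open>t\<close>.\<close>
  moreover have "head (ts ! (k - 1)) \<in> set (leaves (ts ! (k' - 1)))"
    using head_in_leaves[OF wf'(2)[OF k(2)]] fg[OF k(2)] hd by (metis leaves_forget)
  ultimately have "k - 1 = k' - 1"
    using distinct_concat_map_unique[OF _ k] App.prems(5) by simp
  then have kk: "k' = k" using wf(1) wf'(1) by auto
  have "relabel (App (f, k) ts) (App (f, k) ts')"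
  proof (rule list_stepwise[OF len[symmetric], where R = "\<lambda>a b. relabel (App (f, k) a) (App (f, k) b)"])
    fix i and zs :: "('f \<times> nat) monomial list" assume i: "i < length ts" and zs: "length zs = length ts"
    show "relabel (App (f, k) (zs[i := ts ! i])) (App (f, k) (zs[i := ts' ! i]))"
    proof (cases "k = Suc i")
      case True
      have "distinct (leaves (ts ! i))" using distinct_concat_map_nth[of leaves ts] App.prems(5) i by simp
      then have "relabel (ts ! i) (ts' ! i)"
        using App.IH[OF nth_mem[OF i] wf(2)[OF i] wf'(2)[OF i] fg[OF i]] hd kk True by simp
      then show ?thesis using i zs by (simp add: relabel_ctx)
    next
      case False
      then show ?thesis using relabel_off_path[OF L wf(2)[OF i] wf'(2)[OF i] fg[OF i]] i zs by simp
    qed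
  qed (auto intro: relabel_refl relabel_trans)
  then show ?case using F t' kk by simp
qed

section \<open>Soundness of relabelling for ideals that contain the nested relations\<close>

subsection \<open>Relabelling is congruence modulo the defining ideal\<close>

lemma linear_map_free_diff:
  assumes "linear_map (free_module X) (free_module Y) h" "Poly_Mapping.keys p \<subseteq> X" "Poly_Mapping.keys q \<subseteq> X"
  shows "h (p - q) = h p - h q"
proof -
  have "h (p + pm_scale (-1) q) = h p + pm_scale (-1) (h q)"
    using linear_mapD(2)[OF assms(1), of p "pm_scale (-1) q"] linear_mapD(3)[OF assms(1), of q "-1"] assms(2,3)
      keys_pm_scale_subset[OF assms(3), of "-1"] by simp
  then show ?thesis by (simp add: pm_scale_minus_one)
qed

lemma upt_split: "i \<le> j \<Longrightarrow> j \<le> k \<Longrightarrow> [i..<k] = [i..<j] @ [j..<k]"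
  using upt_add_eq_append[of i j "k - j"] by simp

lemma nested_monomial_leaves:
  assumes "j \<in> {1..n}"
  shows "leaves (nested_monomial n m f k j g l) = [1..<n + m]"
proof -
  have "[1..<n + m] = [1..<j] @ [j..<j + m] @ [j + m..<n + m]"
    using upt_split[of 1 j "n + m"] upt_split[of j "j + m" "n + m"] assms by simp
  then show ?thesis by (simp add: nested_monomial_def comp_def concat_map_singleton)
qed

lemma nested_monomial_polylinear:
  assumes "f \<in> symbols L" "g \<in> symbols L" "n = arity L f" "m = arity L g" "k \<in> {1..n}" "j \<in> {1..n}" "l \<in> {1..m}"
  shows "nested_monomial n m f k j g l \<in> polylinear_monomials (language2 L) (n + m - 1)"
proof (rule polylinear_monomialsI; (unfold nested_monomial_leaves[OF assms(6)])?)
  show "well_formed (language2 L) (nested_monomial n m f k j g l)"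
    using assms by (auto simp: nested_monomial_def well_formed_language2 simp del: well_formed.simps(2))
  show "set [1..<n + m] = {1..n + m - 1}" using assms(5,7) by auto
qed simp

text \<open>As \<open>k \<noteq> j\<close>, the root selects a variable and the index of the inner
  vertex is never consulted.\<close>

lemma head_nested_monomial:
  assumes "k \<in> {1..n}" "j \<in> {1..n}" "k \<noteq> j"
  shows "head (nested_monomial n m f k j g l) = head (nested_monomial n m f k j g p)"
proof -
  have "k - 1 \<noteq> j - 1" using assms by auto
  then show ?thesis by (auto simp: nested_monomial_def nth_append nth_Cons')
qed

lemma forget_nested_monomial:
  "forget (nested_monomial n m f k j g l) = forget (nested_monomial n m f k j g p)"
  by (simp add: nested_monomial_def)

text \<open>Substitution reads the branches around and below the inner vertex from left to right.
  The list index \<open>j\<close> corresponds to the place \<open>Suc j\<close> among the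
  arguments.\<close>

lemma subst_nested_monomial:
  assumes "j < length ts" "length us = m" "length ts = n"
  shows "App (f, k) (ts[j := App (g, l) us]) =
    subst (\<lambda>i. (take j ts @ us @ drop (Suc j) ts) ! (i - 1)) (nested_monomial n m f k (Suc j) g l)"
proof -
  let ?s = "\<lambda>i. (take j ts @ us @ drop (Suc j) ts) ! (i - 1)"
  have 1: "map ?s [1..<Suc j] = take j ts"
    by (rule nth_equalityI) (use assms in \<open>auto simp: nth_append simp del: upt_Suc\<close>)
  have 2: "map ?s [Suc j..<Suc j + m] = us"
    by (rule nth_equalityI) (use assms in \<open>auto simp: nth_append simp del: upt_Suc\<close>)
  have 3: "map ?s [Suc j + m..<n + m] = drop (Suc j) ts"
    by (rule nth_equalityI) (use assms in \<open>auto simp: nth_append simp del: upt_Suc\<close>)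
  have "subst ?s (nested_monomial n m f k (Suc j) g l) =
    App (f, k) (map ?s [1..<Suc j] @ [App (g, l) (map ?s [Suc j..<Suc j + m])] @ map ?s [Suc j + m..<n + m])"
    by (simp add: nested_monomial_def comp_def del: upt_Suc)
  also have "\<dots> = App (f, k) (take j ts @ [App (g, l) us] @ drop (Suc j) ts)"
    unfolding 1 2 3 ..
  finally show ?thesis using assms(1) by (simp add: upd_conv_take_nth_drop)
qed

text \<open>Isolates the part of the defining ideal that does not refer to \<open>S\<close>: an
  ideal that contains the relations between nested monomials.\<close>

locale relabel_ideal =
  fixes L :: "'f language" and J :: "nat \<Rightarrow> (('f \<times> nat) monomial \<Rightarrow>\<^sub>0 'k::field) set"
  assumes L: "language L" and J: "operad_ideal (free_operad (language2 L)) J"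
    and nested: "\<And>f g n m k j l p. f \<in> symbols L \<Longrightarrow> g \<in> symbols L \<Longrightarrow> n = arity L f \<Longrightarrow> m = arity L g \<Longrightarrow>
      k \<in> {1..n} \<Longrightarrow> j \<in> {1..n} \<Longrightarrow> k \<noteq> j \<Longrightarrow> l \<in> {1..m} \<Longrightarrow> p \<in> {1..m} \<Longrightarrow>
      basis (nested_monomial n m f k j g l) - basis (nested_monomial n m f k j g p) \<in> J (n + m - 1)"
begin

abbreviation F2 :: "('k, ('f \<times> nat) monomial \<Rightarrow>\<^sub>0 'k) operad" where "F2 \<equiv> free_operad (language2 L)"

interpretation F2: pre_operad F2 by (rule pre_operad_free)

lemmas J_submodule = submodule_free_moduleD[OF operad_idealD(1)[OF J, unfolded free_operad_simps]]

lemma relabel_standardized: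
  assumes st: "standardization zs N ms \<gamma> \<sigma>" and wf: "\<And>z. z \<in> set zs \<Longrightarrow> well_formed (language2 L) z"
    and dist: "distinct (concat (map leaves zs))"
    and a: "a \<in> polylinear_monomials (language2 L) (length zs)"
  shows "op_args F2 ms (map basis (map (\<lambda>i. rename (\<gamma> i) (zs ! i)) [0..<length zs]))"
    and "basis (subst (\<lambda>i. zs ! (i - 1)) a) =
      op_act F2 N \<sigma> (op_comp F2 ms (basis a) (map basis (map (\<lambda>i. rename (\<gamma> i) (zs ! i)) [0..<length zs])))"
proof -
  note st' = standardizationD[OF st]
  show "op_args F2 ms (map basis (map (\<lambda>i. rename (\<gamma> i) (zs ! i)) [0..<length zs]))"
    by (rule op_argsI)
      (use st' rename_polylinear[OF wf[OF nth_mem] distinct_concat_map_nth[OF dist] st'(6)] in auto)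
  have "subst (\<lambda>i. zs ! (i - 1)) a = rename \<sigma> (monomial_comp ms a (map (\<lambda>i. rename (\<gamma> i) (zs ! i)) [0..<length zs]))"
    by (rule standardization_subst[OF st]) (use polylinear_monomialsD(3)[OF a] in auto)
  then show "basis (subst (\<lambda>i. zs ! (i - 1)) a) =
      op_act F2 N \<sigma> (op_comp F2 ms (basis a) (map basis (map (\<lambda>i. rename (\<gamma> i) (zs ! i)) [0..<length zs])))"
    by (simp only: free_operad_simps multilin_ext_basis lin_ext_basis)
qed

lemma act_comp_diff:
  assumes N: "N \<ge> 1" and s: "\<sigma> permutes {1..N}"
    and "p \<in> carrier (component F2 N)" "q \<in> carrier (component F2 N)"
  shows "op_act F2 N \<sigma> p - op_act F2 N \<sigma> q = op_act F2 N \<sigma> (p - q)"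
  using linear_map_free_diff[of _ _ "op_act F2 N \<sigma>" p q] F2.act_linear[OF N s] assms(3,4) by simp

text \<open>A branch of a polylinear monomial need not have consecutive variables. Hence the claim
  is made for every numbering \<open>\<beta>\<close> of the variables, which allows the induction to
  enter a branch.\<close>

lemma relabel_sound:
  "relabel t t' \<Longrightarrow> well_formed (language2 L) t \<Longrightarrow> distinct (leaves t) \<Longrightarrow> bij_betw \<beta> (set (leaves t)) {1..N} \<Longrightarrow>
    basis (rename \<beta> t) - basis (rename \<beta> t') \<in> J N"
proof (induction arbitrary: \<beta> N rule: relabel.induct)
  have N_pos: "N \<ge> 1" if "well_formed (language2 L) t" "bij_betw \<beta> (set (leaves t)) {1..N}"
    for \<beta> :: "nat \<Rightarrow> nat" and N and t :: "('f \<times> nat) monomial"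
  proof -
    have "set (leaves t) \<noteq> {}" using leaves_nonempty[OF language_language2[OF L] that(1)] by simp
    then have "{1..N} \<noteq> {}" using that(2) by (metis bij_betw_imp_surj_on image_is_empty)
    then show ?thesis by (cases N) auto
  qed
  {
    case (relabel_refl t)
    then show ?case using J_submodule(2)[OF N_pos] by simp
  next
    case (relabel_trans t u v)
    have N: "N \<ge> 1" using N_pos relabel_trans.prems(1,3) .
    have "basis (rename \<beta> u) - basis (rename \<beta> v) \<in> J N"
      using relabel_trans relabel_leaves[OF relabel_trans.hyps(1)] relabel_well_formed[OF relabel_trans.hyps(1)] by metis
    from J_submodule(3)[OF N relabel_trans.IH(1)[OF relabel_trans.prems] this] show ?case by simp
  next
    case (relabel_ctx t t' i ts F)
    have N: "N \<ge> 1" using N_pos relabel_ctx.prems(1,3) .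
    obtain f k where F: "F = (f, k)" by fastforce
    \<comment> \<open>The branches below the root, renamed by \<open>\<beta>\<close>. After
      standardization the root becomes a corolla, and the change sits in argument \<open>i\<close>
      of a composition.\<close>
    define zs where "zs = map (rename \<beta>) (ts[i := t])"
    define zs' where "zs' = zs[i := rename \<beta> t']"
    have i: "i < length zs" using relabel_ctx.hyps(2) by (simp add: zs_def)
    have len: "length zs = arity L f" "length zs' = length zs" and f: "F \<in> symbols (language2 L)"
      using relabel_ctx.prems(1) F unfolding F well_formed_language2 by (auto simp: zs_def zs'_def language2_def)
    have wft: "\<And>z. z \<in> set (ts[i := t]) \<Longrightarrow> well_formed (language2 L) z"
      using relabel_ctx.prems(1) by simp
    have wf: "well_formed (language2 L) z" if "z \<in> set zs" for z
      using that wft by (auto simp: zs_def intro: well_formed_rename)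
    have lv: "concat (map leaves zs) = map \<beta> (leaves (App F (ts[i := t])))"
      by (simp add: zs_def comp_def leaves_rename map_concat)
    have dist: "distinct (concat (map leaves zs))" and vars: "set (concat (map leaves zs)) = {1..N}"
      unfolding lv using relabel_ctx.prems(2,3) by (auto simp: distinct_map bij_betw_def)
    have "zs \<noteq> []" using i by auto
    obtain ms \<gamma> \<sigma> where st: "standardization zs N ms \<gamma> \<sigma>"
      using standardization_exists[OF dist leaves_nonempty[OF language_language2[OF L] wf] vars \<open>zs \<noteq> []\<close>] .
    note st' = standardizationD[OF st]
    let ?us = "map (\<lambda>i. rename (\<gamma> i) (zs ! i)) [0..<length zs]"
    let ?c = "App F (map Var [1..<length zs + 1])"
    have c: "?c \<in> polylinear_monomials (language2 L) (length zs)"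
      using corolla_polylinear[OF f] len(1) F by (simp add: language2_def del: upt_Suc)
    have args: "op_args F2 ms (map basis ?us)" by (rule relabel_standardized(1)[OF st wf dist c])
    have lt: "leaves t = leaves t'" by (rule relabel_leaves[OF relabel_ctx.hyps(1)])
    have zi: "zs ! i = rename \<beta> t" using relabel_ctx.hyps(2) by (simp add: zs_def)
    have e1: "basis (rename \<beta> (App F (ts[i := t]))) = op_act F2 N \<sigma> (op_comp F2 ms (basis ?c) (map basis ?us))"
      using relabel_standardized(2)[OF st wf dist c] App_subst[of zs "length zs" F]
      by (simp add: zs_def comp_def del: upt_Suc)
    have "App F zs' = subst (\<lambda>i. zs' ! (i - 1)) ?c" by (rule App_subst[OF len(2)])
    also have "\<dots> = rename \<sigma> (monomial_comp ms ?c (map (\<lambda>i. rename (\<gamma> i) (zs' ! i)) [0..<length zs]))"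
      by (rule standardization_subst[OF st]; (unfold leaves_corolla)?)
        (use i lt zi len(2) in \<open>auto simp: zs'_def leaves_rename nth_list_update simp del: upt_Suc\<close>)
    also have "map (\<lambda>i. rename (\<gamma> i) (zs' ! i)) [0..<length zs] = ?us[i := rename (\<gamma> i) (rename \<beta> t')]"
      by (rule nth_equalityI) (use i in \<open>auto simp: zs'_def nth_list_update\<close>)
    finally have e2: "basis (rename \<beta> (App F (ts[i := t']))) =
      op_act F2 N \<sigma> (op_comp F2 ms (basis ?c) ((map basis ?us)[i := basis (rename (\<gamma> i) (rename \<beta> t'))]))"
      by (simp only: free_operad_simps multilin_ext_basis lin_ext_basis map_update[symmetric])
        (simp add: zs'_def zs_def map_update)
    have ut: "map basis ?us = (map basis ?us)[i := basis (rename (\<gamma> i) (rename \<beta> t)) :: _ \<Rightarrow>\<^sub>0 'k]"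
      using i zi by (intro list_update_same_conv[THEN iffD2, symmetric]) auto
    \<comment> \<open>Renaming by \<open>\<beta>\<close> followed by the standard numbering of
      argument \<open>i\<close> is again a numbering of the variables of \<open>t\<close>, the one
      at which the induction hypothesis is used.\<close>
    have bij: "bij_betw (\<gamma> i \<circ> \<beta>) (set (leaves t)) {1..ms ! i}"
    proof (rule bij_betw_trans)
      show "bij_betw (\<gamma> i) (set (leaves (zs ! i))) {1..ms ! i}" by (rule st'(6)[OF i])
      have "inj_on \<beta> (set (leaves t))"
        using relabel_ctx.prems(3) relabel_ctx.hyps(2) set_update_memI[of i ts t] by (auto simp: bij_betw_def intro: inj_on_subset)
      then show "bij_betw \<beta> (set (leaves t)) (set (leaves (zs ! i)))"
        by (simp add: bij_betw_def zi leaves_rename)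
    qed
    have wt: "well_formed (language2 L) t" "distinct (leaves t)"
      using wft set_update_memI[OF relabel_ctx.hyps(2)] distinct_concat_map_nth[of leaves "ts[i := t]" i] relabel_ctx.prems(2) relabel_ctx.hyps(2)
      by auto
    have IH: "basis (rename (\<gamma> i) (rename \<beta> t)) - basis (rename (\<gamma> i) (rename \<beta> t')) \<in> J (ms ! i)"
      using relabel_ctx.IH[OF wt bij] by (simp add: subst_subst)
    have wt': "well_formed (language2 L) t'" using wt relabel_well_formed[OF relabel_ctx.hyps(1)] by simp
    have cc: "basis ?c \<in> carrier (component F2 (length ms))" using c st'(1) by (simp del: upt_Suc)
    have i': "i < length ms" using i st'(1) by simp
    have mem: "basis (rename (\<gamma> i) (rename \<beta> s)) \<in> carrier (component F2 (ms ! i))"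
      if "s = t \<or> s = t'" for s
      using rename_polylinear[of "language2 L" s "\<gamma> i \<circ> \<beta>" "ms ! i"] that wt wt' lt bij
      by (auto simp: subst_subst comp_def)
    let ?d = "basis (rename (\<gamma> i) (rename \<beta> t)) - basis (rename (\<gamma> i) (rename \<beta> t')) :: _ \<Rightarrow>\<^sub>0 'k"
    have dmem: "?d \<in> carrier (component F2 (ms ! i))" using mem[of t] mem[of t'] by (simp add: keys_diff_subset)
    \<comment> \<open>Linearity in slot \<open>i\<close> moves the difference inside the
      composition, where the ideal absorbs it.\<close>
    have "op_comp F2 ms (basis ?c) (map basis ?us) -
        op_comp F2 ms (basis ?c) ((map basis ?us)[i := basis (rename (\<gamma> i) (rename \<beta> t'))]) =
      op_comp F2 ms (basis ?c) ((map basis ?us)[i := ?d])"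
      using linear_map_free_diff[OF F2.comp_linear_right[OF st'(2) cc args i', unfolded free_operad_simps]] mem
      by (subst ut) (simp del: upt_Suc)
    moreover have "op_comp F2 ms (basis ?c) ((map basis ?us)[i := ?d]) \<in> J N"
      using operad_idealD(4)[OF J st'(2) cc op_args_update[OF args dmem] i'] IH i st'(3)
      by (simp del: upt_Suc free_operad_simps)
    ultimately have d: "op_comp F2 ms (basis ?c) (map basis ?us) -
        op_comp F2 ms (basis ?c) ((map basis ?us)[i := basis (rename (\<gamma> i) (rename \<beta> t'))]) \<in> J N"
      by (rule ssubst)
    have "op_args F2 ms ((map basis ?us)[i := basis (rename (\<gamma> i) (rename \<beta> t'))])"
      by (rule op_args_update[OF args mem]) simp
    from act_comp_diff[OF N st'(4) F2.comp_closed[OF st'(2) cc args, unfolded st'(3)]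
        F2.comp_closed[OF st'(2) cc this, unfolded st'(3)]] operad_idealD(2)[OF J N d st'(4)]
    show ?case unfolding e1 e2 by (rule ssubst)
  next
    case (relabel_base j ts k l us p f g)
    have N: "N \<ge> 1" using N_pos relabel_base.prems(1,3) .
    \<comment> \<open>The branches next to and below the inner vertex, in order. Both monomials are
      nested monomials with these arguments, so the difference now sits in the root of the
      composition.\<close>
    define ws where "ws = map (rename \<beta>) (take j ts @ us @ drop (Suc j) ts)"
    have f: "f \<in> symbols L" "k \<in> {1..arity L f}" "length ts = arity L f"
      using relabel_base.prems(1) unfolding well_formed_language2 by auto
    have wft: "\<And>z. z \<in> set (ts[j := App (g, l) us]) \<Longrightarrow> well_formed (language2 L) z"
      using relabel_base.prems(1) by simp
    then have wfg: "well_formed (language2 L) (App (g, l) us)" using set_update_memI[OF relabel_base.hyps(1)] by metis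
    then have g: "g \<in> symbols L" "length us = arity L g" unfolding well_formed_language2 by auto
    have split: "ts[j := App (g, l) us] = take j ts @ [App (g, l) us] @ drop (Suc j) ts"
      using relabel_base.hyps(1) by (simp add: upd_conv_take_nth_drop)
    have wf: "well_formed (language2 L) z" if "z \<in> set ws" for z
      using that wft wfg unfolding split by (auto simp: ws_def intro: well_formed_rename)
    have lv: "concat (map leaves ws) = map \<beta> (leaves (App (f, k) (ts[j := App (g, l) us])))"
      unfolding split by (simp add: ws_def comp_def leaves_rename map_concat)
    have dist: "distinct (concat (map leaves ws))" and vars: "set (concat (map leaves ws)) = {1..N}"
      unfolding lv using relabel_base.prems(2,3) by (auto simp: distinct_map bij_betw_def)
    have lenw: "length ws = length ts + length us - 1" using relabel_base.hyps(1) by (auto simp: ws_def)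
    have "ws \<noteq> []" using relabel_base.hyps(1,3) lenw by auto
    obtain ms \<gamma> \<sigma> where st: "standardization ws N ms \<gamma> \<sigma>"
      using standardization_exists[OF dist leaves_nonempty[OF language_language2[OF L] wf] vars \<open>ws \<noteq> []\<close>] .
    note st' = standardizationD[OF st]
    let ?n = "\<lambda>l. nested_monomial (length ts) (length us) f k (Suc j) g l"
    let ?us = "map (\<lambda>i. rename (\<gamma> i) (ws ! i)) [0..<length ws]"
    have nest: "?n q \<in> polylinear_monomials (language2 L) (length ws)" if "q \<in> {1..length us}" for q
      unfolding lenw by (rule nested_monomial_polylinear) (use f g relabel_base.hyps that in auto)
    have mem: "basis (?n q) \<in> carrier (component F2 (length ms))" if "q \<in> {1..length us}" for q
      using nest[OF that] st'(1) by simp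
    have args: "op_args F2 ms (map basis ?us)" by (rule relabel_standardized(1)[OF st wf dist nest[OF relabel_base.hyps(3)]])
    have e: "basis (rename \<beta> (App (f, k) (ts[j := App (g, q) us]))) = op_act F2 N \<sigma> (op_comp F2 ms (basis (?n q)) (map basis ?us))"
      if "q \<in> {1..length us}" for q
    proof -
      have "rename \<beta> (App (f, k) (ts[j := App (g, q) us])) =
        App (f, k) ((map (rename \<beta>) ts)[j := App (g, q) (map (rename \<beta>) us)])"
        by (simp add: map_update)
      also have "\<dots> = subst (\<lambda>i. ws ! (i - 1)) (?n q)"
        unfolding ws_def map_append take_map[symmetric] drop_map[symmetric]
        by (rule subst_nested_monomial) (use relabel_base.hyps(1) in auto)
      finally show ?thesis using relabel_standardized(2)[OF st wf dist nest[OF that]] by simp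
    qed
    have d: "basis (?n l) - basis (?n p) \<in> J (length ms)"
      using nested[OF f(1) g(1) f(3) g(2), of k "Suc j" l p] f relabel_base.hyps st'(1) lenw by simp
    have "op_comp F2 ms (basis (?n l)) (map basis ?us) - op_comp F2 ms (basis (?n p)) (map basis ?us) =
      op_comp F2 ms (basis (?n l) - basis (?n p)) (map basis ?us)"
      using linear_map_free_diff[OF F2.comp_linear_left[OF st'(2) args, unfolded free_operad_simps]]
        mem[OF relabel_base.hyps(3)] mem[OF relabel_base.hyps(4)] by simp
    moreover have "basis (?n l) - basis (?n p) \<in> carrier (component F2 (length ms))"
      using mem[OF relabel_base.hyps(3)] mem[OF relabel_base.hyps(4)] by (simp add: keys_diff_subset)
    then have "op_comp F2 ms (basis (?n l) - basis (?n p)) (map basis ?us) \<in> J N"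
      using operad_idealD(3)[OF J st'(2) _ args d] st'(3) by blast
    ultimately have d': "op_comp F2 ms (basis (?n l)) (map basis ?us) - op_comp F2 ms (basis (?n p)) (map basis ?us) \<in> J N"
      by (rule ssubst)
    from act_comp_diff[OF N st'(4) F2.comp_closed[OF st'(2) mem[OF relabel_base.hyps(3)] args, unfolded st'(3)]
        F2.comp_closed[OF st'(2) mem[OF relabel_base.hyps(4)] args, unfolded st'(3)]] operad_idealD(2)[OF J N d' st'(4)]
    show ?case unfolding e[OF relabel_base.hyps(3)] e[OF relabel_base.hyps(4)] by (rule ssubst)
  }
qed

text \<open>The form in which relabelling is used later: with the identity as numbering no renaming
  remains.\<close>

lemma same_shape_congruent:
  assumes "t \<in> polylinear_monomials (language2 L) n" "t' \<in> polylinear_monomials (language2 L) n"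
    and "forget t = forget t'" "head t = head t'"
  shows "basis t - basis t' \<in> J n"
proof -
  note t = polylinear_monomialsD[OF assms(1)] and t' = polylinear_monomialsD[OF assms(2)]
  have "relabel t t'" by (rule relabel_complete[OF L t(1) t'(1) assms(3,4) t(2)])
  from relabel_sound[OF this t(1,2), of id n] show ?thesis
    using t(3) by (simp add: subst_Var)
qed

end

section \<open>The coordinate form of a morphism tensored with Perm\<close>

section \<open>Morphisms of coordinate operads\<close>

lemma linear_map_free_diff_pointwise:
  assumes "linear_map (free_module X) (free_module Y) g" "linear_map (free_module X) (free_module Y) h"
  shows "linear_map (free_module X) (free_module Y) (\<lambda>x. g x - h x)"
  by (rule linear_mapI)
    (simp_all add: linear_mapD(1)[OF assms(1), simplified] linear_mapD(1)[OF assms(2), simplified]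
      linear_mapD(2)[OF assms(1), simplified] linear_mapD(2)[OF assms(2), simplified]
      linear_mapD(3)[OF assms(1), simplified] linear_mapD(3)[OF assms(2), simplified] keys_diff_subset pm_scale_diff_right)

text \<open>The map \<open>\<phi> \<otimes> id\<close> in coordinates.\<close>

definition coord_map :: "(nat \<Rightarrow> 'a \<Rightarrow> 'b) \<Rightarrow> nat \<Rightarrow> (nat \<Rightarrow> 'a) \<Rightarrow> nat \<Rightarrow> 'b"
  where "coord_map \<phi> n F = (\<lambda>k\<in>{1..n}. \<phi> n (F k))"

text \<open>A linear map commutes with evaluations and with finite total sums, hence with the
  formation of slots.\<close>

lemma coord_map_hom:
  assumes P: "pre_operad P" and Q: "pre_operad Q" and hom: "\<phi> \<in> operad_hom P Q"
  shows "coord_map \<phi> \<in> operad_hom (coord_operad P) (coord_operad Q)"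
proof (rule operad_homI)
  interpret P: pre_operad P by fact
  interpret Q: pre_operad Q by fact
  interpret CP: pre_operad "coord_operad P" by (rule P.pre_operad_coord)
  note D = operad_homD[OF hom]
  have lin: "linear_map (fun_module (component P n) n) (fun_module (component Q n) n) (coord_map \<phi> n)" if "n \<ge> 1" for n
    unfolding coord_map_def
    by (rule linear_map_fun_moduleI) (rule linear_map_comp[OF linear_map_eval D(1)[OF that]])
  then show "linear_map (component (coord_operad P) n) (component (coord_operad Q) n) (coord_map \<phi> n)" if "n \<ge> 1" for n
    using that by simp
  show "coord_map \<phi> n (op_act (coord_operad P) n \<sigma> F) = op_act (coord_operad Q) n \<sigma> (coord_map \<phi> n F)"
    if n: "n \<ge> 1" and F: "F \<in> carrier (component (coord_operad P) n)" and s: "\<sigma> permutes {1..n}" for n \<sigma> F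
    unfolding coord_operad_simps coord_map_def
  proof (rule restrict_ext)
    fix k assume k: "k \<in> {1..n}"
    then have k': "inv_into UNIV \<sigma> k \<in> {1..n}" using permutes_in_image[OF permutes_inv[OF s]] by blast
    have "F (inv_into UNIV \<sigma> k) \<in> carrier (component P n)" using fun_module_mem[OF _ k'] F by simp
    from D(2)[OF n this s] show "\<phi> n ((\<lambda>k\<in>{1..n}. op_act P n \<sigma> (F (inv_into UNIV \<sigma> k))) k) =
      op_act Q n \<sigma> ((\<lambda>k\<in>{1..n}. \<phi> n (F k)) (inv_into UNIV \<sigma> k))"
      unfolding restrict_apply'[OF k] restrict_apply'[OF k'] .
  qed
  show "coord_map \<phi> 1 (op_unit (coord_operad P)) = op_unit (coord_operad Q)"
    unfolding coord_operad_simps coord_map_def by (rule restrict_ext) (use D(3) in simp)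
  fix ms F Gs assume F: "F \<in> carrier (component (coord_operad P) (length ms))" and ms: "positive_arities ms"
    and Gs: "op_args (coord_operad P) ms Gs"
  note pos = positive_aritiesD[OF ms]
  have len: "length Gs = length ms" using op_argsD(1)[OF Gs] .
  let ?Hs = "map2 (coord_map \<phi>) ms Gs"
  have slots: "map2 \<phi> ms (slots P ms Gs i j) = slots Q ms ?Hs i j" if i: "i < length ms" and j: "j \<in> {1..ms ! i}" for i j
  proof (rule nth_equalityI)
    fix q assume "q < length (map2 \<phi> ms (slots P ms Gs i j))"
    then have q: "q < length ms" by simp
    have G: "Gs ! q \<in> {1..ms ! q} \<rightarrow> carrier (component P (ms ! q))"
      using op_argsD(2)[OF Gs q] by (auto simp: fun_module_simps)
    interpret N: module scalars "component Q (ms ! q)" using Q.component_module[OF pos(3)[OF q]] .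
    have H: "?Hs ! q = coord_map \<phi> (ms ! q) (Gs ! q)" using q len by simp
    have "\<phi> (ms ! q) (finsum (component P (ms ! q)) (Gs ! q) {1..ms ! q}) =
      finsum (component Q (ms ! q)) (\<lambda>l. \<phi> (ms ! q) ((Gs ! q) l)) {1..ms ! q}"
      by (rule linear_map_finsum[OF P.component_module[OF pos(3)[OF q]] Q.component_module[OF pos(3)[OF q]] D(1)[OF pos(3)[OF q]] G])
    also have "\<dots> = finsum (component Q (ms ! q)) (coord_map \<phi> (ms ! q) (Gs ! q)) {1..ms ! q}"
      by (rule N.finsum_cong') (use G linear_mapD(1)[OF D(1)[OF pos(3)[OF q]]] in \<open>auto simp: coord_map_def\<close>)
    finally have "\<phi> (ms ! q) (finsum (component P (ms ! q)) (Gs ! q) {1..ms ! q}) =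
      finsum (component Q (ms ! q)) (?Hs ! q) {1..ms ! q}" unfolding H .
    moreover have "q = i \<Longrightarrow> \<phi> (ms ! q) ((Gs ! q) j) = (?Hs ! q) j"
      unfolding H using j by (simp add: coord_map_def)
    ultimately show "map2 \<phi> ms (slots P ms Gs i j) ! q = slots Q ms ?Hs i j ! q"
      using q by (simp add: slots_def)
  qed simp
  show "coord_map \<phi> (sum_list ms) (op_comp (coord_operad P) ms F Gs) =
    op_comp (coord_operad Q) ms (coord_map \<phi> (length ms) F) ?Hs"
    unfolding coord_operad_simps coord_map_def[of _ "sum_list ms"]
  proof (rule restrict_ext)
    fix k assume k: "k \<in> {1..sum_list ms}"
    then obtain i j where ij: "i < length ms" "j \<in> {1..ms ! i}" "blk ms k = (i, j)" by (rule block_cases)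
    have i: "Suc i \<in> {1..length ms}" using ij(1) by simp
    have "F (Suc i) \<in> carrier (component P (length ms))" using fun_module_mem[OF _ i] F by simp
    from D(4)[OF this ms P.slots_args[OF ms Gs ij(1,2)]]
    show "\<phi> (sum_list ms) ((\<lambda>k\<in>{1..sum_list ms}. op_comp P ms (F (Suc (fst (blk ms k)))) (slots P ms Gs (fst (blk ms k)) (snd (blk ms k)))) k) =
      op_comp Q ms (coord_map \<phi> (length ms) F (Suc (fst (blk ms k)))) (slots Q ms ?Hs (fst (blk ms k)) (snd (blk ms k)))"
      unfolding restrict_apply'[OF k] ij(3) fst_conv snd_conv slots[OF ij(1,2)]
      unfolding coord_map_def restrict_apply'[OF i] .
  qed
qed

text \<open>Treats one representative of a tensor; the union over all representatives in
  \<open>hadamard_map\<close> is reduced to it by \<open>proj_UN\<close>.\<close>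

lemma coords_hadamard_map:
  assumes P: "pre_operad P" and Q: "pre_operad Q" and hom: "\<phi> \<in> operad_hom P Q" and n: "n \<ge> 1"
    and p: "p \<in> carrier (component (product_linearization P perm_operad) n)"
  shows "lin_ext (\<lambda>(a, c). basis (\<phi> n a, c)) p \<in> carrier (component (product_linearization Q perm_operad) n)"
    and "coords Q n (lin_ext (\<lambda>(a, c). basis (\<phi> n a, c)) p) = coord_map \<phi> n (coords P n p)"
proof -
  interpret P: pre_operad P by fact
  interpret Q: pre_operad Q by fact
  let ?f = "\<lambda>(a, c). basis (\<phi> n a, c) :: _ \<Rightarrow>\<^sub>0 'a"
  let ?X = "carrier (component P n) \<times> carrier (component (perm_operad :: ('a, nat \<Rightarrow>\<^sub>0 'a) operad) n)"
  let ?Y = "carrier (component Q n) \<times> carrier (component (perm_operad :: ('a, nat \<Rightarrow>\<^sub>0 'a) operad) n)"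
  note D = operad_homD[OF hom] linear_mapD[OF operad_homD(1)[OF hom n]]
  have lin: "linear_map (free_module ?X) (free_module ?Y) (lin_ext ?f)"
    by (rule linear_map_lin_ext) (use D(5) in auto)
  then show "lin_ext ?f p \<in> carrier (component (product_linearization Q perm_operad) n)"
    using linear_mapD(1)[OF lin, of p] p by simp
  have cP: "linear_map (free_module ?X) (fun_module (component P n) n) (coords P n)"
    using operad_homD(1)[OF coords_hom[OF P] n] by simp
  have cQ: "linear_map (free_module ?Y) (fun_module (component Q n) n) (coords Q n)"
    using operad_homD(1)[OF coords_hom[OF Q] n] by simp
  have cm: "linear_map (fun_module (component P n) n) (fun_module (component Q n) n) (coord_map \<phi> n)"
    using operad_homD(1)[OF coord_map_hom[OF P Q hom] n] by simp
  show "coords Q n (lin_ext ?f p) = coord_map \<phi> n (coords P n p)"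
  proof (rule linear_map_eq_on_basis[OF vspace_fun_module[OF Q.component_module[OF n]] linear_map_comp[OF lin cQ] linear_map_comp[OF cP cm]])
    show "Poly_Mapping.keys p \<subseteq> ?X" using p by simp
    fix x assume "x \<in> ?X"
    then obtain a v where x: "x = (a, v)" and a: "a \<in> carrier (component P n)" by auto
    have "coords Q n (basis (\<phi> n a, v)) = tensor_coords (component Q n) n (\<phi> n a, v)"
      unfolding coords_def by (rule lext_tensor_coords_basis[OF Q.component_module[OF n] D(5)[OF a]])
    moreover have "coords P n (basis (a, v)) = tensor_coords (component P n) n (a, v)"
      unfolding coords_def by (rule lext_tensor_coords_basis[OF P.component_module[OF n] a])
    ultimately show "coords Q n (lin_ext ?f (basis x)) = coord_map \<phi> n (coords P n (basis x))"
      unfolding x lin_ext_basis prod.case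
      by (auto simp: tensor_coords_def coord_map_def D(7)[OF a] intro!: restrict_ext)
  qed
qed

section \<open>Coordinate descriptions of zeta, rho and the morphism to di P\<close>

section \<open>The morphisms zeta and rho\<close>

text \<open>The map \<open>rho\<close> restricted to tensors whose second factor is the basis
  element of index \<open>k\<close>.\<close>

definition emph :: "nat \<Rightarrow> ('f monomial \<Rightarrow>\<^sub>0 'k::field) \<Rightarrow> (('f \<times> nat) monomial \<Rightarrow>\<^sub>0 'k)"
  where "emph k = lin_ext (\<lambda>t. basis (emphasize k t))"

lemma lin_ext_fun_add: "lin_ext (\<lambda>x. f x + g x) p = lin_ext f p + lin_ext g p"
  by (simp add: lin_ext_def pm_scale_add_right sum.distrib)

lemma lin_ext_fun_scale: "lin_ext (\<lambda>x. pm_scale c (f x)) p = pm_scale c (lin_ext f p)"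
  by (simp add: lin_ext_def pm_scale_sum mult.commute)

text \<open>The formula behind \<open>rho\<close> is bilinear and thus kills the tensor relations.
  Its image of a coset is a singleton, so \<open>the_elem\<close> returns the value at the obvious
  representative.\<close>

lemma rho_pure_tensor:
  fixes s :: "'f monomial \<Rightarrow>\<^sub>0 'k::field"
  assumes s: "s \<in> carrier (component (free_operad L) n)" and k: "k \<in> {1..n}"
  shows "rho (pure_tensor (free_operad L) perm_operad n s (basis k)) = emph k s"
proof -
  let ?F = "component (free_operad L) n :: ('k, 'f monomial \<Rightarrow>\<^sub>0 'k) module"
  let ?V = "component perm_operad n :: ('k, nat \<Rightarrow>\<^sub>0 'k) module"
  let ?T = "tensor_relations ?F ?V"
  define R :: "(('f monomial \<Rightarrow>\<^sub>0 'k) \<times> (nat \<Rightarrow>\<^sub>0 'k) \<Rightarrow>\<^sub>0 'k) \<Rightarrow> (('f \<times> nat) monomial \<Rightarrow>\<^sub>0 'k)"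
    where "R = lin_ext (\<lambda>(a, v). lin_ext (\<lambda>t. lin_ext (\<lambda>k. basis (emphasize k t)) v) a)"
  have Rb: "R (basis (a, v)) = lin_ext (\<lambda>t. lin_ext (\<lambda>k. basis (emphasize k t)) v) a" for a v
    by (simp add: R_def)
  have F: "vspace ?F" and V: "vspace ?V" by (simp_all add: vspace_free_module)
  \<comment> \<open>The target is the span of all monomials, since \<open>rho\<close> is one formula
    for all arities.\<close>
  have lin: "linear_map (free_module (carrier ?F \<times> carrier ?V)) (free_module UNIV) R"
    unfolding R_def by (rule linear_map_lin_ext) auto
  have ker: "R h = 0" if "h \<in> ?T" for h
  proof -
    have "R h = \<zero>\<^bsub>free_module UNIV :: ('k, _) module\<^esub>"
      by (rule tensor_relations_kernel[OF F V vspace_free_module lin _ _ _ _ that])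
        (simp_all add: Rb lin_ext_add lin_ext_scale lin_ext_fun_add lin_ext_fun_scale)
    then show ?thesis by simp
  qed
  have X: "pure_tensor (free_operad L) perm_operad n s (basis k) = (\<Union>h\<in>?T. {h + basis (s, basis k)})"
    by (simp add: pure_tensor_def quotient_map_def a_r_coset_def' hadamard_relations_def)
  have zero: "0 \<in> ?T" using submodule_free_moduleD(2)[OF submodule_tensor_relations[OF F V]] .
  have eq: "R (h + basis (s, basis k)) = emph k s" if "h \<in> ?T" for h
  proof -
    have "R (h + basis (s, basis k)) = R h + R (basis (s, basis k))" by (simp add: R_def lin_ext_add)
    then show ?thesis using ker[OF that] by (simp add: Rb emph_def)
  qed
  have "R ` (\<Union>h\<in>?T. {h + basis (s, basis k)}) = {emph k s}"
  proof (intro equalityI subsetI)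
    show "y \<in> {emph k s}" if "y \<in> R ` (\<Union>h\<in>?T. {h + basis (s, basis k)})" for y
      using that eq by auto
    show "y \<in> R ` (\<Union>h\<in>?T. {h + basis (s, basis k)})" if "y \<in> {emph k s}" for y
      by (rule image_eqI[of _ _ "0 + basis (s, basis k)"]) (use that eq[OF zero] zero in \<open>simp, blast\<close>)
  qed
  then show ?thesis unfolding rho_def X R_def by simp
qed

lemma keys_emph:
  "language L \<Longrightarrow> Poly_Mapping.keys s \<subseteq> polylinear_monomials L n \<Longrightarrow>
    Poly_Mapping.keys (emph k s) \<subseteq> polylinear_monomials (language2 L) n"
  unfolding emph_def by (rule keys_lin_ext[where X = "polylinear_monomials L n"]) (auto intro: emphasize_polylinear)

lemma linear_map_emph:
  "language L \<Longrightarrow> linear_map (free_module (polylinear_monomials L n)) (free_module (polylinear_monomials (language2 L) n)) (emph k)"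
  unfolding emph_def by (rule linear_map_lin_ext) (auto intro: emphasize_polylinear)

lemma linear_map_delta_fun:
  assumes "vspace M"
  shows "linear_map M (fun_module M n) (delta_fun M n k)"
  unfolding delta_fun_def
proof (rule linear_map_fun_moduleI)
  interpret module scalars M by fact
  show "linear_map M M (\<lambda>x. if l = k then x else \<zero>\<^bsub>M\<^esub>)" for l
    by (rule linear_mapI) auto
qed

text \<open>Says that \<open>rho\<close> is a section of \<open>zeta\<close>: the emphasized leaf
  becomes the head, and forgetting the indices restores the monomial.\<close>

lemma psi_emph:
  fixes s :: "'f monomial \<Rightarrow>\<^sub>0 'k::field"
  assumes L: "language L" and s: "Poly_Mapping.keys s \<subseteq> polylinear_monomials L n" and k: "k \<in> {1..n}"
  shows "psi L n (emph k s) = delta_fun (free_module (polylinear_monomials L n)) n k s"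
proof (rule linear_map_eq_on_basis[OF vspace_fun_module[OF vspace_free_module]
    linear_map_comp[OF linear_map_emph[OF L] linear_map_psi] linear_map_delta_fun[OF vspace_free_module] _ s])
  fix t assume t: "t \<in> polylinear_monomials L n"
  have "head (emphasize k t) = k" by (rule head_emphasize) (use polylinear_monomialsD(3)[OF t] k in simp)
  then show "psi L n (emph k (basis t :: _ \<Rightarrow>\<^sub>0 'k)) = delta_fun (free_module (polylinear_monomials L n)) n k (basis t)"
    by (simp add: emph_def psi_basis[OF emphasize_polylinear[OF L t]])
qed

text \<open>\<open>psi\<close> followed by the inverse of the coordinate isomorphism takes the
  prescribed values, so the choice in \<open>free_morphism\<close> has a candidate. Uniqueness,
  applied after passing to coordinates, identifies the chosen morphism with
  \<open>psi\<close>.\<close>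

lemma zeta_coords:
  fixes L :: "'f language"
  assumes L: "language L"
  defines "Z \<equiv> zeta L :: nat \<Rightarrow> (('f \<times> nat) monomial \<Rightarrow>\<^sub>0 'k::field) \<Rightarrow> _"
  shows "Z \<in> operad_hom (free_operad (language2 L)) (di (free_operad L))"
    and "n \<ge> 1 \<Longrightarrow> x \<in> carrier (component (free_operad (language2 L)) n) \<Longrightarrow>
      operad_quotient.induced (coords (free_operad L)) n (Z n x) = psi L n x"
proof -
  let ?F = "free_operad L :: ('k, 'f monomial \<Rightarrow>\<^sub>0 'k) operad"
  let ?F2 = "free_operad (language2 L) :: ('k, ('f \<times> nat) monomial \<Rightarrow>\<^sub>0 'k) operad"
  interpret F: pre_operad ?F by (rule pre_operad_free)
  interpret Q: operad_quotient "product_linearization ?F perm_operad" "coord_operad ?F" "coords ?F" "hadamard_relations ?F perm_operad"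
    by (rule di_quotient) (rule F.pre_operad_axioms)
  define img :: "'f \<times> nat \<Rightarrow> _"
    where "img = (\<lambda>(f, k). pure_tensor ?F perm_operad (arity L f) (generator L f) (basis k))"
  let ?inv = "\<lambda>n. inv_into (carrier (component (di ?F) n)) (Q.induced n)"
  let ?good = "\<lambda>\<phi>. \<phi> \<in> operad_hom ?F2 (di ?F) \<and>
    (\<forall>f\<in>symbols (language2 L). \<phi> (arity (language2 L) f) (generator (language2 L) f) = img f)"
  have di: "di ?F = Q.quot" by (simp add: hadamard_def)
  have iso: "Q.induced \<in> operad_iso (di ?F) (coord_operad ?F)" unfolding di by (rule Q.induced_iso)
  have inv: "?inv \<in> operad_hom (coord_operad ?F) (di ?F)"
    using operad_iso_inverse[OF iso] Q.closed_operations_quot by (simp add: di operad_iso_def)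
  have ar: "arity L f \<ge> 1" if "f \<in> symbols L" for f using L that by (auto simp: language_def)
  have gen: "img (f, k) \<in> carrier (component (di ?F) (arity L f)) \<and>
      Q.induced (arity L f) (img (f, k)) = psi L (arity L f) (generator (language2 L) (f, k))"
    if f: "f \<in> symbols L" and k: "k \<in> {1..arity L f}" for f k
  proof -
    let ?n = "arity L f"
    have g: "generator L f \<in> carrier (component ?F ?n)"
      using corolla_polylinear[OF f] by (simp add: generator_def del: upt_Suc)
    then have b: "basis (generator L f, basis k) \<in> carrier (component (product_linearization ?F perm_operad) ?n)"
      using k by simp
    have fk: "(f, k) \<in> symbols (language2 L)" "arity (language2 L) (f, k) = ?n" using f k by (auto simp: language2_def)
    have c2: "App (f, k) (map Var [1..<?n + 1]) \<in> polylinear_monomials (language2 L) ?n"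
      using corolla_polylinear[OF fk(1)] fk(2) by simp
    have img: "img (f, k) = Q.proj ?n (basis (generator L f, basis k))"
      by (simp add: img_def pure_tensor_def)
    have "Q.induced ?n (img (f, k)) = coords ?F ?n (basis (generator L f, basis k))"
      unfolding img by (rule Q.induced_proj[OF ar[OF f] b])
    also have "\<dots> = tensor_coords (component ?F ?n) ?n (generator L f, basis k)"
      unfolding coords_def by (rule lext_tensor_coords_basis[OF F.component_module[OF ar[OF f]] g])
    also have "\<dots> = delta_fun (component ?F ?n) ?n k (generator L f)"
      by (rule tensor_coords_basis[OF F.component_module[OF ar[OF f]] g])
    also have "\<dots> = psi L ?n (generator (language2 L) (f, k))"
    proof -
      have "map head (map Var [1..<?n + 1]) ! (k - 1) = k"
        using k by (simp add: comp_def del: upt_Suc)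
      then have "head (App (f, k) (map Var [1..<?n + 1])) = k" by simp
      moreover have "forget (App (f, k) (map Var [1..<?n + 1])) = App f (map Var [1..<?n + 1])"
        by (simp add: comp_def del: upt_Suc)
      moreover have "psi L ?n (basis (App (f, k) (map Var [1..<?n + 1])) :: _ \<Rightarrow>\<^sub>0 'k) =
        delta_fun (free_module (polylinear_monomials L ?n)) ?n (head (App (f, k) (map Var [1..<?n + 1])))
          (basis (forget (App (f, k) (map Var [1..<?n + 1]))))"
        by (rule psi_basis[OF c2])
      ultimately show ?thesis unfolding generator_def fk(2) free_operad_simps by (simp only:)
    qed
    finally show ?thesis using b unfolding img di Q.quot_carrier by blast
  qed
  \<comment> \<open>On a generator with index \<open>k\<close> both routes give the delta function
    at \<open>k\<close>, and injectivity of the coordinates recovers the prescribed tensor.\<close>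
  have "?good (\<lambda>n x. ?inv n (psi L n x))"
  proof (intro conjI ballI)
    show "(\<lambda>n x. ?inv n (psi L n x)) \<in> operad_hom ?F2 (di ?F)"
      by (rule operad_hom_comp[OF psi_hom inv])
    fix F assume "F \<in> symbols (language2 L)"
    then obtain f k where F: "F = (f, k)" "f \<in> symbols L" "k \<in> {1..arity L f}" "arity (language2 L) F = arity L f"
      by (auto simp: language2_def)
    have "inj_on (Q.induced (arity L f)) (carrier (component (di ?F) (arity L f)))"
      using iso ar[OF F(2)] by (auto simp: operad_iso_def bij_betw_def)
    from inv_into_f_f[OF this gen[OF F(2,3), THEN conjunct1]] gen[OF F(2,3)]
    show "?inv (arity (language2 L) F) (psi L (arity (language2 L) F) (generator (language2 L) F)) = img F"
      unfolding F(4) unfolding F(1) by simp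
  qed
  \<comment> \<open>Existence makes the chosen morphism satisfy its specification.\<close>
  then have good: "?good Z"
    unfolding Z_def zeta_def free_morphism_def img_def[symmetric] by (rule someI[where P = ?good])
  then show Z: "Z \<in> operad_hom ?F2 (di ?F)" by simp
  have ind: "(\<lambda>n x. Q.induced n (Z n x)) \<in> operad_hom ?F2 (coord_operad ?F)"
    by (rule operad_hom_comp[OF Z]) (use iso in \<open>simp add: operad_iso_def\<close>)
  show "Q.induced n (Z n x) = psi L n x" if "n \<ge> 1" "x \<in> carrier (component ?F2 n)" for n x
  proof (rule free_operad_hom_unique[OF language_language2[OF L] F.pre_operad_coord ind psi_hom _ that])
    fix F assume "F \<in> symbols (language2 L)"
    then obtain f k where F: "F = (f, k)" "f \<in> symbols L" "k \<in> {1..arity L f}" "arity (language2 L) F = arity L f"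
      by (auto simp: language2_def)
    have "Z (arity (language2 L) F) (generator (language2 L) F) = img F"
      using good \<open>F \<in> symbols (language2 L)\<close> by blast
    then show "Q.induced (arity (language2 L) F) (Z (arity (language2 L) F) (generator (language2 L) F)) =
      psi L (arity (language2 L) F) (generator (language2 L) F)"
      using gen[OF F(2,3)] unfolding F(4) unfolding F(1) by simp
  qed
qed

text \<open>A representative of \<open>zeta L n x\<close> has coordinates \<open>psi L n x\<close>,
  and the choice of the representative does not affect the value in \<open>di P\<close>. Vanishing
  there is tested on coordinates.\<close>

lemma pi2_coords:
  fixes L :: "'f language" and P :: "('k::field, 'a) operad"
  assumes L: "language L" and P: "pre_operad P" and pi: "\<pi> \<in> operad_hom (free_operad L) P"
    and n: "n \<ge> 1" and x: "x \<in> carrier (component (free_operad (language2 L)) n)"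
  shows "pi2 L P \<pi> n x = \<zero>\<^bsub>component (di P) n\<^esub> \<longleftrightarrow>
    coord_map \<pi> n (psi L n x) = \<zero>\<^bsub>component (coord_operad P) n\<^esub>"
proof -
  let ?F = "free_operad L :: ('k, 'f monomial \<Rightarrow>\<^sub>0 'k) operad"
  interpret F: pre_operad ?F by (rule pre_operad_free)
  interpret P: pre_operad P by fact
  interpret QF: operad_quotient "product_linearization ?F perm_operad" "coord_operad ?F" "coords ?F" "hadamard_relations ?F perm_operad"
    by (rule di_quotient) (rule F.pre_operad_axioms)
  interpret QP: operad_quotient "product_linearization P perm_operad" "coord_operad P" "coords P" "hadamard_relations P perm_operad"
    by (rule di_quotient[OF P])
  have "zeta L n x \<in> carrier (component QF.quot n)"
    using linear_mapD(1)[OF operad_homD(1)[OF zeta_coords(1)[OF L] n] x] by (simp add: hadamard_def)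
  then obtain p where p: "p \<in> carrier (component (product_linearization ?F perm_operad) n)" "zeta L n x = QF.proj n p"
    unfolding QF.quot_carrier by blast
  have cp: "coords ?F n p = psi L n x"
    using zeta_coords(2)[OF L n x] QF.induced_proj[OF n p(1)] p(2) by simp
  let ?h = "lin_ext (\<lambda>(a, c). basis (\<pi> n a, c))"
  note hp = coords_hadamard_map[OF F.pre_operad_axioms P pi n]
  have "pi2 L P \<pi> n x = (\<Union>q\<in>QF.proj n p. QP.proj n (?h q))"
    by (simp add: pi2_def hadamard_map_def p(2))
  also have "\<dots> = QP.proj n (?h p)"
  proof (rule QP.proj_UN[OF n hp(1)[OF p(1)]])
    show "QF.proj n p \<noteq> {}" using QF.proj_self[OF n p(1)] by blast
    fix q assume "q \<in> QF.proj n p"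
    then have q: "q \<in> carrier (component (product_linearization ?F perm_operad) n)" "coords ?F n q = coords ?F n p"
      using QF.proj_eq[OF n p(1)] by auto
    show "?h q \<in> carrier (component (product_linearization P perm_operad) n) \<and> coords P n (?h q) = coords P n (?h p)"
      using hp(1)[OF q(1)] hp(2)[OF q(1)] hp(2)[OF p(1)] q(2) by simp
  qed
  finally show ?thesis
    using QP.proj_zero_iff[OF n hp(1)[OF p(1)]] hp(2)[OF p(1)] cp by (simp add: hadamard_def)
qed

section \<open>Equality of the defining ideal with the kernel in coordinates\<close>

section \<open>The kernel of the morphism to coordinates\<close>

lemma polylinear_disjoint: "t \<in> polylinear_monomials L n \<Longrightarrow> t \<in> polylinear_monomials L m \<Longrightarrow> n = m"
  by (metis polylinear_monomialsD(4))

text \<open>The number of leaves recovers the arity of a monomial. A generating set does not record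
  arities, and this settles elements that occur in two components.\<close>

lemma free_carriers_disjoint:
  assumes "p \<in> carrier (component (free_operad L) n)" "p \<in> carrier (component (free_operad L) m)" "n \<noteq> m"
  shows "p = 0"
proof -
  have "Poly_Mapping.keys p = {}" using assms polylinear_disjoint by fastforce
  then show ?thesis by simp
qed

text \<open>Stated for the explicit morphism to coordinates, so that neither the choice behind
  \<open>zeta\<close> nor the cosets of \<open>di P\<close> enter the argument.\<close>

lemma J_ideal_eq_kernel:
  fixes L :: "'f language" and P :: "('k::field, 'a) operad"
  assumes L: "language L" and P: "pre_operad P" and pi: "\<pi> \<in> operad_hom (free_operad L) P"
    and S: "\<forall>n\<ge>1. operad_kernel (free_operad L) P \<pi> n = generated_ideal (free_operad L) S n"
    and n: "n \<ge> 1"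
  shows "J_ideal L S n = operad_kernel (free_operad (language2 L)) (coord_operad P) (\<lambda>n x. coord_map \<pi> n (psi L n x)) n"
proof -
  let ?F = "free_operad L :: ('k, 'f monomial \<Rightarrow>\<^sub>0 'k) operad"
  let ?F2 = "free_operad (language2 L) :: ('k, ('f \<times> nat) monomial \<Rightarrow>\<^sub>0 'k) operad"
  let ?\<Psi> = "\<lambda>n x. coord_map \<pi> n (psi L n x)"
  let ?K = "operad_kernel ?F2 (coord_operad P) ?\<Psi>"
  let ?J = "J_ideal L S"
  interpret F: pre_operad ?F by (rule pre_operad_free)
  interpret F2: pre_operad ?F2 by (rule pre_operad_free)
  interpret P: pre_operad P by fact
  interpret CP: pre_operad "coord_operad P" by (rule P.pre_operad_coord)
  have Psi: "?\<Psi> \<in> operad_hom ?F2 (coord_operad P)"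
    by (rule operad_hom_comp[OF psi_hom coord_map_hom[OF F.pre_operad_axioms P pi]])
  have psi_carrier: "psi L n x \<in> carrier (fun_module (component ?F n) n)" if "x \<in> carrier (component ?F2 n)" for n x
    using linear_mapD(1)[OF linear_map_psi] that by simp
  \<comment> \<open>Vanishing in the coordinate operad is coordinatewise, so the kernel condition
    splits into one condition for each leaf.\<close>
  have K_iff: "x \<in> ?K n \<longleftrightarrow> x \<in> carrier (component ?F2 n) \<and> (\<forall>k\<in>{1..n}. psi L n x k \<in> operad_kernel ?F P \<pi> n)"
    if "n \<ge> 1" for n x
  proof -
    have "coord_map \<pi> n G = \<zero>\<^bsub>component (coord_operad P) n\<^esub> \<longleftrightarrow> (\<forall>k\<in>{1..n}. \<pi> n (G k) = \<zero>\<^bsub>component P n\<^esub>)" for G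
      by (auto simp: coord_map_def fun_module_simps restrict_def fun_eq_iff)
    moreover have "psi L n x k \<in> carrier (component ?F n)" if "x \<in> carrier (component ?F2 n)" "k \<in> {1..n}" for k
      by (rule fun_module_mem[OF psi_carrier[OF that(1)] that(2)])
    ultimately show ?thesis unfolding operad_kernel_iff by blast
  qed
  have J: "operad_ideal ?F2 ?J" unfolding J_ideal_def by (rule operad_ideal_generated[OF F2.pre_operad_axioms])
  note J_sub = submodule_free_moduleD[OF operad_idealD(1)[OF J, unfolded free_operad_simps]]

  \<comment> \<open>The two nested monomials have the same head and the same underlying monomial,
    hence the same coordinates.\<close>
  have gen1: "basis (nested_monomial n m f k j g l) - basis (nested_monomial n m f k j g p) \<in> carrier (component ?F2 (n + m - 1))
      \<and> psi L (n + m - 1) (basis (nested_monomial n m f k j g l) - basis (nested_monomial n m f k j g p)) =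
        \<zero>\<^bsub>fun_module (component ?F (n + m - 1)) (n + m - 1)\<^esub>"
    if "f \<in> symbols L" "g \<in> symbols L" "n = arity L f" "m = arity L g" "k \<in> {1..n}" "j \<in> {1..n}" "k \<noteq> j"
      "l \<in> {1..m}" "p \<in> {1..m}" for f g n m k j l p
  proof -
    note in1 = nested_monomial_polylinear[OF that(1-6,8)] and in2 = nested_monomial_polylinear[OF that(1-6,9)]
    have "psi L (n + m - 1) (basis (nested_monomial n m f k j g l)) = psi L (n + m - 1) (basis (nested_monomial n m f k j g p) :: _ \<Rightarrow>\<^sub>0 'k)"
      unfolding psi_basis[OF in1] psi_basis[OF in2] head_nested_monomial[OF that(5-7), of m f g l p]
        forget_nested_monomial[of n m f k j g l p] ..
    then show ?thesis
      using linear_map_diff_eq_zero_iff[OF vspace_fun_module[OF vspace_free_module] linear_map_psi,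
          of "basis (nested_monomial n m f k j g l)" L "n + m - 1" "basis (nested_monomial n m f k j g p) :: _ \<Rightarrow>\<^sub>0 'k"] in1 in2
      by (simp add: keys_diff_subset)
  qed
  interpret R: relabel_ideal L ?J
  proof
    fix f g n m k j l p assume a: "f \<in> symbols L" "g \<in> symbols L" "n = arity L f" "m = arity L g" "k \<in> {1..n}" "j \<in> {1..n}" "k \<noteq> j"
      "l \<in> {1..m}" "p \<in> {1..m}"
    have "n + m - 1 \<ge> 1" using a(5,8) by auto
    moreover have "basis (nested_monomial n m f k j g l) - basis (nested_monomial n m f k j g p) \<in> J_generators L S"
      unfolding J_generators_def using a by blast
    ultimately show "basis (nested_monomial n m f k j g l) - basis (nested_monomial n m f k j g p) \<in> ?J (n + m - 1)"
      unfolding J_ideal_def by (rule generated_ideal_superset) (use gen1[OF a] in blast)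
  qed (fact L J)+

  \<comment> \<open>Coordinate \<open>k\<close> of \<open>emph k s\<close> is \<open>s\<close>, and
    all others vanish.\<close>
  have gen2: "emph k s \<in> ?K n" if "n \<ge> 1" "s \<in> S \<inter> carrier (component ?F n)" "k \<in> {1..n}" for n s k
  proof -
    have s: "Poly_Mapping.keys s \<subseteq> polylinear_monomials L n" using that(2) by simp
    interpret M: module scalars "component ?F n" by (rule F.component_module[OF that(1)])
    have "s \<in> operad_kernel ?F P \<pi> n"
      using generated_ideal_superset[OF that(1), of s S ?F] that(2) S that(1) by blast
    moreover have "0 \<in> operad_kernel ?F P \<pi> n"
      using vspace_submoduleD(2)[OF F.component_module[OF that(1)] operad_idealD(1)[OF operad_ideal_kernel[OF F.pre_operad_axioms P pi] that(1)]]
      by simp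
    ultimately show ?thesis
      unfolding K_iff[OF that(1)] psi_emph[OF L s that(3)] using keys_emph[OF L s] by (simp add: delta_fun_def)
  qed
  have "?J n \<subseteq> ?K n"
    unfolding J_ideal_def
  proof (rule generated_ideal_least[OF operad_ideal_kernel[OF F2.pre_operad_axioms CP.pre_operad_axioms Psi]])
    fix m :: nat assume m: "m \<ge> 1"
    have zero: "0 \<in> ?K m"
      using vspace_submoduleD(2)[OF F2.component_module[OF m] operad_idealD(1)[OF operad_ideal_kernel[OF F2.pre_operad_axioms CP.pre_operad_axioms Psi] m]]
      by simp
    \<comment> \<open>A generator is intersected with every component. In a component other than its
      own it can only be 0, which lies in each kernel.\<close>
    have move: "x \<in> ?K m" if "x \<in> ?K n" "x \<in> carrier (component ?F2 m)" for x n
    proof (cases "n = m")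
      case False
      have "x = 0" by (rule free_carriers_disjoint[OF _ that(2) False]) (use that(1) in \<open>simp add: operad_kernel_iff\<close>)
      then show ?thesis using zero by simp
    qed (use that in simp)
    show "J_generators L S \<inter> carrier (component ?F2 m) \<subseteq> ?K m"
    proof
      fix x assume x: "x \<in> J_generators L S \<inter> carrier (component ?F2 m)"
      have "\<exists>n. x \<in> ?K n"
      proof -
        from x consider
          (nested) n m f k j g l p where "x = basis (nested_monomial n m f k j g l) - basis (nested_monomial n m f k j g p)"
            "f \<in> symbols L" "g \<in> symbols L" "n = arity L f" "m = arity L g" "k \<in> {1..n}" "j \<in> {1..n}" "k \<noteq> j"
            "l \<in> {1..m}" "p \<in> {1..m}"
          | (rho) n s k where "x = rho (pure_tensor ?F perm_operad n s (basis k))" "n \<ge> 1" "s \<in> S \<inter> carrier (component ?F n)" "k \<in> {1..n}"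
          unfolding J_generators_def by blast
        then show ?thesis
        proof cases
          case nested
          have N: "n + m - 1 \<ge> 1" using nested(6,9) by auto
          note g = gen1[OF nested(2-)]
          have "coord_map \<pi> (n + m - 1) \<zero>\<^bsub>fun_module (component ?F (n + m - 1)) (n + m - 1)\<^esub> = \<zero>\<^bsub>component (coord_operad P) (n + m - 1)\<^esub>"
            using linear_map_zero[OF vspace_fun_module[OF F.component_module[OF N]] CP.component_module[OF N]]
              operad_homD(1)[OF coord_map_hom[OF F.pre_operad_axioms P pi] N] by simp
          then have "x \<in> ?K (n + m - 1)" using g unfolding nested(1) operad_kernel_iff by simp
          then show ?thesis ..
        next
          case rho
          have "x = emph k s" using rho rho_pure_tensor[of s L n k] by simp
          then show ?thesis using gen2[OF rho(2-4)] by blast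
        qed
      qed
      then show "x \<in> ?K m" using move x by blast
    qed
  qed
  moreover have "?K n \<subseteq> ?J n"
  proof -
    \<comment> \<open>All leaves are required at once because the action permutes them, and a
      composition emphasizes different leaves in its parts.\<close>
    define I where "I n = {a \<in> carrier (component ?F n). \<forall>k\<in>{1..n}. emph k a \<in> ?J n}" for n
    have I: "operad_ideal ?F I"
    proof (rule operad_idealI)
      fix n :: nat assume n: "n \<ge> 1"
      show "submodule (I n) scalars (component ?F n)"
        by (rule vspace_submoduleI[OF F.component_module[OF n]])
          (use J_sub(2-4)[OF n] in \<open>auto simp: I_def emph_def lin_ext_add lin_ext_scale keys_plus_subset[THEN subsetD] keys_pm_scale_subset[THEN subsetD]\<close>)
      fix \<sigma> a assume a: "a \<in> I n" and s: "\<sigma> permutes {1..n}"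
      have a': "Poly_Mapping.keys a \<subseteq> polylinear_monomials L n" using a by (simp add: I_def)
      show "op_act ?F n \<sigma> a \<in> I n"
        unfolding I_def
      proof (intro CollectI conjI ballI)
        show "op_act ?F n \<sigma> a \<in> carrier (component ?F n)" using F.act_closed[OF n s, of a] a' by simp
        fix k assume k: "k \<in> {1..n}"
        \<comment> \<open>The leaf that \<open>\<sigma>\<close> moves to \<open>k\<close>;
          emphasizing it before the action or \<open>k\<close> after it gives monomials of the same
          shape and head.\<close>
        define k' where "k' = inv_into UNIV \<sigma> k"
        have k': "k' \<in> {1..n}" "\<sigma> k' = k"
          using permutes_in_image[OF permutes_inv[OF s]] k permutes_inverses[OF s] by (auto simp: k'_def)
        have "emph k (op_act ?F n \<sigma> a) - op_act ?F2 n \<sigma> (emph k' a) \<in> ?J n"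
          using a'
        proof (induction rule: free_module_induct)
          case zero
          then show ?case using J_sub(2)[OF n] by (simp add: emph_def)
        next
          case (basis t)
          note t = polylinear_monomialsD[OF basis]
          have r: "rename \<sigma> t \<in> polylinear_monomials L n" using set_operad.set_act[OF set_operad_free n s basis] .
          note e = emphasize_polylinear[OF L r, of k] and e' = emphasize_polylinear[OF L basis, of k']
          have "head (emphasize k (rename \<sigma> t)) = k"
            by (rule head_emphasize) (use polylinear_monomialsD(3)[OF r] k in simp)
          moreover have "head (emphasize k' t) = k'" by (rule head_emphasize) (use t(3) k' in simp)
          ultimately have "basis (emphasize k (rename \<sigma> t)) - basis (rename \<sigma> (emphasize k' t)) \<in> ?J n"
            using set_operad.set_act[OF set_operad_free n s e'] e k'(2)
            by (intro R.same_shape_congruent) (simp_all add: forget_subst head_subst[OF polylinear_monomialsD(1)[OF e']])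
          then show ?case by (simp add: emph_def)
        next
          case (add p q)
          from J_sub(3)[OF n add(3,4)] show ?case by (simp add: emph_def lin_ext_add algebra_simps)
        next
          case (scale c p)
          from J_sub(4)[OF n scale(2), of c] show ?case by (simp add: emph_def lin_ext_scale pm_scale_diff_right)
        qed
        moreover have "op_act ?F2 n \<sigma> (emph k' a) \<in> ?J n"
          using operad_idealD(2)[OF J n _ s] a k'(1) by (simp add: I_def)
        ultimately show "emph k (op_act ?F n \<sigma> a) \<in> ?J n" using J_sub(3)[OF n] by fastforce
      qed
    next
      fix ms a bs assume ms: "positive_arities ms" and a: "a \<in> carrier (component ?F (length ms))" and bs: "op_args ?F ms bs"
        and ker: "a \<in> I (length ms) \<or> (\<exists>i<length ms. bs ! i \<in> I (ms ! i))"
      note pos = positive_aritiesD[OF ms]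
      show "op_comp ?F ms a bs \<in> I (sum_list ms)"
        unfolding I_def
      proof (intro CollectI conjI ballI)
        show "op_comp ?F ms a bs \<in> carrier (component ?F (sum_list ms))" by (rule F.comp_closed[OF ms a bs])
        fix k assume "k \<in> {1..sum_list ms}"
        then obtain i j where ij: "i < length ms" "j \<in> {1..ms ! i}" "k = offset ms i + j" by (rule block_cases)
        \<comment> \<open>Argument \<open>i\<close> contains the leaf \<open>k\<close>, at its place
          \<open>j\<close>. The other arguments do not contain it; any leaf may be emphasized there,
          and 1 exists because arities are positive.\<close>
        define e where "e q = (if q = i then j else 1)" for q
        have e: "e q \<in> {1..ms ! q}" if "q < length ms" for q using ij(2) pos(3)[OF that] by (auto simp: e_def)
        let ?E = "\<lambda>bs. map (\<lambda>q. emph (e q) (bs ! q)) [0..<length ms]"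
        have Eargs: "op_args ?F2 ms (?E bs)" if "op_args ?F ms bs" for bs
        proof (rule op_argsI)
          fix q assume q: "q < length ms"
          then show "?E bs ! q \<in> carrier (component ?F2 (ms ! q))"
            using keys_emph[OF L, of "bs ! q" "ms ! q" "e q"] op_argsD(2)[OF that q] by simp
        qed simp
        have Ea: "emph (Suc i) a \<in> carrier (component ?F2 (length ms))" if "a \<in> carrier (component ?F (length ms))" for a :: "_ \<Rightarrow>\<^sub>0 'k"
          using keys_emph[OF L] that by simp
        \<comment> \<open>The defect of emphasis with respect to composition. It is linear in each
          variable, so it suffices to place it in the ideal for monomials.\<close>
        let ?D = "\<lambda>a bs. emph k (op_comp ?F ms a bs) - op_comp ?F2 ms (emph (Suc i) a) (?E bs)"
        have "?D a bs \<in> ?J (sum_list ms)"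
        proof (rule set_operad.lin_args_induct[OF set_operad_free ms _ bs[unfolded free_operad_def]], unfold free_operad_def[symmetric])
          note JN = operad_idealD(1)[OF J pos(2), unfolded free_operad_simps]
          show "Poly_Mapping.keys a \<subseteq> polylinear_monomials L (length ms)" using a by simp
          fix bs :: "('f monomial \<Rightarrow>\<^sub>0 'k) list" assume bs: "op_args ?F ms bs"
          show "submodule {a. Poly_Mapping.keys a \<subseteq> polylinear_monomials L (length ms) \<and> ?D a bs \<in> ?J (sum_list ms)} scalars
            (free_module (polylinear_monomials L (length ms)))"
          proof (rule submodule_linear_preimage[OF JN], rule linear_map_free_diff_pointwise)
            show "linear_map (free_module (polylinear_monomials L (length ms))) (free_module (polylinear_monomials (language2 L) (sum_list ms)))
              (\<lambda>a. emph k (op_comp ?F ms a bs))"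
              using linear_map_comp[OF F.comp_linear_left[OF ms bs, unfolded free_operad_simps] linear_map_emph[OF L]] by simp
            show "linear_map (free_module (polylinear_monomials L (length ms))) (free_module (polylinear_monomials (language2 L) (sum_list ms)))
              (\<lambda>a. op_comp ?F2 ms (emph (Suc i) a) (?E bs))"
              using linear_map_comp[OF linear_map_emph[OF L] F2.comp_linear_left[OF ms Eargs[OF bs], unfolded free_operad_simps]] by simp
          qed
          fix a :: "'f monomial \<Rightarrow>\<^sub>0 'k" and p
          assume a: "Poly_Mapping.keys a \<subseteq> polylinear_monomials L (length ms)" and p: "p < length ms"
          have a': "a \<in> carrier (component ?F (length ms))" using a by simp
          show "submodule {b. Poly_Mapping.keys b \<subseteq> polylinear_monomials L (ms ! p) \<and> ?D a (bs[p := b]) \<in> ?J (sum_list ms)} scalars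
            (free_module (polylinear_monomials L (ms ! p)))"
          proof (rule submodule_linear_preimage[OF JN], rule linear_map_free_diff_pointwise)
            show "linear_map (free_module (polylinear_monomials L (ms ! p))) (free_module (polylinear_monomials (language2 L) (sum_list ms)))
              (\<lambda>b. emph k (op_comp ?F ms a (bs[p := b])))"
              using linear_map_comp[OF F.comp_linear_right[OF ms a' bs p, unfolded free_operad_simps] linear_map_emph[OF L]] by simp
            have "?E (bs[p := b]) = (?E bs)[p := emph (e p) b]" for b
              by (rule nth_equalityI) (use p op_argsD(1)[OF bs] in \<open>auto simp: nth_list_update\<close>)
            then show "linear_map (free_module (polylinear_monomials L (ms ! p))) (free_module (polylinear_monomials (language2 L) (sum_list ms)))
              (\<lambda>b. op_comp ?F2 ms (emph (Suc i) a) (?E (bs[p := b])))"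
              using linear_map_comp[OF linear_map_emph[OF L] F2.comp_linear_right[OF ms Ea[OF a'] Eargs[OF bs] p, unfolded free_operad_simps]]
              by simp
          qed
        next
          fix t us assume t: "t \<in> polylinear_monomials L (length ms)"
            and us: "list_all2 (\<lambda>m u. u \<in> polylinear_monomials L m) ms us"
          have len: "length us = length ms" using us by (simp add: list_all2_lengthD)
          have u: "us ! q \<in> polylinear_monomials L (ms ! q)" if "q < length ms" for q
            using us that by (auto simp: list_all2_conv_all_nth)
          let ?us = "map (\<lambda>q. emphasize (e q) (us ! q)) [0..<length ms]"
          have us2: "list_all2 (\<lambda>m u. u \<in> polylinear_monomials (language2 L) m) ms ?us"
            using emphasize_polylinear[OF L u] by (auto simp: list_all2_conv_all_nth)
          note t2 = emphasize_polylinear[OF L t, of "Suc i"]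
          have c: "monomial_comp ms t us \<in> polylinear_monomials L (sum_list ms)"
            by (rule set_operad.set_comp[OF set_operad_free ms t us])
          have c2: "monomial_comp ms (emphasize (Suc i) t) ?us \<in> polylinear_monomials (language2 L) (sum_list ms)"
            by (rule set_operad.set_comp[OF set_operad_free ms t2 us2])
          have "map forget ?us = us" by (rule nth_equalityI) (use len in auto)
          then have fg: "forget (monomial_comp ms (emphasize (Suc i) t) ?us) = monomial_comp ms t us"
            using forget_monomial_comp[of "emphasize (Suc i) t" ?us ms] polylinear_monomialsD(3)[OF t] by simp
          have "head (emphasize (Suc i) t) = Suc i"
            by (rule head_emphasize) (use polylinear_monomialsD(3)[OF t] ij(1) in simp)
          moreover have "head (emphasize (e i) (us ! i)) = j"
            by (rule trans[OF head_emphasize]) (use polylinear_monomialsD(3)[OF u[OF ij(1)]] ij(2) in \<open>simp_all add: e_def\<close>)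
          ultimately have hd: "head (monomial_comp ms (emphasize (Suc i) t) ?us) = k"
            using head_monomial_comp[OF t2 us2] ij(1,3) by simp
          have "head (emphasize k (monomial_comp ms t us)) = k"
            by (rule head_emphasize) (use polylinear_monomialsD(3)[OF c] offset_le[of i ms j] ij in auto)
          \<comment> \<open>The monomials may differ in indices off the path to \<open>k\<close>;
            equal shape and head make them congruent.\<close>
          then have "basis (emphasize k (monomial_comp ms t us)) - basis (monomial_comp ms (emphasize (Suc i) t) ?us) \<in> ?J (sum_list ms)"
            by (intro R.same_shape_congruent[OF emphasize_polylinear[OF L c] c2]) (simp_all add: fg hd)
          moreover have "?E (map basis us) = (map basis ?us :: (_ \<Rightarrow>\<^sub>0 'k) list)"
            by (rule nth_equalityI) (use len in \<open>auto simp: emph_def\<close>)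
          moreover have "multilin_ext (monomial_comp ms) (basis (emphasize (Suc i) t)) (map basis ?us) =
            (basis (monomial_comp ms (emphasize (Suc i) t) ?us) :: _ \<Rightarrow>\<^sub>0 'k)" by (rule multilin_ext_basis)
          moreover have "multilin_ext (monomial_comp ms) (basis t) (map basis us) = (basis (monomial_comp ms t us) :: _ \<Rightarrow>\<^sub>0 'k)"
            by (rule multilin_ext_basis)
          ultimately show "?D (basis t) (map basis us) \<in> ?J (sum_list ms)"
            unfolding free_operad_simps emph_def by (simp only: lin_ext_basis)
        qed
        \<comment> \<open>Whichever part lies in \<open>I\<close>, its emphasized form lies in the
          defining ideal, which absorbs the composite.\<close>
        moreover have "op_comp ?F2 ms (emph (Suc i) a) (?E bs) \<in> ?J (sum_list ms)"
          using ker
        proof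
          assume "a \<in> I (length ms)"
          then have "emph (Suc i) a \<in> ?J (length ms)" using ij(1) by (simp add: I_def)
          then show ?thesis by (rule operad_idealD(3)[OF J ms Ea[OF a] Eargs[OF bs]])
        next
          assume "\<exists>q<length ms. bs ! q \<in> I (ms ! q)"
          then obtain q where q: "q < length ms" "bs ! q \<in> I (ms ! q)" by blast
          then have "?E bs ! q \<in> ?J (ms ! q)" using e[OF q(1)] by (simp add: I_def)
          then show ?thesis by (rule operad_idealD(4)[OF J ms Ea[OF a] Eargs[OF bs] q(1)])
        qed
        ultimately show "emph k (op_comp ?F ms a bs) \<in> ?J (sum_list ms)" using J_sub(3)[OF pos(2)] by fastforce
      qed
    qed
    have gen: "generated_ideal ?F S n \<subseteq> I n"
    proof (rule generated_ideal_least[OF I], rule subsetI)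
      fix m s assume m: "(m::nat) \<ge> 1" and s: "s \<in> S \<inter> carrier (component ?F m)"
      show "s \<in> I m"
        unfolding I_def
      proof (intro CollectI conjI ballI)
        show "s \<in> carrier (component ?F m)" using s by blast
        fix k assume k: "k \<in> {1..m}"
        have "rho (pure_tensor ?F perm_operad m s (basis k)) \<in> J_generators L S"
          unfolding J_generators_def using m s k by blast
        then have "emph k s \<in> J_generators L S" using rho_pure_tensor[of s L m k] s k by simp
        moreover have "emph k s \<in> carrier (component ?F2 m)" using keys_emph[OF L, of s m k] s by simp
        ultimately show "emph k s \<in> ?J m"
          unfolding J_ideal_def by (rule generated_ideal_superset[OF m])
      qed
    qed
    show ?thesis
    proof
      fix x assume x: "x \<in> ?K n"
      then have xc: "Poly_Mapping.keys x \<subseteq> polylinear_monomials (language2 L) n"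
        and xk: "\<And>k. k \<in> {1..n} \<Longrightarrow> psi L n x k \<in> operad_kernel ?F P \<pi> n" using K_iff[OF n] by auto
      \<comment> \<open>A monomial has a single nonzero coordinate, at its head; emphasizing that
        leaf again gives a monomial with the same shape and head.\<close>
      have "x - (\<Sum>k\<in>{1..n}. emph k (psi L n x k)) \<in> ?J n"
        using xc
      proof (induction rule: free_module_induct)
        case zero
        have "psi L n 0 = \<zero>\<^bsub>fun_module (component ?F n) n\<^esub>"
          using linear_map_zero[OF vspace_free_module vspace_fun_module[OF vspace_free_module] linear_map_psi, of L n] by simp
        then show ?case using J_sub(2)[OF n] by (simp add: fun_module_simps emph_def)
      next
        case (basis t)
        have "(\<Sum>k\<in>{1..n}. emph k (psi L n (Defs.basis t) k)) = (\<Sum>k\<in>{1..n}. if k = head t then Defs.basis (emphasize k (forget t)) else 0 :: _ \<Rightarrow>\<^sub>0 'k)"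
          by (rule sum.cong) (auto simp: psi_basis[OF basis] delta_fun_def emph_def)
        also have "\<dots> = Defs.basis (emphasize (head t) (forget t))" using head_polylinear[OF basis] by simp
        finally have eq: "(\<Sum>k\<in>{1..n}. emph k (psi L n (Defs.basis t) k)) = (Defs.basis (emphasize (head t) (forget t)) :: _ \<Rightarrow>\<^sub>0 'k)" .
        have "head (emphasize (head t) (forget t)) = head t"
          by (rule head_emphasize) (use head_in_leaves[OF polylinear_monomialsD(1)[OF basis]] in simp)
        then show ?case unfolding eq
          using emphasize_polylinear[OF L forget_polylinear[OF basis]] basis by (intro R.same_shape_congruent) simp_all
      next
        case (add p q)
        have "psi L n (p + q) = psi L n p \<oplus>\<^bsub>fun_module (component ?F n) n\<^esub> psi L n q"
          using linear_mapD(2)[OF linear_map_psi, of p L n q] add(1,2) by simp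
        then have "(\<Sum>k\<in>{1..n}. emph k (psi L n (p + q) k)) = (\<Sum>k\<in>{1..n}. emph k (psi L n p k)) + (\<Sum>k\<in>{1..n}. emph k (psi L n q k))"
          by (simp add: fun_module_simps emph_def lin_ext_add sum.distrib)
        then show ?case using J_sub(3)[OF n add(3,4)] by (simp add: algebra_simps)
      next
        case (scale c p)
        have "psi L n (pm_scale c p) = c \<odot>\<^bsub>fun_module (component ?F n) n\<^esub> psi L n p"
          using linear_mapD(3)[OF linear_map_psi, of p L n c] scale(1) by simp
        then have "(\<Sum>k\<in>{1..n}. emph k (psi L n (pm_scale c p) k)) = pm_scale c (\<Sum>k\<in>{1..n}. emph k (psi L n p k))"
          by (simp add: fun_module_simps emph_def lin_ext_scale pm_scale_sum)
        then show ?case using J_sub(4)[OF n scale(2), of c] by (simp add: pm_scale_diff_right)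
      qed
      moreover have "(\<Sum>k\<in>{1..n}. emph k (psi L n x k)) \<in> ?J n"
      proof (rule J_sub(6)[OF n])
        fix k assume k: "k \<in> {1..n}"
        have "psi L n x k \<in> I n" using xk[OF k] S n gen by auto
        then show "emph k (psi L n x k) \<in> ?J n" using k by (simp add: I_def)
      qed
      ultimately show "x \<in> ?J n" using J_sub(3)[OF n] by fastforce
    qed
  qed
  ultimately show ?thesis by blast
qed

section \<open>Comparison of the two quotients over the operad of coordinates\<close>

theorem theorem1:
  fixes L :: "'f language"
    and P :: "('k::field, 'a) operad"
    and \<pi> :: "nat \<Rightarrow> ('f monomial \<Rightarrow>\<^sub>0 'k) \<Rightarrow> 'a"
    and S :: "('f monomial \<Rightarrow>\<^sub>0 'k) set"
  assumes "language L"
    and "operad P"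
    and "quotient_morphism (free_operad L) P \<pi>"
    and "S \<subseteq> (\<Union>n\<in>{1..}. carrier (component (free_operad L) n))"
    and "\<forall>n\<ge>1. operad_kernel (free_operad L) P \<pi> n = generated_ideal (free_operad L) S n"
  shows "(\<forall>n\<ge>1. operad_kernel (free_operad (language2 L)) (di P) (pi2 L P \<pi>) n =
                operad_kernel (free_operad (language2 L)) (P2 L S) (pi2_hat L S) n) \<and>
         operads_isomorphic (P2 L S) (di P)"
proof -
  let ?F = "free_operad L :: ('k, 'f monomial \<Rightarrow>\<^sub>0 'k) operad"
  let ?F2 = "free_operad (language2 L) :: ('k, ('f \<times> nat) monomial \<Rightarrow>\<^sub>0 'k) operad"
  let ?\<Psi> = "\<lambda>n x. coord_map \<pi> n (psi L n x)"
  have P: "pre_operad P" by (rule operad_pre_operad[OF assms(2)])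
  have pi: "\<pi> \<in> operad_hom ?F P"
    and surj: "\<And>n. n \<ge> 1 \<Longrightarrow> \<pi> n ` carrier (component ?F n) = carrier (component P n)"
    using assms(3) by (auto simp: quotient_morphism_def)
  interpret F: pre_operad ?F by (rule pre_operad_free)
  interpret F2: pre_operad ?F2 by (rule pre_operad_free)
  interpret P: pre_operad P by (rule P)
  interpret CP: pre_operad "coord_operad P" by (rule P.pre_operad_coord)
  interpret QP: operad_quotient "product_linearization P perm_operad" "coord_operad P" "coords P" "hadamard_relations P perm_operad"
    by (rule di_quotient[OF P])
  \<comment> \<open>With this, \<open>P2 L S\<close> is the quotient by the kernel of a surjective
    morphism onto \<open>coord_operad P\<close>.\<close>
  interpret Q: operad_quotient ?F2 "coord_operad P" ?\<Psi> "J_ideal L S"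
  proof
    show Psi: "?\<Psi> \<in> operad_hom ?F2 (coord_operad P)"
      by (rule operad_hom_comp[OF psi_hom coord_map_hom[OF F.pre_operad_axioms P pi]])
    fix n :: nat assume n: "n \<ge> 1"
    show "J_ideal L S n = operad_kernel ?F2 (coord_operad P) ?\<Psi> n"
      by (rule J_ideal_eq_kernel[OF assms(1) P pi assms(5) n])
    show "?\<Psi> n ` carrier (component ?F2 n) = carrier (component (coord_operad P) n)"
    proof (intro equalityI subsetI)
      show "G \<in> carrier (component (coord_operad P) n)" if "G \<in> ?\<Psi> n ` carrier (component ?F2 n)" for G
        using that linear_mapD(1)[OF operad_homD(1)[OF Psi n]] by blast
      fix G assume G: "G \<in> carrier (component (coord_operad P) n)"
      have "\<exists>a. k \<in> {1..n} \<longrightarrow> a \<in> carrier (component ?F n) \<and> \<pi> n a = G k" for k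
      proof (cases "k \<in> {1..n}")
        case True
        have "G k \<in> \<pi> n ` carrier (component ?F n)"
          unfolding surj[OF n] using fun_module_mem[OF _ True] G by simp
        then obtain b where "G k = \<pi> n b" "b \<in> carrier (component ?F n)" by (rule imageE)
        then show ?thesis by (intro exI[of _ b]) simp
      next
        case False
        then show ?thesis by blast
      qed
      then obtain a where a: "\<And>k. k \<in> {1..n} \<Longrightarrow> a k \<in> carrier (component ?F n) \<and> \<pi> n (a k) = G k" by metis
      \<comment> \<open>Preimages under \<open>\<pi>\<close> of the coordinates of \<open>G\<close>,
        each emphasized at its own leaf, so that no two of them contribute to the same
        coordinate.\<close>
      define x where "x = (\<Sum>k\<in>{1..n}. emph k (a k))"
      have e: "Poly_Mapping.keys (emph k (a k)) \<subseteq> polylinear_monomials (language2 L) n" if "k \<in> {1..n}" for k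
        by (rule keys_emph[OF assms(1)]) (use a[OF that] in simp)
      have "Poly_Mapping.keys x \<subseteq> polylinear_monomials (language2 L) n"
        unfolding x_def by (rule keys_sum_subset) (rule e)
      then have x: "x \<in> carrier (component ?F2 n)" by simp
      have "psi L n x l = a l" if l: "l \<in> {1..n}" for l
      proof -
        let ?M = "free_module (polylinear_monomials L n) :: ('k, _) module"
        interpret M: module scalars ?M by (rule vspace_free_module)
        have lin: "linear_map (free_module (polylinear_monomials (language2 L) n)) ?M (\<lambda>x. psi L n x l)"
          by (rule linear_map_comp[OF linear_map_psi linear_map_eval[OF l]])
        have "x = finsum (free_module (polylinear_monomials (language2 L) n)) (\<lambda>k. emph k (a k)) {1..n}"
          unfolding x_def by (rule finsum_free_module[symmetric]) (use e in auto)
        then have "psi L n x l = finsum ?M (\<lambda>k. psi L n (emph k (a k)) l) {1..n}"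
          using linear_map_finsum[OF vspace_free_module vspace_free_module lin, of "\<lambda>k. emph k (a k)" "{1..n}"] e by simp
        also have "\<dots> = finsum ?M (\<lambda>k. if k = l then a l else \<zero>\<^bsub>?M\<^esub>) {1..n}"
        proof (rule M.finsum_cong')
          have ak: "Poly_Mapping.keys (a k) \<subseteq> polylinear_monomials L n" if "k \<in> {1..n}" for k
            using a[OF that] by simp
          show "psi L n (emph k (a k)) l = (if k = l then a l else \<zero>\<^bsub>?M\<^esub>)" if "k \<in> {1..n}" for k
            unfolding psi_emph[OF assms(1) ak[OF that] that] using l by (simp add: delta_fun_def)
          show "(\<lambda>k. if k = l then a l else \<zero>\<^bsub>?M\<^esub>) \<in> {1..n} \<rightarrow> carrier ?M"
            using ak[OF l] by simp
        qed simp
        also have "\<dots> = a l" by (rule finsum_delta[OF vspace_free_module _ l]) (use a[OF l] in auto)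
        finally show ?thesis .
      qed
      then have "?\<Psi> n x = G"
        by (intro fun_module_eqI[of _ "component P n" n])
          (use a G linear_mapD(1)[OF operad_homD(1)[OF Psi n] x] in \<open>auto simp: coord_map_def\<close>)
      then show "G \<in> ?\<Psi> n ` carrier (component ?F2 n)" using x by blast
    qed
  qed
  \<comment> \<open>Membership in either kernel means that the same coordinates vanish in
    \<open>P\<close>, by \<open>pi2_coords\<close> on one side and \<open>proj_zero_iff\<close> on
    the other.\<close>
  have "operad_kernel ?F2 (di P) (pi2 L P \<pi>) n = operad_kernel ?F2 (P2 L S) (pi2_hat L S) n" if n: "n \<ge> 1" for n
  proof (rule Set.set_eqI)
    fix x
    show "x \<in> operad_kernel ?F2 (di P) (pi2 L P \<pi>) n \<longleftrightarrow> x \<in> operad_kernel ?F2 (P2 L S) (pi2_hat L S) n"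
      using pi2_coords[OF assms(1) P pi n, of x] Q.proj_zero_iff[OF n, of x]
      unfolding operad_kernel_iff P2_def pi2_hat_def by blast
  qed
  moreover have "operads_isomorphic (P2 L S) (di P)"
    unfolding P2_def hadamard_def
    by (rule operads_isomorphicI[OF Q.induced_iso QP.induced_iso QP.closed_operations_quot])
  ultimately show ?thesis by blast
qed

end
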